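(* Let $E$ be a left $A$-module and $q$ a full quantization for $(E,E)$. The $\Bbbk[h]$-module $\mathrm{Symb}^\bullet_d(E,E)[h]$ equipped with the formal star product $\hat\star$ corresponding to $q$ forms a unital associative filtered $\Bbbk[h]$-algebra, where the filtration is given by the partial sums $$\bigoplus_{k=0}^n\mathrm{Symb}^k_d(E,E)[h].$$ In particular, for all $a\in\mathrm{Symb}^n_d(E,E)$ and $b\in\mathrm{Symb}^m_d(E,E)$, we have $$a\,\hat\star\,b-a\cdot b\in h\bigoplus_{k=0}^{m+n-1}\mathrm{Symb}^k_d(E,E)[h].$$ Thus $\hat\star$ agrees with the symbol multiplication $\cdot$ up to order $0$ in $h$, i.e. $a\,\hat\star\,b=a\cdot b+O(h)$.
   Context: **Setting.** $\Bbbk$ is a commutative unital ring, $A$ an associative unital $\Bbbk$-algebra, $\otimes=\otimes_\Bbbk$. $(\Omega^\bullet_d,\wedge,d)$ is an exterior algebra over $A$: a differential graded $\Bbbk$-algebra with $\Omega^0_d=A$, generated by $A$ and $dA$, $d$ satisfying the graded Leibniz rule. $\Omega^k_dE=\Omega^k_d\otimes_AE$. **Jets.** For a left $A$-module $E$, $J^1_dE=(A\otimes E)/\{\sum_ia_i\otimes e_i:\sum_ia_ie_i=0,\ \sum_ida_i\otimes_Ae_i=0\}$, with $a[b\otimes e]=[ab\otimes e]$, functorial in $E$; $j^1_{d,E}(e)=[1\otimes e]$. Put $J^0_dE=E$, $l^1=\mathrm{id}$, $j^0=\mathrm{id}$; for $n\ge2$, $l^n_{d,E}\colon J^n_dE\hookrightarrow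 J^1_dJ^{n-1}_dE$ is the inclusion of the left $A$-submodule of those $x$ such that $J^1_d(l^{n-1}_{d,E})(x)\in J^1_dJ^1_dJ^{n-2}_dE$ is annihilated by both maps $[a\otimes[c\otimes e]]\mapsto a\,dc\otimes_Ae\in\Omega^1_dJ^{n-2}_dE$ and $[a\otimes[c\otimes e]]\mapsto da\wedge dc\otimes_Ae\in\Omega^2_dJ^{n-2}_dE$. The prolongation $j^n_{d,E}\colon E\to J^n_dE$ is the $\Bbbk$-linear map with $l^n_{d,E}\circ j^n_{d,E}=j^1_{d,J^{n-1}_dE}\circ j^{n-1}_{d,E}$. **Differential operators and symbols.** $\mathrm{Diff}^n_d(E,F)$ is the set of $\Bbbk$-linear $\Delta\colon E\to F$ for which there is a left $A$-linear $\widetilde\Delta\colon J^n_dE\to F$ with $\widetilde\Delta\circ j^n_{d,E}=\Delta$; $\mathrm{Diff}^{n-1}_d\subseteq\mathrm{Diff}^n_d$, $\mathrm{Diff}^{-1}_d=0$, $\mathrm{Diff}_d=\bigcup_n\mathrm{Diff}^n_d$. The composition of operators of order at most $n$ and $m$ has order at most $n+m$. $\mathrm{Symb}^n_d(E,F)=\mathrm{Diff}^n_d(E,F)/\mathrm{Diff}^{n-1}_d(E,F)$ with quotient map $\varsigma^n_d$; $\mathrm{Symb}^\bullet_d=\bigoplus_n\mathrm{Symb}^n_d$. The symbol multiplication on $\mathrm{Symb}^\bullet_d(E,E)$ is $\varsigma^n_d(\Delta_1)\cdot\varsigma^m_d(\Delta_2)=\varsigma^{n+m}_d(\Delta_1\circ\Delta_2)$.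 **Quantizations.** An $n$-quantization for $(E,E)$ is an ${}_A\mathrm{Hom}(E,E)$-linear (for postcomposition) map $q^n\colon\mathrm{Symb}^n_d(E,E)\to\mathrm{Diff}^n_d(E,E)$ with $\varsigma^n_d\circ q^n=\mathrm{id}$. A full quantization is $q=\sum_nq^n\colon\mathrm{Symb}^\bullet_d(E,E)\to\mathrm{Diff}_d(E,E)$ for a collection $\{q^n\}_{n\in\mathbb N}$ of $n$-quantizations. **Truncation.** For $\Delta\in\mathrm{Diff}^n_d(E,E)$ put $\Delta_{\le k}:=\Delta$ for $k\ge n$ and recursively $\Delta_{\le k}:=\Delta_{\le k+1}-q^{k+1}(\varsigma^{k+1}_d(\Delta_{\le k+1}))$ for $0\le k<n$ (independent of the choice of $n$); then $\Delta_{\le k}\in\mathrm{Diff}^k_d(E,E)$. Put $[\Delta]^k_q:=\varsigma^k_d(\Delta_{\le k})$. **Formal star product.** For a $\Bbbk$-module $M$, $M[h]=M\otimes\Bbbk[h]$. The formal star product corresponding to $q$ is the $\Bbbk[h]$-bilinear operation $\hat\star$ on $\mathrm{Symb}^\bullet_d(E,E)[h]$ extending $$a\star b=\sum_{k=0}^{n+m}h^k\,[q^n(a)\circ q^m(b)]^{n+m-k}_q,\qquad a\in\mathrm{Symb}^n_d(E,E),\ b\in\mathrm{Symb}^m_d(E,E).$$ *)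

theory Defs
  imports "HOL-Algebra.UnivPoly" "HOL-Algebra.Generated_Rings" "HOL-Algebra.AbelCoset"
    "HOL-Library.FuncSet"
begin

section \<open>Modules and algebras over possibly noncommutative rings\<close>

text \<open>
  The locale \<open>Module.module\<close> of HOL-Algebra requires a commutative ring of scalars. Its record type
  is reused here for left modules over arbitrary rings. For a record that is only a module, the
  fields \<^const>\<open>mult\<close> and \<^const>\<open>one\<close> are irrelevant and set to \<^const>\<open>undefined\<close>.
\<close>

locale left_module = R?: ring R + M?: abelian_group M
  for R :: "('a, 'c) ring_scheme" (structure) and M :: "('a, 'b, 'd) module_scheme" (structure) +
  assumes smult_closed:
      "\<lbrakk>a \<in> carrier R; x \<in> carrier M\<rbrakk> \<Longrightarrow> a \<odot>\<^bsub>M\<^esub> x \<in> carrier M"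
    and smult_l_distr:
      "\<lbrakk>a \<in> carrier R; b \<in> carrier R; x \<in> carrier M\<rbrakk> \<Longrightarrow>
        (a \<oplus>\<^bsub>R\<^esub> b) \<odot>\<^bsub>M\<^esub> x = a \<odot>\<^bsub>M\<^esub> x \<oplus>\<^bsub>M\<^esub> b \<odot>\<^bsub>M\<^esub> x"
    and smult_r_distr:
      "\<lbrakk>a \<in> carrier R; x \<in> carrier M; y \<in> carrier M\<rbrakk> \<Longrightarrow>
        a \<odot>\<^bsub>M\<^esub> (x \<oplus>\<^bsub>M\<^esub> y) = a \<odot>\<^bsub>M\<^esub> x \<oplus>\<^bsub>M\<^esub> a \<odot>\<^bsub>M\<^esub> y"
    and smult_assoc:
      "\<lbrakk>a \<in> carrier R; b \<in> carrier R; x \<in> carrier M\<rbrakk> \<Longrightarrow>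
        (a \<otimes>\<^bsub>R\<^esub> b) \<odot>\<^bsub>M\<^esub> x = a \<odot>\<^bsub>M\<^esub> (b \<odot>\<^bsub>M\<^esub> x)"
    and smult_one: "x \<in> carrier M \<Longrightarrow> \<one>\<^bsub>R\<^esub> \<odot>\<^bsub>M\<^esub> x = x"

locale assoc_algebra = Module.module K S + ring S
  for K :: "('a, 'c) ring_scheme" (structure) and S :: "('a, 'b, 'd) module_scheme" (structure) +
  assumes smult_mult_left:
      "\<lbrakk>k \<in> carrier K; x \<in> carrier S; y \<in> carrier S\<rbrakk> \<Longrightarrow>
        (k \<odot>\<^bsub>S\<^esub> x) \<otimes>\<^bsub>S\<^esub> y = k \<odot>\<^bsub>S\<^esub> (x \<otimes>\<^bsub>S\<^esub> y)"
    and smult_mult_right: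
      "\<lbrakk>k \<in> carrier K; x \<in> carrier S; y \<in> carrier S\<rbrakk> \<Longrightarrow>
        x \<otimes>\<^bsub>S\<^esub> (k \<odot>\<^bsub>S\<^esub> y) = k \<odot>\<^bsub>S\<^esub> (x \<otimes>\<^bsub>S\<^esub> y)"

locale filtered_algebra = assoc_algebra K S
  for K :: "('a, 'c) ring_scheme" (structure) and S :: "('a, 'b, 'd) module_scheme" (structure)
    and F :: "nat \<Rightarrow> 'b set" +
  assumes filt_submodule: "submodule (F n) K S"
    and filt_mono: "F n \<subseteq> F (Suc n)"
    and filt_exhaustive: "(\<Union>n. F n) = carrier S"
    and filt_one: "\<one>\<^bsub>S\<^esub> \<in> F 0"
    and filt_mult: "\<lbrakk>x \<in> F n; y \<in> F m\<rbrakk> \<Longrightarrow> x \<otimes>\<^bsub>S\<^esub> y \<in> F (n + m)"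

definition lin_map ::
  "('r, 'z) ring_scheme \<Rightarrow> ('r, 'm, 'y) module_scheme \<Rightarrow> ('r, 'n, 'x) module_scheme \<Rightarrow>
    ('m \<Rightarrow> 'n) \<Rightarrow> bool"
  where "lin_map R M N f \<longleftrightarrow>
    f \<in> carrier M \<rightarrow> carrier N \<and>
    (\<forall>x\<in>carrier M. \<forall>y\<in>carrier M. f (x \<oplus>\<^bsub>M\<^esub> y) = f x \<oplus>\<^bsub>N\<^esub> f y) \<and>
    (\<forall>r\<in>carrier R. \<forall>x\<in>carrier M. f (r \<odot>\<^bsub>M\<^esub> x) = r \<odot>\<^bsub>N\<^esub> f x)"

definition quot_module :: "('r, 'm, 'z) module_scheme \<Rightarrow> 'm set \<Rightarrow> ('r, 'm set) module"
  where "quot_module M N =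
    \<lparr>carrier = a_rcosets\<^bsub>M\<^esub> N, mult = undefined, one = undefined, zero = N, add = set_add M,
     smult = (\<lambda>r X. \<Union>x\<in>X. N +>\<^bsub>M\<^esub> (r \<odot>\<^bsub>M\<^esub> x))\<rparr>"

definition direct_sum :: "(nat \<Rightarrow> ('r, 'm, 'z) module_scheme) \<Rightarrow> ('r, nat \<Rightarrow> 'm) module"
  where "direct_sum M =
    \<lparr>carrier = {s. (\<forall>n. s n \<in> carrier (M n)) \<and> finite {n. s n \<noteq> \<zero>\<^bsub>M n\<^esub>}},
     mult = undefined, one = undefined,
     zero = (\<lambda>n. \<zero>\<^bsub>M n\<^esub>), add = (\<lambda>s t n. s n \<oplus>\<^bsub>M n\<^esub> t n), smult = (\<lambda>r s n. r \<odot>\<^bsub>M n\<^esub> s n)\<rparr>"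

definition direct_sum_incl ::
  "(nat \<Rightarrow> ('r, 'm, 'z) module_scheme) \<Rightarrow> nat \<Rightarrow> 'm \<Rightarrow> nat \<Rightarrow> 'm"
  where "direct_sum_incl M n a = (\<lambda>i. if i = n then a else \<zero>\<^bsub>M i\<^esub>)"

definition transport_module :: "('m \<Rightarrow> 'n) \<Rightarrow> ('r, 'm, 'z) module_scheme \<Rightarrow> ('r, 'n) module"
  where "transport_module f M = (let g = inv_into (carrier M) f in
    \<lparr>carrier = f ` carrier M, mult = undefined, one = undefined, zero = f \<zero>\<^bsub>M\<^esub>,
     add = (\<lambda>x y. f (g x \<oplus>\<^bsub>M\<^esub> g y)), smult = (\<lambda>r x. f (r \<odot>\<^bsub>M\<^esub> g x))\<rparr>)"

subsection \<open>Tensor products\<close>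

text \<open>
  \<open>X \<otimes>\<^sub>R M\<close> is presented by generators and relations: the list \<open>[(x\<^sub>1, m\<^sub>1), \<dots>, (x\<^sub>n, m\<^sub>n)]\<close> stands
  for the formal sum of the \<open>x\<^sub>i \<otimes> m\<^sub>i\<close>. No formal negatives are needed, as \<open>-(x \<otimes> m) = (-x) \<otimes> m\<close>.
  Here \<open>X\<close> is a \<^emph>\<open>right\<close> \<open>R\<close>-module, stored in a \<open>module\<close> record with \<open>r \<odot>\<^bsub>X\<^esub> x\<close> meaning \<open>x r\<close>.
\<close>

definition formal_sums ::
  "('x, 'c) partial_object_scheme \<Rightarrow> ('m, 'z) partial_object_scheme \<Rightarrow> ('x \<times> 'm) list set"
  where "formal_sums X M = lists (carrier X \<times> carrier M)"

inductive tensor_eq ::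
  "('r, 'b) ring_scheme \<Rightarrow> ('r, 'x, 'c) module_scheme \<Rightarrow> ('r, 'm, 'z) module_scheme \<Rightarrow>
    ('x \<times> 'm) list \<Rightarrow> ('x \<times> 'm) list \<Rightarrow> bool"
  for R X M where
  refl: "u \<in> formal_sums X M \<Longrightarrow> tensor_eq R X M u u"
| sym: "tensor_eq R X M u v \<Longrightarrow> tensor_eq R X M v u"
| trans: "tensor_eq R X M u v \<Longrightarrow> tensor_eq R X M v w \<Longrightarrow> tensor_eq R X M u w"
| append: "tensor_eq R X M u u' \<Longrightarrow> tensor_eq R X M v v' \<Longrightarrow> tensor_eq R X M (u @ v) (u' @ v')"
| commute: "u \<in> formal_sums X M \<Longrightarrow> v \<in> formal_sums X M \<Longrightarrow> tensor_eq R X M (u @ v) (v @ u)"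
| zero: "m \<in> carrier M \<Longrightarrow> tensor_eq R X M [(\<zero>\<^bsub>X\<^esub>, m)] []"
| add_left: "x \<in> carrier X \<Longrightarrow> y \<in> carrier X \<Longrightarrow> m \<in> carrier M \<Longrightarrow>
    tensor_eq R X M [(x \<oplus>\<^bsub>X\<^esub> y, m)] [(x, m), (y, m)]"
| add_right: "x \<in> carrier X \<Longrightarrow> m \<in> carrier M \<Longrightarrow> n \<in> carrier M \<Longrightarrow>
    tensor_eq R X M [(x, m \<oplus>\<^bsub>M\<^esub> n)] [(x, m), (x, n)]"
| balanced: "r \<in> carrier R \<Longrightarrow> x \<in> carrier X \<Longrightarrow> m \<in> carrier M \<Longrightarrow>
    tensor_eq R X M [(r \<odot>\<^bsub>X\<^esub> x, m)] [(x, r \<odot>\<^bsub>M\<^esub> m)]"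

definition tensor_cls ::
  "('r, 'b) ring_scheme \<Rightarrow> ('r, 'x, 'c) module_scheme \<Rightarrow> ('r, 'm, 'z) module_scheme \<Rightarrow>
    ('x \<times> 'm) list \<Rightarrow> ('x \<times> 'm) list set"
  where "tensor_cls R X M u = {v. tensor_eq R X M u v}"

text \<open>
  The argument \<open>act\<close> gives the scalar multiplication on pure tensors of a further module
  structure inherited from one of the factors; its scalars need not be those of \<open>R\<close>.
\<close>

definition tensor ::
  "('r, 'b) ring_scheme \<Rightarrow> ('r, 'x, 'c) module_scheme \<Rightarrow> ('r, 'm, 'z) module_scheme \<Rightarrow>
    ('s \<Rightarrow> 'x \<times> 'm \<Rightarrow> 'x \<times> 'm) \<Rightarrow> ('s, ('x \<times> 'm) list set) module"
  where "tensor R X M act =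
    \<lparr>carrier = tensor_cls R X M ` formal_sums X M, mult = undefined, one = undefined,
     zero = tensor_cls R X M [],
     add = (\<lambda>U V. \<Union>u\<in>U. \<Union>v\<in>V. tensor_cls R X M (u @ v)),
     smult = (\<lambda>s U. \<Union>u\<in>U. tensor_cls R X M (map (act s) u))\<rparr>"

section \<open>First-order differential calculi and their exterior algebras\<close>

text \<open>
  The differential graded algebra of forms is a single algebra with an internal grading, whose
  degree \<open>0\<close> part is the algebra \<open>A\<close>.
\<close>

record ('k, 'w) dga =
  scalars :: "'k ring"
  forms :: "('k, 'w) module"
  degree_part :: "nat \<Rightarrow> 'w set"
  extd :: "'w \<Rightarrow> 'w"

definition alg :: "('k, 'w) dga \<Rightarrow> ('k, 'w) module"
  where "alg D = (forms D)\<lparr>carrier := degree_part D 0\<rparr>"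

text \<open>
  In \<open>generated\<close>, generation as a ring is the same as generation as an algebra over the scalars, as
  the scalar multiples of \<open>1\<close> lie in degree \<open>0\<close>.
\<close>

locale exterior_algebra =
  fixes D :: "('k, 'w) dga"
  assumes algebra: "assoc_algebra (scalars D) (forms D)"
    and degree_submodule: "submodule (degree_part D n) (scalars D) (forms D)"
    and grading: "\<omega> \<in> carrier (forms D) \<Longrightarrow>
      \<exists>!f. (\<forall>n. f n \<in> degree_part D n) \<and> finite {n. f n \<noteq> \<zero>\<^bsub>forms D\<^esub>} \<and>
        \<omega> = (\<Oplus>\<^bsub>forms D\<^esub> n \<in> {n. f n \<noteq> \<zero>\<^bsub>forms D\<^esub>}. f n)"
    and degree_one: "\<one>\<^bsub>forms D\<^esub> \<in> degree_part D 0"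
    and degree_mult: "\<lbrakk>\<omega> \<in> degree_part D n; \<eta> \<in> degree_part D m\<rbrakk> \<Longrightarrow>
      \<omega> \<otimes>\<^bsub>forms D\<^esub> \<eta> \<in> degree_part D (n + m)"
    and d_linear: "lin_map (scalars D) (forms D) (forms D) (extd D)"
    and d_degree: "\<omega> \<in> degree_part D n \<Longrightarrow> extd D \<omega> \<in> degree_part D (Suc n)"
    and d_d: "\<omega> \<in> carrier (forms D) \<Longrightarrow> extd D (extd D \<omega>) = \<zero>\<^bsub>forms D\<^esub>"
    and d_leibniz: "\<lbrakk>\<omega> \<in> degree_part D n; \<eta> \<in> carrier (forms D)\<rbrakk> \<Longrightarrow>
      extd D (\<omega> \<otimes>\<^bsub>forms D\<^esub> \<eta>) = extd D \<omega> \<otimes>\<^bsub>forms D\<^esub> \<eta> \<oplus>\<^bsub>forms D\<^esub>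
        (if even n then \<omega> \<otimes>\<^bsub>forms D\<^esub> extd D \<eta> else \<ominus>\<^bsub>forms D\<^esub> (\<omega> \<otimes>\<^bsub>forms D\<^esub> extd D \<eta>))"
    and generated:
      "generate_ring (forms D) (degree_part D 0 \<union> extd D ` degree_part D 0) = carrier (forms D)"

text \<open>A left \<open>A\<close>-module regarded as a module over the scalars.\<close>

definition restrict_scalars :: "('k, 'w) dga \<Rightarrow> ('w, 'm) module \<Rightarrow> ('k, 'm) module"
  where "restrict_scalars D M =
    \<lparr>carrier = carrier M, mult = undefined, one = undefined, zero = \<zero>\<^bsub>M\<^esub>, add = add M,
     smult = (\<lambda>k x. (k \<odot>\<^bsub>forms D\<^esub> \<one>\<^bsub>forms D\<^esub>) \<odot>\<^bsub>M\<^esub> x)\<rparr>"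

text \<open>\<open>\<Omega>\<^sup>k\<close> with its \<^emph>\<open>right\<close> \<open>A\<close>-module structure.\<close>

definition right_forms :: "('k, 'w) dga \<Rightarrow> nat \<Rightarrow> ('w, 'w) module"
  where "right_forms D k =
    \<lparr>carrier = degree_part D k, mult = undefined, one = undefined, zero = \<zero>\<^bsub>forms D\<^esub>,
     add = add (forms D), smult = (\<lambda>a \<omega>. \<omega> \<otimes>\<^bsub>forms D\<^esub> a)\<rparr>"

definition forms_with_coeffs ::
  "('k, 'w) dga \<Rightarrow> nat \<Rightarrow> ('w, 'm) module \<Rightarrow> ('w, ('w \<times> 'm) list set) module"
  where "forms_with_coeffs D k M =
    tensor (alg D) (right_forms D k) M (\<lambda>a. apfst (\<lambda>\<omega>. a \<otimes>\<^bsub>forms D\<^esub> \<omega>))"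

definition forms_cls ::
  "('k, 'w) dga \<Rightarrow> nat \<Rightarrow> ('w, 'm) module \<Rightarrow> ('w \<times> 'm) list \<Rightarrow> ('w \<times> 'm) list set"
  where "forms_cls D k M = tensor_cls (alg D) (right_forms D k) M"

section \<open>Jets\<close>

subsection \<open>The 1-jet functor\<close>

definition free_jet :: "('k, 'w) dga \<Rightarrow> ('w, 'm) module \<Rightarrow> ('w, ('w \<times> 'm) list set) module"
  where "free_jet D M =
    tensor (scalars D) (alg D) (restrict_scalars D M) (\<lambda>a. apfst (\<lambda>b. a \<otimes>\<^bsub>forms D\<^esub> b))"

definition free_jet_cls ::
  "('k, 'w) dga \<Rightarrow> ('w, 'm) module \<Rightarrow> ('w \<times> 'm) list \<Rightarrow> ('w \<times> 'm) list set"
  where "free_jet_cls D M = tensor_cls (scalars D) (alg D) (restrict_scalars D M)"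

definition jet1_relations :: "('k, 'w) dga \<Rightarrow> ('w, 'm) module \<Rightarrow> ('w \<times> 'm) list set set"
  where "jet1_relations D M = free_jet_cls D M ` {l \<in> formal_sums (alg D) M.
    foldr (\<lambda>(a, e) s. a \<odot>\<^bsub>M\<^esub> e \<oplus>\<^bsub>M\<^esub> s) l \<zero>\<^bsub>M\<^esub> = \<zero>\<^bsub>M\<^esub> \<and>
    forms_cls D 1 M (map (apfst (extd D)) l) = \<zero>\<^bsub>forms_with_coeffs D 1 M\<^esub>}"

definition jet1 :: "('k, 'w) dga \<Rightarrow> ('w, 'm) module \<Rightarrow> ('w, ('w \<times> 'm) list set set) module"
  where "jet1 D M = quot_module (free_jet D M) (jet1_relations D M)"

text \<open>The element \<open>\<Sum>\<^sub>i [a\<^sub>i \<otimes> e\<^sub>i]\<close> for the list of pairs \<open>(a\<^sub>i, e\<^sub>i)\<close>.\<close>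

definition jet1_cls ::
  "('k, 'w) dga \<Rightarrow> ('w, 'm) module \<Rightarrow> ('w \<times> 'm) list \<Rightarrow> ('w \<times> 'm) list set set"
  where "jet1_cls D M l = jet1_relations D M +>\<^bsub>free_jet D M\<^esub> free_jet_cls D M l"

definition jet1_rep ::
  "('k, 'w) dga \<Rightarrow> ('w, 'm) module \<Rightarrow> ('w \<times> 'm) list set set \<Rightarrow> ('w \<times> 'm) list"
  where "jet1_rep D M X = (SOME l. l \<in> formal_sums (alg D) M \<and> jet1_cls D M l = X)"

definition prolong1 :: "('k, 'w) dga \<Rightarrow> ('w, 'm) module \<Rightarrow> 'm \<Rightarrow> ('w \<times> 'm) list set set"
  where "prolong1 D M e = jet1_cls D M [(\<one>\<^bsub>forms D\<^esub>, e)]"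

text \<open>
  The following three maps are given on generators. They are evaluated on a chosen representative;
  the values do not depend on the choice (for \<open>jet1_map\<close>, when \<open>f\<close> is left \<open>A\<close>-linear).
\<close>

definition jet1_map ::
  "('k, 'w) dga \<Rightarrow> ('w, 'm) module \<Rightarrow> ('w, 'n) module \<Rightarrow> ('m \<Rightarrow> 'n) \<Rightarrow>
    ('w \<times> 'm) list set set \<Rightarrow> ('w \<times> 'n) list set set"
  where "jet1_map D M N f X = jet1_cls D N (map (apsnd f) (jet1_rep D M X))"

text \<open>\<open>[a \<otimes> [c \<otimes> e]] \<mapsto> a dc \<otimes> e\<close>\<close>

definition holonomy1 ::
  "('k, 'w) dga \<Rightarrow> ('w, 'm) module \<Rightarrow>
    ('w \<times> ('w \<times> 'm) list set set) list set set \<Rightarrow> ('w \<times> 'm) list set"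
  where "holonomy1 D M X = forms_cls D 1 M
    (concat (map (\<lambda>(a, x). map (apfst (\<lambda>c. a \<otimes>\<^bsub>forms D\<^esub> extd D c)) (jet1_rep D M x))
      (jet1_rep D (jet1 D M) X)))"

text \<open>\<open>[a \<otimes> [c \<otimes> e]] \<mapsto> da \<and> dc \<otimes> e\<close>\<close>

definition holonomy2 ::
  "('k, 'w) dga \<Rightarrow> ('w, 'm) module \<Rightarrow>
    ('w \<times> ('w \<times> 'm) list set set) list set set \<Rightarrow> ('w \<times> 'm) list set"
  where "holonomy2 D M X = forms_cls D 2 M
    (concat (map (\<lambda>(a, x). map (apfst (\<lambda>c. extd D a \<otimes>\<^bsub>forms D\<^esub> extd D c)) (jet1_rep D M x))
      (jet1_rep D (jet1 D M) X)))"

subsection \<open>Higher jets\<close>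

text \<open>
  The iterated jet modules have ever growing types. To have all of them in one type, an element of
  \<open>J\<^sup>1 M\<close> is stored as a chosen formal sum representing it; \<open>jet_code\<close> is injective on
  \<open>J\<^sup>1 M\<close>, and the module structure is transported along it.
\<close>

datatype ('w, 'e) jet = Base 'e | Formal "('w \<times> ('w, 'e) jet) list"

definition jet_code ::
  "('k, 'w) dga \<Rightarrow> ('w, ('w, 'e) jet) module \<Rightarrow>
    ('w \<times> ('w, 'e) jet) list set set \<Rightarrow> ('w, 'e) jet"
  where "jet_code D M X = Formal (jet1_rep D M X)"

text \<open>
  \<open>jet_decode D M\<close> is the inclusion \<open>l\<^sup>n\<close> of \<open>J\<^sup>n E\<close> into \<open>J\<^sup>1 M\<close>, for \<open>M = J\<^sup>n\<^sup>-\<^sup>1 E\<close> and \<open>n \<ge> 1\<close>.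
\<close>

definition jet_decode ::
  "('k, 'w) dga \<Rightarrow> ('w, ('w, 'e) jet) module \<Rightarrow>
    ('w, 'e) jet \<Rightarrow> ('w \<times> ('w, 'e) jet) list set set"
  where "jet_decode D M = inv_into (carrier (jet1 D M)) (jet_code D M)"

fun jets :: "('k, 'w) dga \<Rightarrow> ('w, 'e) module \<Rightarrow> nat \<Rightarrow> ('w, ('w, 'e) jet) module" where
  "jets D E 0 = transport_module Base E"
| "jets D E (Suc 0) = transport_module (jet_code D (jets D E 0)) (jet1 D (jets D E 0))"
| "jets D E (Suc (Suc n)) = (let P = jets D E (Suc n); Q = jets D E n in
    transport_module (jet_code D P)
      ((jet1 D P)\<lparr>carrier := {x \<in> carrier (jet1 D P).
        let y = jet1_map D P (jet1 D Q) (jet_decode D Q) x in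
          holonomy1 D Q y = \<zero>\<^bsub>forms_with_coeffs D 1 Q\<^esub> \<and>
          holonomy2 D Q y = \<zero>\<^bsub>forms_with_coeffs D 2 Q\<^esub>}\<rparr>))"

fun prolong :: "('k, 'w) dga \<Rightarrow> ('w, 'e) module \<Rightarrow> nat \<Rightarrow> 'e \<Rightarrow> ('w, 'e) jet" where
  "prolong D E 0 e = Base e"
| "prolong D E (Suc n) e = jet_code D (jets D E n) (prolong1 D (jets D E n) (prolong D E n e))"

section \<open>Differential operators and symbols\<close>

text \<open>Maps between modules are functions restricted to the carrier of the source.\<close>

definition scalar_linear_maps ::
  "('k, 'w) dga \<Rightarrow> ('w, 'e) module \<Rightarrow> ('w, 'f) module \<Rightarrow> ('k, 'e \<Rightarrow> 'f) module"
  where "scalar_linear_maps D E F =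
    \<lparr>carrier = {f \<in> extensional (carrier E).
       lin_map (scalars D) (restrict_scalars D E) (restrict_scalars D F) f},
     mult = undefined, one = undefined,
     zero = (\<lambda>e\<in>carrier E. \<zero>\<^bsub>F\<^esub>),
     add = (\<lambda>f g. \<lambda>e\<in>carrier E. f e \<oplus>\<^bsub>F\<^esub> g e),
     smult = (\<lambda>k f. \<lambda>e\<in>carrier E. k \<odot>\<^bsub>restrict_scalars D F\<^esub> f e)\<rparr>"

definition diff_ops ::
  "('k, 'w) dga \<Rightarrow> ('w, 'e) module \<Rightarrow> ('w, 'f) module \<Rightarrow> nat \<Rightarrow> ('k, 'e \<Rightarrow> 'f) module"
  where "diff_ops D E F n = (scalar_linear_maps D E F)\<lparr>carrier :=
    {\<Delta> \<in> carrier (scalar_linear_maps D E F).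
      \<exists>\<Delta>'. lin_map (alg D) (jets D E n) F \<Delta>' \<and> (\<forall>e\<in>carrier E. \<Delta>' (prolong D E n e) = \<Delta> e)}\<rparr>"

text \<open>\<open>Diff\<^sup>n\<^sup>-\<^sup>1(E, F)\<close>, which is \<open>0\<close> for \<open>n = 0\<close>\<close>

definition lower_diff_ops ::
  "('k, 'w) dga \<Rightarrow> ('w, 'e) module \<Rightarrow> ('w, 'f) module \<Rightarrow> nat \<Rightarrow> ('e \<Rightarrow> 'f) set"
  where "lower_diff_ops D E F n =
    (case n of 0 \<Rightarrow> {\<zero>\<^bsub>scalar_linear_maps D E F\<^esub>} | Suc m \<Rightarrow> carrier (diff_ops D E F m))"

definition symb ::
  "('k, 'w) dga \<Rightarrow> ('w, 'e) module \<Rightarrow> ('w, 'f) module \<Rightarrow> nat \<Rightarrow> ('k, ('e \<Rightarrow> 'f) set) module"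
  where "symb D E F n = quot_module (diff_ops D E F n) (lower_diff_ops D E F n)"

definition symbol_map ::
  "('k, 'w) dga \<Rightarrow> ('w, 'e) module \<Rightarrow> ('w, 'f) module \<Rightarrow> nat \<Rightarrow> ('e \<Rightarrow> 'f) \<Rightarrow> ('e \<Rightarrow> 'f) set"
  where "symbol_map D E F n \<Delta> = lower_diff_ops D E F n +>\<^bsub>diff_ops D E F n\<^esub> \<Delta>"

definition symb_total ::
  "('k, 'w) dga \<Rightarrow> ('w, 'e) module \<Rightarrow> ('w, 'f) module \<Rightarrow> ('k, nat \<Rightarrow> ('e \<Rightarrow> 'f) set) module"
  where "symb_total D E F = direct_sum (symb D E F)"

definition symb_mult ::
  "('k, 'w) dga \<Rightarrow> ('w, 'e) module \<Rightarrow> nat \<Rightarrow> nat \<Rightarrow>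
    ('e \<Rightarrow> 'e) set \<Rightarrow> ('e \<Rightarrow> 'e) set \<Rightarrow> ('e \<Rightarrow> 'e) set"
  where "symb_mult D E n m a b =
    (\<Union>\<Delta>1\<in>a. \<Union>\<Delta>2\<in>b. symbol_map D E E (n + m) (compose (carrier E) \<Delta>1 \<Delta>2))"

section \<open>Quantizations and the formal star product\<close>

definition quantization ::
  "('k, 'w) dga \<Rightarrow> ('w, 'e) module \<Rightarrow> nat \<Rightarrow> (('e \<Rightarrow> 'e) set \<Rightarrow> 'e \<Rightarrow> 'e) \<Rightarrow> bool"
  where "quantization D E n qn \<longleftrightarrow>
    qn \<in> carrier (symb D E E n) \<rightarrow> carrier (diff_ops D E E n) \<and>
    (\<forall>a\<in>carrier (symb D E E n). \<forall>b\<in>carrier (symb D E E n).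
      qn (a \<oplus>\<^bsub>symb D E E n\<^esub> b) = qn a \<oplus>\<^bsub>diff_ops D E E n\<^esub> qn b) \<and>
    (\<forall>\<phi>. lin_map (alg D) E E \<phi> \<longrightarrow> (\<forall>\<Delta>\<in>carrier (diff_ops D E E n).
      qn (symbol_map D E E n (compose (carrier E) \<phi> \<Delta>)) =
        compose (carrier E) \<phi> (qn (symbol_map D E E n \<Delta>)))) \<and>
    (\<forall>a\<in>carrier (symb D E E n). symbol_map D E E n (qn a) = a)"

definition full_quantization ::
  "('k, 'w) dga \<Rightarrow> ('w, 'e) module \<Rightarrow> (nat \<Rightarrow> ('e \<Rightarrow> 'e) set \<Rightarrow> 'e \<Rightarrow> 'e) \<Rightarrow> bool"
  where "full_quantization D E q \<longleftrightarrow> (\<forall>n. quantization D E n (q n))"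

text \<open>\<open>truncate D E q n \<Delta> k\<close> is \<open>\<Delta>\<^bsub>\<le>k\<^esub>\<close> for \<open>\<Delta>\<close> of order at most \<open>n\<close>.\<close>

function truncate ::
  "('k, 'w) dga \<Rightarrow> ('w, 'e) module \<Rightarrow> (nat \<Rightarrow> ('e \<Rightarrow> 'e) set \<Rightarrow> 'e \<Rightarrow> 'e) \<Rightarrow>
    nat \<Rightarrow> ('e \<Rightarrow> 'e) \<Rightarrow> nat \<Rightarrow> 'e \<Rightarrow> 'e" where
  "truncate D E q n \<Delta> k = (if n \<le> k then \<Delta> else
    (let T = truncate D E q n \<Delta> (Suc k) in
      T \<ominus>\<^bsub>scalar_linear_maps D E E\<^esub> q (Suc k) (symbol_map D E E (Suc k) T)))"
  by pat_completeness auto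
termination by (relation "measure (\<lambda>(D, E, q, n, \<Delta>, k). n - k)") auto

declare truncate.simps [simp del]

definition symbol_part ::
  "('k, 'w) dga \<Rightarrow> ('w, 'e) module \<Rightarrow> (nat \<Rightarrow> ('e \<Rightarrow> 'e) set \<Rightarrow> 'e \<Rightarrow> 'e) \<Rightarrow>
    nat \<Rightarrow> ('e \<Rightarrow> 'e) \<Rightarrow> nat \<Rightarrow> ('e \<Rightarrow> 'e) set"
  where "symbol_part D E q n \<Delta> k = symbol_map D E E k (truncate D E q n \<Delta> k)"

definition symb_h ::
  "('k, 'w) dga \<Rightarrow> ('w, 'e) module \<Rightarrow>
    (nat \<Rightarrow> 'k, ((nat \<Rightarrow> ('e \<Rightarrow> 'e) set) \<times> (nat \<Rightarrow> 'k)) list set) module"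
  where "symb_h D E = tensor (scalars D) (symb_total D E E) (UP (scalars D))
    (\<lambda>p. apsnd (\<lambda>r. p \<otimes>\<^bsub>UP (scalars D)\<^esub> r))"

definition symb_h_cls ::
  "('k, 'w) dga \<Rightarrow> ('w, 'e) module \<Rightarrow> ((nat \<Rightarrow> ('e \<Rightarrow> 'e) set) \<times> (nat \<Rightarrow> 'k)) list \<Rightarrow>
    ((nat \<Rightarrow> ('e \<Rightarrow> 'e) set) \<times> (nat \<Rightarrow> 'k)) list set"
  where "symb_h_cls D E = tensor_cls (scalars D) (symb_total D E E) (UP (scalars D))"

definition hvar :: "('k, 'w) dga \<Rightarrow> nat \<Rightarrow> 'k"
  where "hvar D = monom (UP (scalars D)) \<one>\<^bsub>scalars D\<^esub> 1"

text \<open>The image of \<open>a \<in> Symb\<^sup>n(E, E)\<close>.\<close>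

definition symb_h_incl ::
  "('k, 'w) dga \<Rightarrow> ('w, 'e) module \<Rightarrow> nat \<Rightarrow> ('e \<Rightarrow> 'e) set \<Rightarrow>
    ((nat \<Rightarrow> ('e \<Rightarrow> 'e) set) \<times> (nat \<Rightarrow> 'k)) list set"
  where "symb_h_incl D E n a =
    symb_h_cls D E [(direct_sum_incl (symb D E E) n a, \<one>\<^bsub>UP (scalars D)\<^esub>)]"

text \<open>The sum of the \<open>Symb\<^sup>k(E, E)[h]\<close> over \<open>k < n\<close>, as a subset of \<open>Symb\<^sup>\<bullet>(E, E)[h]\<close>.\<close>

definition symb_h_below ::
  "('k, 'w) dga \<Rightarrow> ('w, 'e) module \<Rightarrow> nat \<Rightarrow>
    ((nat \<Rightarrow> ('e \<Rightarrow> 'e) set) \<times> (nat \<Rightarrow> 'k)) list set set"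
  where "symb_h_below D E n = symb_h_cls D E `
    {l \<in> formal_sums (symb_total D E E) (UP (scalars D)).
      \<forall>(s, p)\<in>set l. \<forall>k\<ge>n. s k = \<zero>\<^bsub>symb D E E k\<^esub>}"

definition is_formal_star ::
  "('k, 'w) dga \<Rightarrow> ('w, 'e) module \<Rightarrow> (nat \<Rightarrow> ('e \<Rightarrow> 'e) set \<Rightarrow> 'e \<Rightarrow> 'e) \<Rightarrow>
    (((nat \<Rightarrow> ('e \<Rightarrow> 'e) set) \<times> (nat \<Rightarrow> 'k)) list set \<Rightarrow>
     ((nat \<Rightarrow> ('e \<Rightarrow> 'e) set) \<times> (nat \<Rightarrow> 'k)) list set \<Rightarrow>
     ((nat \<Rightarrow> ('e \<Rightarrow> 'e) set) \<times> (nat \<Rightarrow> 'k)) list set) \<Rightarrow> bool"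
  where "is_formal_star D E q f \<longleftrightarrow>
    f \<in> carrier (symb_h D E) \<rightarrow>\<^sub>E (carrier (symb_h D E) \<rightarrow>\<^sub>E carrier (symb_h D E)) \<and>
    (\<forall>x\<in>carrier (symb_h D E). lin_map (UP (scalars D)) (symb_h D E) (symb_h D E) (\<lambda>y. f x y)) \<and>
    (\<forall>y\<in>carrier (symb_h D E). lin_map (UP (scalars D)) (symb_h D E) (symb_h D E) (\<lambda>x. f x y)) \<and>
    (\<forall>n m. \<forall>a\<in>carrier (symb D E E n). \<forall>b\<in>carrier (symb D E E m).
      f (symb_h_incl D E n a) (symb_h_incl D E m b) =
        (\<Oplus>\<^bsub>symb_h D E\<^esub> k \<in> {0..n + m}.
          (hvar D [^]\<^bsub>UP (scalars D)\<^esub> k) \<odot>\<^bsub>symb_h D E\<^esub>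
            symb_h_incl D E (n + m - k)
              (symbol_part D E q (n + m) (compose (carrier E) (q n a) (q m b)) (n + m - k))))"

definition formal_star ::
  "('k, 'w) dga \<Rightarrow> ('w, 'e) module \<Rightarrow> (nat \<Rightarrow> ('e \<Rightarrow> 'e) set \<Rightarrow> 'e \<Rightarrow> 'e) \<Rightarrow>
    ((nat \<Rightarrow> ('e \<Rightarrow> 'e) set) \<times> (nat \<Rightarrow> 'k)) list set \<Rightarrow>
    ((nat \<Rightarrow> ('e \<Rightarrow> 'e) set) \<times> (nat \<Rightarrow> 'k)) list set \<Rightarrow>
    ((nat \<Rightarrow> ('e \<Rightarrow> 'e) set) \<times> (nat \<Rightarrow> 'k)) list set"
  where "formal_star D E q = (THE f. is_formal_star D E q f)"

end

theory Submission
  imports Defs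
begin

text \<open>
  Identify \<open>Symb[h]\<close> with the Rees algebra of the filtered algebra of differential operators: send
  \<open>a \<otimes> h\<^sup>j\<close>, with \<open>a\<close> a symbol of order \<open>n\<close>, to the operator-valued polynomial \<open>q\<^sup>n(a) h\<^sup>n\<^sup>+\<^sup>j\<close>. Every
  operator of order at most \<open>n\<close> is in exactly one way a sum of operators \<open>q\<^sup>k(a\<^sub>k)\<close> with \<open>k \<le> n\<close>, the
  \<open>a\<^sub>k\<close> being computed by truncation. Hence this map is injective, and its image consists of the
  polynomials whose \<open>i\<close>-th coefficient has order at most \<open>i\<close>. The formal star product becomes the
  multiplication of polynomials, and the \<open>n\<close>-th step of the filtration becomes the set of those
  polynomials in the image all of whose coefficients have order at most \<open>n\<close>.

  It remains to see that differential operators form a filtered algebra. The evaluation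
  \<open>[a \<otimes> e] \<mapsto> ae\<close> gives left linear maps \<open>J\<^sup>n\<^sup>+\<^sup>1 E \<rightarrow> J\<^sup>n E\<close> compatible with prolongation, so the orders
  increase. For compositions, a left linear map \<open>J\<^sup>n E \<rightarrow> F\<close> is lifted to \<open>J\<^sup>k\<^sup>+\<^sup>n E \<rightarrow> J\<^sup>k F\<close> by applying
  \<open>J\<^sup>1\<close> repeatedly and restricting. This needs the holonomy maps to be well defined and natural; for
  that, \<open>J\<^sup>1 M\<close> is embedded into the sum of \<open>M\<close> and \<open>\<Omega>\<^sup>1 \<otimes> M\<close> by \<open>[a \<otimes> m] \<mapsto> (am, da \<otimes> m)\<close>.
\<close>

section \<open>Modules over noncommutative rings\<close>

text \<open>The exponent \<open>n + j\<close> is dictated by the product formula: for symbols of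
  orders \<open>n\<close> and \<open>m\<close>, the term of order \<open>n + m - k\<close> carries
  \<open>h\<close> to the power \<open>k\<close>, so all terms land on the exponent
  \<open>n + m\<close> and add up to the single coefficient \<open>q n a\<close> composed with
  \<open>q m b\<close>. Since \<open>formal_star\<close> is a definite description, existence and
  uniqueness of the bilinear extension have to be shown too: the first by transporting the product
  of polynomials, the second because homogeneous symbols generate the module over
  \<open>K[h]\<close>. On the side of jets the obstacle is that nothing is given by a formula on
  classes: 1-jets are cosets of classes of lists, maps are evaluated at chosen representatives, and
  higher jets are codes of such representatives. The pair of components of a 1-jet replaces every
  comparison of representatives. Its second component is not linear over \<open>A\<close> but obeys
  a Leibniz rule whose defect involves only the first. The two holonomy maps repeat this pattern,
  which is why the joint kernel is a submodule in both cases.\<close>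

context left_module
begin

lemma smult_zero_right: "a \<in> carrier R \<Longrightarrow> a \<odot>\<^bsub>M\<^esub> \<zero>\<^bsub>M\<^esub> = \<zero>\<^bsub>M\<^esub>"
  by (metis M.add.r_cancel_one' M.zero_closed M.r_zero smult_closed smult_r_distr)

lemma smult_zero_left: "x \<in> carrier M \<Longrightarrow> \<zero>\<^bsub>R\<^esub> \<odot>\<^bsub>M\<^esub> x = \<zero>\<^bsub>M\<^esub>"
  by (metis M.add.r_cancel_one' R.zero_closed R.r_zero smult_closed smult_l_distr)

lemma smult_minus_right:
  "\<lbrakk>a \<in> carrier R; x \<in> carrier M\<rbrakk> \<Longrightarrow> a \<odot>\<^bsub>M\<^esub> (\<ominus>\<^bsub>M\<^esub> x) = \<ominus>\<^bsub>M\<^esub> (a \<odot>\<^bsub>M\<^esub> x)"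
  by (metis M.add.inv_closed M.minus_equality M.l_neg smult_closed smult_r_distr smult_zero_right)

lemma smult_minus_left:
  "\<lbrakk>a \<in> carrier R; x \<in> carrier M\<rbrakk> \<Longrightarrow> (\<ominus>\<^bsub>R\<^esub> a) \<odot>\<^bsub>M\<^esub> x = \<ominus>\<^bsub>M\<^esub> (a \<odot>\<^bsub>M\<^esub> x)"
  by (metis R.add.inv_closed M.minus_equality R.l_neg smult_closed smult_l_distr smult_zero_left)

text \<open>The module axioms pass to the image of any map compatible with the operations.
  Quotients, transported copies and records with exchanged \<open>mult\<close> and
  \<open>one\<close> are all instances.\<close>

lemma left_module_surj:
  assumes carrier: "carrier N = p ` carrier M"
    and add: "\<And>x y. \<lbrakk>x \<in> carrier M; y \<in> carrier M\<rbrakk> \<Longrightarrow> p x \<oplus>\<^bsub>N\<^esub> p y = p (x \<oplus>\<^bsub>M\<^esub> y)"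
    and smult: "\<And>a x. \<lbrakk>a \<in> carrier R; x \<in> carrier M\<rbrakk> \<Longrightarrow> a \<odot>\<^bsub>N\<^esub> p x = p (a \<odot>\<^bsub>M\<^esub> x)"
    and zero: "\<zero>\<^bsub>N\<^esub> = p \<zero>\<^bsub>M\<^esub>"
  shows "left_module R N"
proof -
  have "abelian_group N"
  proof (rule abelian_groupI)
    show "x \<oplus>\<^bsub>N\<^esub> y \<in> carrier N" if "x \<in> carrier N" "y \<in> carrier N" for x y
      using that by (auto simp: carrier add)
    show "\<zero>\<^bsub>N\<^esub> \<in> carrier N" by (auto simp: carrier zero)
    show "x \<oplus>\<^bsub>N\<^esub> y \<oplus>\<^bsub>N\<^esub> z = x \<oplus>\<^bsub>N\<^esub> (y \<oplus>\<^bsub>N\<^esub> z)"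
      if "x \<in> carrier N" "y \<in> carrier N" "z \<in> carrier N" for x y z
      using that by (auto simp: carrier add M.a_assoc)
    show "x \<oplus>\<^bsub>N\<^esub> y = y \<oplus>\<^bsub>N\<^esub> x" if "x \<in> carrier N" "y \<in> carrier N" for x y
      using that by (auto simp: carrier add M.a_comm)
    show "\<zero>\<^bsub>N\<^esub> \<oplus>\<^bsub>N\<^esub> x = x" if "x \<in> carrier N" for x
      using that by (auto simp: carrier add zero)
    show "\<exists>y\<in>carrier N. y \<oplus>\<^bsub>N\<^esub> x = \<zero>\<^bsub>N\<^esub>" if x: "x \<in> carrier N" for x
    proof -
      from x obtain x' where x': "x' \<in> carrier M" "x = p x'" by (auto simp: carrier)
      then show ?thesis
        by (intro bexI[of _ "p (\<ominus>\<^bsub>M\<^esub> x')"]) (auto simp: carrier add zero M.l_neg)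
    qed
  qed
  then show ?thesis
    unfolding left_module_def left_module_axioms_def
    using R.ring_axioms
    by (auto simp: carrier add smult smult_closed smult_l_distr smult_r_distr smult_assoc smult_one)
qed

end

text \<open>The stability conditions suffice for a submodule, since \<open>-x = (-1) x\<close>.\<close>

definition left_submodule ::
  "('r, 'z) ring_scheme \<Rightarrow> ('r, 'm, 'y) module_scheme \<Rightarrow> 'm set \<Rightarrow> bool"
  where "left_submodule R M N \<longleftrightarrow> N \<subseteq> carrier M \<and> \<zero>\<^bsub>M\<^esub> \<in> N \<and>
    (\<forall>x\<in>N. \<forall>y\<in>N. x \<oplus>\<^bsub>M\<^esub> y \<in> N) \<and> (\<forall>a\<in>carrier R. \<forall>x\<in>N. a \<odot>\<^bsub>M\<^esub> x \<in> N)"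

lemma left_submoduleI:
  assumes "N \<subseteq> carrier M" "\<zero>\<^bsub>M\<^esub> \<in> N" "\<And>x y. \<lbrakk>x \<in> N; y \<in> N\<rbrakk> \<Longrightarrow> x \<oplus>\<^bsub>M\<^esub> y \<in> N"
    "\<And>a x. \<lbrakk>a \<in> carrier R; x \<in> N\<rbrakk> \<Longrightarrow> a \<odot>\<^bsub>M\<^esub> x \<in> N"
  shows "left_submodule R M N"
  using assms by (simp add: left_submodule_def)

lemma (in left_module) left_submodule_neg:
  assumes "left_submodule R M N" "x \<in> N" shows "\<ominus>\<^bsub>M\<^esub> x \<in> N"
proof -
  have "x \<in> carrier M" using assms by (auto simp: left_submodule_def)
  then have "\<ominus>\<^bsub>M\<^esub> x = (\<ominus>\<^bsub>R\<^esub> \<one>\<^bsub>R\<^esub>) \<odot>\<^bsub>M\<^esub> x" by (simp add: smult_minus_left smult_one)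
  then show ?thesis using assms by (simp add: left_submodule_def)
qed

lemma (in left_module) left_submodule_minus:
  assumes "left_submodule R M N" "x \<in> N" "y \<in> N" shows "x \<ominus>\<^bsub>M\<^esub> y \<in> N"
  using assms left_submodule_neg[OF assms(1,3)] by (auto simp: left_submodule_def a_minus_def)

lemma (in left_module) left_module_submodule:
  assumes "left_submodule R M N" shows "left_module R (M\<lparr>carrier := N\<rparr>)"
proof -
  have NM: "N \<subseteq> carrier M" and z: "\<zero>\<^bsub>M\<^esub> \<in> N"
    and cl: "\<And>x y. \<lbrakk>x \<in> N; y \<in> N\<rbrakk> \<Longrightarrow> x \<oplus>\<^bsub>M\<^esub> y \<in> N"
    and sm: "\<And>a x. \<lbrakk>a \<in> carrier R; x \<in> N\<rbrakk> \<Longrightarrow> a \<odot>\<^bsub>M\<^esub> x \<in> N"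
    using assms by (auto simp: left_submodule_def)
  have neg: "\<ominus>\<^bsub>M\<^esub> x \<in> N" if "x \<in> N" for x using left_submodule_neg[OF assms that] .
  have "abelian_group (M\<lparr>carrier := N\<rparr>)"
  proof (rule abelian_groupI)
    show "\<exists>y\<in>carrier (M\<lparr>carrier := N\<rparr>). y \<oplus>\<^bsub>M\<lparr>carrier := N\<rparr>\<^esub> x = \<zero>\<^bsub>M\<lparr>carrier := N\<rparr>\<^esub>"
      if "x \<in> carrier (M\<lparr>carrier := N\<rparr>)" for x
      using that NM neg by (auto simp: subset_eq M.l_neg intro!: bexI[of _ "\<ominus>\<^bsub>M\<^esub> x"])
    show "x \<oplus>\<^bsub>M\<lparr>carrier := N\<rparr>\<^esub> y \<oplus>\<^bsub>M\<lparr>carrier := N\<rparr>\<^esub> z = x \<oplus>\<^bsub>M\<lparr>carrier := N\<rparr>\<^esub> (y \<oplus>\<^bsub>M\<lparr>carrier := N\<rparr>\<^esub> z)"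
      if "x \<in> carrier (M\<lparr>carrier := N\<rparr>)" "y \<in> carrier (M\<lparr>carrier := N\<rparr>)"
        "z \<in> carrier (M\<lparr>carrier := N\<rparr>)" for x y z
      using that NM by (simp add: subset_eq M.a_assoc)
  qed (use NM z cl in \<open>auto simp: subset_eq M.a_comm\<close>)
  then show ?thesis
    unfolding left_module_def left_module_axioms_def
    using R.ring_axioms NM sm
    by (auto simp: subset_eq smult_l_distr smult_r_distr smult_assoc smult_one)
qed

lemma (in left_module) additive_subgroup_left_submodule:
  assumes "left_submodule R M N" shows "abelian_subgroup N M"
proof (rule abelian_subgroupI3)
  show "additive_subgroup N M"
    unfolding additive_subgroup_def
  proof (rule M.add.subgroupI)
    show "N \<subseteq> carrier M" "N \<noteq> {}" using assms by (auto simp: left_submodule_def)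
    show "\<ominus>\<^bsub>M\<^esub> x \<in> N" if "x \<in> N" for x using left_submodule_neg[OF assms that] .
    show "x \<oplus>\<^bsub>M\<^esub> y \<in> N" if "x \<in> N" "y \<in> N" for x y
      using assms that by (simp add: left_submodule_def)
  qed
qed (rule M.abelian_group_axioms)

section \<open>Quotients and transported modules\<close>

context left_module
begin

context
  fixes N assumes sub: "left_submodule R M N"
begin

interpretation N: abelian_subgroup N M
  by (rule additive_subgroup_left_submodule[OF sub])

lemma coset_eq_iff:
  assumes "x \<in> carrier M" "y \<in> carrier M"
  shows "N +>\<^bsub>M\<^esub> x = N +>\<^bsub>M\<^esub> y \<longleftrightarrow> x \<ominus>\<^bsub>M\<^esub> y \<in> N"
proof
  assume "N +>\<^bsub>M\<^esub> x = N +>\<^bsub>M\<^esub> y"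
  then have "x \<in> N +>\<^bsub>M\<^esub> y" using N.a_rcos_self assms by blast
  then show "x \<ominus>\<^bsub>M\<^esub> y \<in> N" using assms by (simp add: N.a_rcos_module a_minus_def)
next
  assume "x \<ominus>\<^bsub>M\<^esub> y \<in> N"
  then have "x \<in> N +>\<^bsub>M\<^esub> y" using assms by (simp add: N.a_rcos_module a_minus_def)
  then show "N +>\<^bsub>M\<^esub> x = N +>\<^bsub>M\<^esub> y" using assms N.a_repr_independence' by metis
qed

text \<open>Scalar multiplication on a quotient is a union over the representatives of a coset;
  stability of \<open>N\<close> under scalars makes all members of this union equal.\<close>

lemma coset_smult:
  assumes "a \<in> carrier R" "x \<in> carrier M"
  shows "(\<Union>y\<in>N +>\<^bsub>M\<^esub> x. N +>\<^bsub>M\<^esub> (a \<odot>\<^bsub>M\<^esub> y)) = N +>\<^bsub>M\<^esub> (a \<odot>\<^bsub>M\<^esub> x)"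
proof -
  have "N +>\<^bsub>M\<^esub> (a \<odot>\<^bsub>M\<^esub> y) = N +>\<^bsub>M\<^esub> (a \<odot>\<^bsub>M\<^esub> x)" if "y \<in> N +>\<^bsub>M\<^esub> x" for y
  proof -
    have y: "y \<in> carrier M" using that assms N.a_rcosets_carrier M.a_rcosetsI N.a_subset by blast
    then have "y \<ominus>\<^bsub>M\<^esub> x \<in> N" using that assms by (simp add: N.a_rcos_module a_minus_def)
    then have "a \<odot>\<^bsub>M\<^esub> (y \<ominus>\<^bsub>M\<^esub> x) \<in> N" using sub assms by (simp add: left_submodule_def)
    then show ?thesis using y assms
      by (simp add: coset_eq_iff smult_closed smult_r_distr a_minus_def smult_minus_right)
  qed
  moreover have "x \<in> N +>\<^bsub>M\<^esub> x" using assms N.a_rcos_self by blast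
  ultimately show ?thesis by blast
qed

lemma quot_module_simps:
  shows "carrier (quot_module M N) = (\<lambda>x. N +>\<^bsub>M\<^esub> x) ` carrier M"
    and "\<lbrakk>x \<in> carrier M; y \<in> carrier M\<rbrakk> \<Longrightarrow>
      (N +>\<^bsub>M\<^esub> x) \<oplus>\<^bsub>quot_module M N\<^esub> (N +>\<^bsub>M\<^esub> y) = N +>\<^bsub>M\<^esub> (x \<oplus>\<^bsub>M\<^esub> y)"
    and "\<lbrakk>a \<in> carrier R; x \<in> carrier M\<rbrakk> \<Longrightarrow>
      a \<odot>\<^bsub>quot_module M N\<^esub> (N +>\<^bsub>M\<^esub> x) = N +>\<^bsub>M\<^esub> (a \<odot>\<^bsub>M\<^esub> x)"
    and "\<zero>\<^bsub>quot_module M N\<^esub> = N +>\<^bsub>M\<^esub> \<zero>\<^bsub>M\<^esub>"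
proof -
  show "carrier (quot_module M N) = (\<lambda>x. N +>\<^bsub>M\<^esub> x) ` carrier M"
    by (auto simp: quot_module_def A_RCOSETS_def')
  show "(N +>\<^bsub>M\<^esub> x) \<oplus>\<^bsub>quot_module M N\<^esub> (N +>\<^bsub>M\<^esub> y) = N +>\<^bsub>M\<^esub> (x \<oplus>\<^bsub>M\<^esub> y)"
    if "x \<in> carrier M" "y \<in> carrier M" using that by (simp add: quot_module_def N.a_rcos_sum)
  show "a \<odot>\<^bsub>quot_module M N\<^esub> (N +>\<^bsub>M\<^esub> x) = N +>\<^bsub>M\<^esub> (a \<odot>\<^bsub>M\<^esub> x)"
    if "a \<in> carrier R" "x \<in> carrier M" using that by (simp add: quot_module_def coset_smult)
  show "\<zero>\<^bsub>quot_module M N\<^esub> = N +>\<^bsub>M\<^esub> \<zero>\<^bsub>M\<^esub>"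
    using N.a_subset by (simp add: quot_module_def)
qed

lemma left_module_quot: "left_module R (quot_module M N)"
  by (rule left_module_surj[where p = "\<lambda>x. N +>\<^bsub>M\<^esub> x"]) (auto simp: quot_module_simps)

end

lemma transport_module_simps:
  assumes "inj_on f (carrier M)"
  shows "carrier (transport_module f M) = f ` carrier M"
    and "\<lbrakk>x \<in> carrier M; y \<in> carrier M\<rbrakk> \<Longrightarrow> f x \<oplus>\<^bsub>transport_module f M\<^esub> f y = f (x \<oplus>\<^bsub>M\<^esub> y)"
    and "\<lbrakk>a \<in> carrier R; x \<in> carrier M\<rbrakk> \<Longrightarrow> a \<odot>\<^bsub>transport_module f M\<^esub> f x = f (a \<odot>\<^bsub>M\<^esub> x)"
    and "\<zero>\<^bsub>transport_module f M\<^esub> = f \<zero>\<^bsub>M\<^esub>"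
  using assms by (simp_all add: transport_module_def Let_def)

lemma left_module_transport:
  assumes "inj_on f (carrier M)" shows "left_module R (transport_module f M)"
  by (rule left_module_surj[where p = f]) (simp_all add: transport_module_simps[OF assms])

end

lemma left_module_direct_sum:
  assumes M: "\<And>n. left_module R (M n)" shows "left_module R (direct_sum M)"
proof -
  interpret M: left_module R "M n" for n by (rule M)
  let ?S = "direct_sum M"
  have fin: "finite {n. s n \<oplus>\<^bsub>M n\<^esub> t n \<noteq> \<zero>\<^bsub>M n\<^esub>}"
    if "s \<in> carrier ?S" "t \<in> carrier ?S" for s t
    by (rule finite_subset[of _ "{n. s n \<noteq> \<zero>\<^bsub>M n\<^esub>} \<union> {n. t n \<noteq> \<zero>\<^bsub>M n\<^esub>}"])
      (use that in \<open>auto simp: direct_sum_def\<close>)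
  have fin': "finite {n. a \<odot>\<^bsub>M n\<^esub> s n \<noteq> \<zero>\<^bsub>M n\<^esub>}" if "s \<in> carrier ?S" "a \<in> carrier R" for s a
    by (rule finite_subset[of _ "{n. s n \<noteq> \<zero>\<^bsub>M n\<^esub>}"])
      (use that in \<open>auto simp: direct_sum_def M.smult_zero_right\<close>)
  have "abelian_group ?S"
  proof (rule abelian_groupI)
    show "s \<oplus>\<^bsub>?S\<^esub> t \<in> carrier ?S" if "s \<in> carrier ?S" "t \<in> carrier ?S" for s t
      using fin[OF that] that by (auto simp: direct_sum_def)
    show "\<exists>t\<in>carrier ?S. t \<oplus>\<^bsub>?S\<^esub> s = \<zero>\<^bsub>?S\<^esub>" if s: "s \<in> carrier ?S" for s
    proof (rule bexI[of _ "\<lambda>n. \<ominus>\<^bsub>M n\<^esub> s n"])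
      have "finite {n. \<ominus>\<^bsub>M n\<^esub> s n \<noteq> \<zero>\<^bsub>M n\<^esub>}"
        by (rule finite_subset[of _ "{n. s n \<noteq> \<zero>\<^bsub>M n\<^esub>}"]) (use s in \<open>auto simp: direct_sum_def\<close>)
      then show "(\<lambda>n. \<ominus>\<^bsub>M n\<^esub> s n) \<in> carrier ?S" using s by (auto simp: direct_sum_def)
    qed (use s in \<open>auto simp: direct_sum_def M.M.l_neg\<close>)
  qed (auto simp: direct_sum_def M.M.a_ac)
  then show ?thesis
    unfolding left_module_def left_module_axioms_def
    using M.R.ring_axioms fin'
    by (auto simp: direct_sum_def M.smult_closed M.smult_l_distr M.smult_r_distr M.smult_assoc
        M.smult_one)
qed

subsection \<open>Additive maps and sums over lists\<close>

text \<open>Weaker than \<open>lin_map\<close> on purpose: \<open>jet_diff\<close> is not linear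
  over \<open>A\<close>, and maps such as \<open>rees\<close> go between modules over different
  rings.\<close>

definition additive_map :: "('m, 'z) ring_scheme \<Rightarrow> ('n, 'y) ring_scheme \<Rightarrow> ('m \<Rightarrow> 'n) \<Rightarrow> bool"
  where "additive_map M N f \<longleftrightarrow> f \<in> carrier M \<rightarrow> carrier N \<and>
    (\<forall>x\<in>carrier M. \<forall>y\<in>carrier M. f (x \<oplus>\<^bsub>M\<^esub> y) = f x \<oplus>\<^bsub>N\<^esub> f y)"

lemma additive_mapD:
  assumes "additive_map M N f" "x \<in> carrier M"
  shows "f x \<in> carrier N" and "y \<in> carrier M \<Longrightarrow> f (x \<oplus>\<^bsub>M\<^esub> y) = f x \<oplus>\<^bsub>N\<^esub> f y"
  using assms by (auto simp: additive_map_def)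

lemma additive_map_zero:
  assumes "abelian_group M" "abelian_group N" "additive_map M N f"
  shows "f \<zero>\<^bsub>M\<^esub> = \<zero>\<^bsub>N\<^esub>"
proof -
  interpret M: abelian_group M by fact
  interpret N: abelian_group N by fact
  have "f \<zero>\<^bsub>M\<^esub> \<oplus>\<^bsub>N\<^esub> f \<zero>\<^bsub>M\<^esub> = f \<zero>\<^bsub>M\<^esub>" using additive_mapD[OF assms(3)] by (metis M.zero_closed M.l_zero)
  moreover have "f \<zero>\<^bsub>M\<^esub> \<in> carrier N" using additive_mapD[OF assms(3)] by simp
  ultimately show ?thesis by (simp add: N.add.r_cancel_one)
qed

lemma additive_map_neg:
  assumes "abelian_group M" "abelian_group N" "additive_map M N f" "x \<in> carrier M"
  shows "f (\<ominus>\<^bsub>M\<^esub> x) = \<ominus>\<^bsub>N\<^esub> f x"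
proof -
  interpret M: abelian_group M by fact
  interpret N: abelian_group N by fact
  have "f (\<ominus>\<^bsub>M\<^esub> x) \<oplus>\<^bsub>N\<^esub> f x = \<zero>\<^bsub>N\<^esub>"
    using additive_mapD[OF assms(3)] additive_map_zero[OF assms(1-3)] assms(4)
    by (metis M.a_inv_closed M.l_neg)
  then show ?thesis using additive_mapD[OF assms(3)] assms(4) by (simp add: N.minus_equality)
qed

lemma additive_map_minus:
  assumes "abelian_group M" "abelian_group N" "additive_map M N f" "x \<in> carrier M" "y \<in> carrier M"
  shows "f (x \<ominus>\<^bsub>M\<^esub> y) = f x \<ominus>\<^bsub>N\<^esub> f y"
proof -
  interpret M: abelian_group M by fact
  show ?thesis
    using additive_mapD[OF assms(3)] additive_map_neg[OF assms(1-3)] assms(4,5)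
    by (simp add: a_minus_def)
qed

lemma lin_map_additive: "lin_map R M N f \<Longrightarrow> additive_map M N f"
  by (simp add: lin_map_def additive_map_def)

lemma lin_mapD:
  assumes "lin_map R M N f" "x \<in> carrier M"
  shows "f x \<in> carrier N" "y \<in> carrier M \<Longrightarrow> f (x \<oplus>\<^bsub>M\<^esub> y) = f x \<oplus>\<^bsub>N\<^esub> f y"
    "a \<in> carrier R \<Longrightarrow> f (a \<odot>\<^bsub>M\<^esub> x) = a \<odot>\<^bsub>N\<^esub> f x"
  using assms by (auto simp: lin_map_def)

lemma lin_map_comp:
  assumes "lin_map R M N f" "lin_map R N P g" shows "lin_map R M P (\<lambda>x. g (f x))"
  using assms by (auto simp: lin_map_def Pi_iff)

text \<open>Written as a \<open>foldr\<close> so that the sum in \<open>jet1_relations\<close> is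
  literally the instance for \<open>smult M\<close>.\<close>

definition lsum :: "('p, 'z) ring_scheme \<Rightarrow> ('x \<Rightarrow> 'm \<Rightarrow> 'p) \<Rightarrow> ('x \<times> 'm) list \<Rightarrow> 'p"
  where "lsum P \<phi> u = foldr (\<lambda>(x, m) s. \<phi> x m \<oplus>\<^bsub>P\<^esub> s) u \<zero>\<^bsub>P\<^esub>"

lemma lsum_simps [simp]:
  "lsum P \<phi> [] = \<zero>\<^bsub>P\<^esub>" "lsum P \<phi> ((x, m) # u) = \<phi> x m \<oplus>\<^bsub>P\<^esub> lsum P \<phi> u"
  by (simp_all add: lsum_def)

lemma lsum_cong: "(\<And>x m. (x, m) \<in> set u \<Longrightarrow> \<phi> x m = \<psi> x m) \<Longrightarrow> lsum P \<phi> u = lsum P \<psi> u"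
  by (induction u) auto

lemma lsum_map_apfst: "lsum P \<phi> (map (apfst f) u) = lsum P (\<lambda>x m. \<phi> (f x) m) u"
  by (induction u) auto

lemma lsum_map_apsnd: "lsum P \<phi> (map (apsnd f) u) = lsum P (\<lambda>x m. \<phi> x (f m)) u"
  by (induction u) auto

lemma (in abelian_group) lsum_closed:
  "(\<And>x m. (x, m) \<in> set u \<Longrightarrow> \<phi> x m \<in> carrier G) \<Longrightarrow> lsum G \<phi> u \<in> carrier G"
  by (induction u) auto

lemma (in abelian_group) lsum_append:
  assumes "\<And>x m. (x, m) \<in> set u \<union> set v \<Longrightarrow> \<phi> x m \<in> carrier G"
  shows "lsum G \<phi> (u @ v) = lsum G \<phi> u \<oplus> lsum G \<phi> v"
  using assms
proof (induction u)
  case Nil then show ?case by (simp add: lsum_closed)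
next
  case (Cons p u) then show ?case by (cases p) (auto simp: a_assoc lsum_closed)
qed

lemma (in abelian_group) lsum_add:
  assumes "\<And>x m. (x, m) \<in> set u \<Longrightarrow> \<phi> x m \<in> carrier G \<and> \<psi> x m \<in> carrier G"
  shows "lsum G (\<lambda>x m. \<phi> x m \<oplus> \<psi> x m) u = lsum G \<phi> u \<oplus> lsum G \<psi> u"
  using assms
proof (induction u)
  case (Cons p u) then show ?case by (cases p) (auto simp: a_ac lsum_closed)
qed simp

lemma lsum_additive_map:
  assumes "abelian_group M" "abelian_group N" "additive_map M N f"
    and "\<And>x m. (x, m) \<in> set u \<Longrightarrow> \<phi> x m \<in> carrier M"
  shows "f (lsum M \<phi> u) = lsum N (\<lambda>x m. f (\<phi> x m)) u"
  using assms(4)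
proof (induction u)
  case Nil then show ?case by (simp add: additive_map_zero[OF assms(1-3)])
next
  case (Cons p u)
  interpret M: abelian_group M by fact
  show ?case using Cons
    by (cases p) (auto simp: M.lsum_closed additive_mapD(2)[OF assms(3)])
qed

section \<open>Tensor products\<close>

text \<open>Only closure is required of the right action on \<open>X\<close>: the remaining axioms of a right module
  play no role for the presentation by generators and relations.\<close>

locale tensor_factors = M?: left_module R M + X?: abelian_group X
  for R :: "('r, 'b) ring_scheme" and X :: "('r, 'x, 'c) module_scheme"
    and M :: "('r, 'm, 'z) module_scheme" +
  assumes right_smult_closed: "\<lbrakk>r \<in> carrier R; x \<in> carrier X\<rbrakk> \<Longrightarrow> r \<odot>\<^bsub>X\<^esub> x \<in> carrier X"
begin

abbreviation "cls \<equiv> tensor_cls R X M"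
abbreviation "FS \<equiv> formal_sums X M"

lemma formal_sums_simps [simp]:
  "[] \<in> formal_sums X M"
  "(x, m) # u \<in> formal_sums X M \<longleftrightarrow> x \<in> carrier X \<and> m \<in> carrier M \<and> u \<in> formal_sums X M"
  "u @ v \<in> formal_sums X M \<longleftrightarrow> u \<in> formal_sums X M \<and> v \<in> formal_sums X M"
  by (auto simp: formal_sums_def)

lemma tensor_eq_formal_sums: "tensor_eq R X M u v \<Longrightarrow> u \<in> FS \<and> v \<in> FS"
  by (induction rule: tensor_eq.induct) (auto simp: right_smult_closed M.smult_closed)

lemma tensor_cls_eq_iff: "u \<in> FS \<Longrightarrow> cls u = cls v \<longleftrightarrow> tensor_eq R X M u v"
  unfolding tensor_cls_def
  using tensor_eq.refl[of u X M R] tensor_eq.sym[of R X M] tensor_eq.trans[of R X M] by blast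

lemma tensor_cls_mem: "v \<in> cls u \<longleftrightarrow> tensor_eq R X M u v"
  by (simp add: tensor_cls_def)

lemma tensor_simps:
  shows "carrier (tensor R X M act) = cls ` FS"
    and "\<zero>\<^bsub>tensor R X M act\<^esub> = cls []"
    and "\<lbrakk>u \<in> FS; v \<in> FS\<rbrakk> \<Longrightarrow> cls u \<oplus>\<^bsub>tensor R X M act\<^esub> cls v = cls (u @ v)"
proof -
  show "cls u \<oplus>\<^bsub>tensor R X M act\<^esub> cls v = cls (u @ v)" if uv: "u \<in> FS" "v \<in> FS"
  proof -
    have "cls (u' @ v') = cls (u @ v)" if "u' \<in> cls u" "v' \<in> cls v" for u' v'
      using that uv tensor_eq_formal_sums
      by (simp add: tensor_cls_mem tensor_cls_eq_iff) (metis tensor_cls_eq_iff tensor_eq.append tensor_eq.sym formal_sums_simps(3))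
    moreover have "u \<in> cls u" "v \<in> cls v" using uv by (auto simp: tensor_cls_mem tensor_eq.refl)
    ultimately have "(\<Union>u'\<in>cls u. \<Union>v'\<in>cls v. cls (u' @ v')) = cls (u @ v)" by blast
    then show ?thesis by (simp add: tensor_def)
  qed
qed (simp_all add: tensor_def)

text \<open>Only inverses need an argument. A pure tensor is negated in its left factor, and the
  negative of a list is built in reverse order, so that cancellation always happens at the
  seam.\<close>

lemma abelian_group_tensor: "abelian_group (tensor R X M act)"
proof (rule abelian_groupI, goal_cases)
  case (6 t)
  then obtain u where u: "u \<in> FS" "t = cls u" by (auto simp: tensor_simps)
  have "\<exists>v\<in>FS. tensor_eq R X M (v @ u) []" using u(1)
  proof (induction u)
    case Nil then show ?case by (intro bexI[of _ "[]"]) (auto intro: tensor_eq.refl)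
  next
    case (Cons p u)
    obtain x m where p: "p = (x, m)" by fastforce
    obtain v where v: "v \<in> FS" "tensor_eq R X M (v @ u) []" using Cons p by auto
    have xm: "x \<in> carrier X" "m \<in> carrier M" "u \<in> FS" using Cons p by auto
    have n: "tensor_eq R X M [(\<ominus>\<^bsub>X\<^esub> x, m), (x, m)] []"
      using tensor_eq.add_left[of "\<ominus>\<^bsub>X\<^esub> x" X x m M R] tensor_eq.zero[of m M R X] xm
      by (simp add: X.l_neg) (metis tensor_eq.trans tensor_eq.sym)
    have "tensor_eq R X M ((v @ [(\<ominus>\<^bsub>X\<^esub> x, m), (x, m)]) @ u) ((v @ []) @ u)"
      using n v xm by (intro tensor_eq.append tensor_eq.refl) auto
    with v have "tensor_eq R X M ((v @ [(\<ominus>\<^bsub>X\<^esub> x, m)]) @ p # u) []"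
      by (simp add: p, metis tensor_eq.trans)
    then show ?case using v xm by (intro bexI[of _ "v @ [(\<ominus>\<^bsub>X\<^esub> x, m)]"]) auto
  qed
  then obtain v where "v \<in> FS" "tensor_eq R X M (v @ u) []" by blast
  with u show ?case by (intro bexI[of _ "cls v"]) (auto simp: tensor_simps tensor_cls_eq_iff)
next
  case (4 s t)
  then obtain u v where "u \<in> FS" "s = cls u" "v \<in> FS" "t = cls v" by (auto simp: tensor_simps)
  then show ?case by (simp add: tensor_simps tensor_cls_eq_iff tensor_eq.commute)
qed (auto simp: tensor_simps)

text \<open>Everything is asked on generators only. The first hypotheses say that the action
  respects the defining relations; of the module axioms, \<open>assoc\<close> and \<open>one\<close>
  are equations between pairs, while \<open>distr\<close> holds only modulo the relations.\<close>

lemma left_module_tensor: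
  assumes S: "ring S"
    and closed: "\<And>s x m. \<lbrakk>s \<in> carrier S; x \<in> carrier X; m \<in> carrier M\<rbrakk> \<Longrightarrow>
      act s (x, m) \<in> carrier X \<times> carrier M"
    and zero: "\<And>s m. \<lbrakk>s \<in> carrier S; m \<in> carrier M\<rbrakk> \<Longrightarrow> tensor_eq R X M [act s (\<zero>\<^bsub>X\<^esub>, m)] []"
    and add_left: "\<And>s x y m. \<lbrakk>s \<in> carrier S; x \<in> carrier X; y \<in> carrier X; m \<in> carrier M\<rbrakk> \<Longrightarrow>
      tensor_eq R X M [act s (x \<oplus>\<^bsub>X\<^esub> y, m)] [act s (x, m), act s (y, m)]"
    and add_right: "\<And>s x m n. \<lbrakk>s \<in> carrier S; x \<in> carrier X; m \<in> carrier M; n \<in> carrier M\<rbrakk> \<Longrightarrow>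
      tensor_eq R X M [act s (x, m \<oplus>\<^bsub>M\<^esub> n)] [act s (x, m), act s (x, n)]"
    and balanced: "\<And>s r x m. \<lbrakk>s \<in> carrier S; r \<in> carrier R; x \<in> carrier X; m \<in> carrier M\<rbrakk> \<Longrightarrow>
      tensor_eq R X M [act s (r \<odot>\<^bsub>X\<^esub> x, m)] [act s (x, r \<odot>\<^bsub>M\<^esub> m)]"
    and distr: "\<And>s t x m. \<lbrakk>s \<in> carrier S; t \<in> carrier S; x \<in> carrier X; m \<in> carrier M\<rbrakk> \<Longrightarrow>
      tensor_eq R X M [act (s \<oplus>\<^bsub>S\<^esub> t) (x, m)] [act s (x, m), act t (x, m)]"
    and assoc: "\<And>s t x m. \<lbrakk>s \<in> carrier S; t \<in> carrier S; x \<in> carrier X; m \<in> carrier M\<rbrakk> \<Longrightarrow>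
      act (s \<otimes>\<^bsub>S\<^esub> t) (x, m) = act s (act t (x, m))"
    and one: "\<And>x m. \<lbrakk>x \<in> carrier X; m \<in> carrier M\<rbrakk> \<Longrightarrow> act \<one>\<^bsub>S\<^esub> (x, m) = (x, m)"
  shows "left_module S (tensor R X M act)"
    and "\<lbrakk>s \<in> carrier S; u \<in> FS\<rbrakk> \<Longrightarrow> s \<odot>\<^bsub>tensor R X M act\<^esub> cls u = cls (map (act s) u)"
proof -
  let ?T = "tensor R X M act"
  have cl: "map (act s) u \<in> FS" if "s \<in> carrier S" "u \<in> FS" for s u
    using that(2) by (induction u) (use closed[OF that(1)] in \<open>auto simp: formal_sums_def\<close>)
  have resp: "tensor_eq R X M (map (act s) u) (map (act s) v)"
    if "tensor_eq R X M u v" "s \<in> carrier S" for s u v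
    using that
  proof (induction rule: tensor_eq.induct)
    case (refl u) then show ?case using cl by (simp add: tensor_eq.refl)
  next
    case (sym u v) then show ?case by (metis tensor_eq.sym)
  next
    case (trans u v w) then show ?case by (metis tensor_eq.trans)
  next
    case (append u u' v v') then show ?case by (simp add: tensor_eq.append)
  next
    case (commute u v) then show ?case using cl by (simp add: tensor_eq.commute)
  qed (simp_all add: zero add_left add_right balanced)
  show smult: "s \<odot>\<^bsub>?T\<^esub> cls u = cls (map (act s) u)" if "s \<in> carrier S" "u \<in> FS" for s u
  proof -
    have "cls (map (act s) v) = cls (map (act s) u)" if v: "v \<in> cls u" for v
    proof -
      have "tensor_eq R X M u v" "v \<in> FS" using v tensor_eq_formal_sums by (auto simp: tensor_cls_mem)
      then show ?thesis
        using resp \<open>s \<in> carrier S\<close> cl tensor_cls_eq_iff tensor_eq.sym by metis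
    qed
    moreover have "u \<in> cls u" using that by (auto simp: tensor_cls_mem tensor_eq.refl)
    ultimately have "(\<Union>v\<in>cls u. cls (map (act s) v)) = cls (map (act s) u)" by blast
    then show ?thesis by (simp add: tensor_def)
  qed
  interpret T: abelian_group ?T by (rule abelian_group_tensor)
  interpret S: ring S by (rule S)
  have dist: "tensor_eq R X M (map (act (s \<oplus>\<^bsub>S\<^esub> t)) u) (map (act s) u @ map (act t) u)"
    if st: "s \<in> carrier S" "t \<in> carrier S" and "u \<in> FS" for s t u
    using that(3)
  proof (induction u)
    case (Cons p u)
    obtain x m where p: "p = (x, m)" by fastforce
    have u: "u \<in> FS" "x \<in> carrier X" "m \<in> carrier M" using Cons p by auto
    have pc: "[act s p] \<in> FS" "[act t p] \<in> FS" using closed st u by (auto simp: p formal_sums_def)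
    have "tensor_eq R X M ([act (s \<oplus>\<^bsub>S\<^esub> t) p] @ map (act (s \<oplus>\<^bsub>S\<^esub> t)) u)
        ([act s p, act t p] @ (map (act s) u @ map (act t) u))"
      using Cons u distr st by (intro tensor_eq.append) (auto simp: p)
    \<comment> \<open>Acting element by element interleaves the images under \<open>s\<close> and
      \<open>t\<close>; one transposition of neighbouring blocks sorts them.\<close>
    moreover have "tensor_eq R X M ([act s p] @ (([act t p] @ map (act s) u) @ map (act t) u))
      ([act s p] @ ((map (act s) u @ [act t p]) @ map (act t) u))"
      using u st pc cl by (intro tensor_eq.append tensor_eq.refl tensor_eq.commute) auto
    ultimately show ?case by (simp, metis tensor_eq.trans)
  qed (simp add: tensor_eq.refl)
  show "left_module S ?T"
  proof (intro left_module.intro left_module_axioms.intro S T.abelian_group_axioms, goal_cases)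
    case (1 s t) then show ?case using cl by (auto simp: tensor_simps smult)
  next
    case (2 s t x)
    then obtain u where u: "u \<in> FS" "x = cls u" by (auto simp: tensor_simps)
    then have "cls (map (act (s \<oplus>\<^bsub>S\<^esub> t)) u) = cls (map (act s) u @ map (act t) u)"
      using cl dist 2 by (subst tensor_cls_eq_iff) auto
    then show ?case using 2 u cl by (simp add: tensor_simps smult)
  next
    case (3 s x y) then show ?case using cl by (auto simp: tensor_simps smult)
  next
    case (4 s t x)
    then obtain u where u: "u \<in> FS" "x = cls u" by (auto simp: tensor_simps)
    have "map (act (s \<otimes>\<^bsub>S\<^esub> t)) u = map (act s) (map (act t) u)"
      using u(1) 4 assoc by (auto simp: formal_sums_def)
    then show ?case using 4 u cl by (simp add: smult del: map_map)
  next
    case (5 x)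
    then obtain u where u: "u \<in> FS" "x = cls u" by (auto simp: tensor_simps)
    have "map (act \<one>\<^bsub>S\<^esub>) u = u"
      using u(1) one by (intro map_idI) (auto simp: formal_sums_def)
    then show ?case using u by (simp add: smult)
  qed
qed

end

section \<open>The universal property of the tensor product\<close>

definition balanced_map ::
  "('r, 'b) ring_scheme \<Rightarrow> ('r, 'x, 'c) module_scheme \<Rightarrow> ('r, 'm, 'z) module_scheme \<Rightarrow>
    ('p, 'y) ring_scheme \<Rightarrow> ('x \<Rightarrow> 'm \<Rightarrow> 'p) \<Rightarrow> bool"
  where "balanced_map R X M P \<phi> \<longleftrightarrow>
    (\<forall>x\<in>carrier X. \<forall>m\<in>carrier M. \<phi> x m \<in> carrier P) \<and>
    (\<forall>x\<in>carrier X. \<forall>y\<in>carrier X. \<forall>m\<in>carrier M. \<phi> (x \<oplus>\<^bsub>X\<^esub> y) m = \<phi> x m \<oplus>\<^bsub>P\<^esub> \<phi> y m) \<and>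
    (\<forall>x\<in>carrier X. \<forall>m\<in>carrier M. \<forall>n\<in>carrier M. \<phi> x (m \<oplus>\<^bsub>M\<^esub> n) = \<phi> x m \<oplus>\<^bsub>P\<^esub> \<phi> x n) \<and>
    (\<forall>r\<in>carrier R. \<forall>x\<in>carrier X. \<forall>m\<in>carrier M. \<phi> (r \<odot>\<^bsub>X\<^esub> x) m = \<phi> x (r \<odot>\<^bsub>M\<^esub> m))"

lemma balanced_mapI:
  assumes "\<And>x m. \<lbrakk>x \<in> carrier X; m \<in> carrier M\<rbrakk> \<Longrightarrow> \<phi> x m \<in> carrier P"
    and "\<And>x y m. \<lbrakk>x \<in> carrier X; y \<in> carrier X; m \<in> carrier M\<rbrakk> \<Longrightarrow> \<phi> (x \<oplus>\<^bsub>X\<^esub> y) m = \<phi> x m \<oplus>\<^bsub>P\<^esub> \<phi> y m"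
    and "\<And>x m n. \<lbrakk>x \<in> carrier X; m \<in> carrier M; n \<in> carrier M\<rbrakk> \<Longrightarrow> \<phi> x (m \<oplus>\<^bsub>M\<^esub> n) = \<phi> x m \<oplus>\<^bsub>P\<^esub> \<phi> x n"
    and "\<And>r x m. \<lbrakk>r \<in> carrier R; x \<in> carrier X; m \<in> carrier M\<rbrakk> \<Longrightarrow> \<phi> (r \<odot>\<^bsub>X\<^esub> x) m = \<phi> x (r \<odot>\<^bsub>M\<^esub> m)"
  shows "balanced_map R X M P \<phi>"
  using assms by (simp add: balanced_map_def)

text \<open>Evaluated at one chosen representative; \<open>lsum_tensor_eq\<close> makes the choice
  immaterial when \<open>\<phi>\<close> is balanced.\<close>

definition tensor_lift :: "('p, 'y) ring_scheme \<Rightarrow> ('x \<Rightarrow> 'm \<Rightarrow> 'p) \<Rightarrow> ('x \<times> 'm) list set \<Rightarrow> 'p"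
  where "tensor_lift P \<phi> U = lsum P \<phi> (SOME u. u \<in> U)"

context tensor_factors
begin

context
  fixes P :: "('p, 'y) ring_scheme" and \<phi>
  assumes P: "abelian_group P" and \<phi>: "balanced_map R X M P \<phi>"
begin

interpretation P: abelian_group P by (rule P)

lemma balanced_mapD:
  "\<lbrakk>x \<in> carrier X; m \<in> carrier M\<rbrakk> \<Longrightarrow> \<phi> x m \<in> carrier P"
  "\<lbrakk>x \<in> carrier X; y \<in> carrier X; m \<in> carrier M\<rbrakk> \<Longrightarrow> \<phi> (x \<oplus>\<^bsub>X\<^esub> y) m = \<phi> x m \<oplus>\<^bsub>P\<^esub> \<phi> y m"
  "\<lbrakk>x \<in> carrier X; m \<in> carrier M; n \<in> carrier M\<rbrakk> \<Longrightarrow> \<phi> x (m \<oplus>\<^bsub>M\<^esub> n) = \<phi> x m \<oplus>\<^bsub>P\<^esub> \<phi> x n"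
  "\<lbrakk>r \<in> carrier R; x \<in> carrier X; m \<in> carrier M\<rbrakk> \<Longrightarrow> \<phi> (r \<odot>\<^bsub>X\<^esub> x) m = \<phi> x (r \<odot>\<^bsub>M\<^esub> m)"
  using \<phi> by (simp_all add: balanced_map_def)

lemma lsum_balanced_closed: "u \<in> FS \<Longrightarrow> lsum P \<phi> u \<in> carrier P"
  by (rule P.lsum_closed) (auto simp: formal_sums_def balanced_mapD)

lemma lsum_balanced_append:
  "\<lbrakk>u \<in> FS; v \<in> FS\<rbrakk> \<Longrightarrow> lsum P \<phi> (u @ v) = lsum P \<phi> u \<oplus>\<^bsub>P\<^esub> lsum P \<phi> v"
  by (rule P.lsum_append) (auto simp: formal_sums_def balanced_mapD)

lemma lsum_tensor_eq: "tensor_eq R X M u v \<Longrightarrow> lsum P \<phi> u = lsum P \<phi> v"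
proof (induction rule: tensor_eq.induct)
  case (zero m)
  \<comment> \<open>Additivity in the left argument makes this value equal to its own double, hence
    zero.\<close>
  have "\<phi> \<zero>\<^bsub>X\<^esub> m \<oplus>\<^bsub>P\<^esub> \<phi> \<zero>\<^bsub>X\<^esub> m = \<phi> \<zero>\<^bsub>X\<^esub> m" using zero balanced_mapD(2)[of "\<zero>\<^bsub>X\<^esub>" "\<zero>\<^bsub>X\<^esub>" m] by simp
  then have "\<phi> \<zero>\<^bsub>X\<^esub> m = \<zero>\<^bsub>P\<^esub>"
    using zero balanced_mapD(1)[of "\<zero>\<^bsub>X\<^esub>" m] by (simp add: P.add.r_cancel_one)
  then show ?case by simp
next
  case (append u u' v v')
  then show ?case using tensor_eq_formal_sums by (simp add: lsum_balanced_append)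
next
  case (commute u v)
  then show ?case by (simp add: lsum_balanced_append lsum_balanced_closed P.a_comm)
qed (simp_all add: balanced_mapD M.smult_closed right_smult_closed)

lemma tensor_lift_cls:
  assumes "u \<in> FS" shows "tensor_lift P \<phi> (cls u) = lsum P \<phi> u"
proof -
  have "u \<in> cls u" using assms by (simp add: tensor_cls_mem tensor_eq.refl)
  then have "(SOME v. v \<in> cls u) \<in> cls u" by (rule someI)
  then show ?thesis by (simp add: tensor_lift_def tensor_cls_mem lsum_tensor_eq[symmetric])
qed

lemma tensor_lift_additive: "additive_map (tensor R X M act) P (tensor_lift P \<phi>)"
  unfolding additive_map_def tensor_simps(1)
  by (simp add: Pi_iff tensor_simps tensor_lift_cls lsum_balanced_closed lsum_balanced_append)

end

lemma lsum_pure: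
  assumes "u \<in> formal_sums Y N" "\<And>y n. \<lbrakk>y \<in> carrier Y; n \<in> carrier N\<rbrakk> \<Longrightarrow> f y n \<in> carrier X \<and> g y n \<in> carrier M"
  shows "lsum (tensor R X M act) (\<lambda>y n. cls [(f y n, g y n)]) u = cls (map (\<lambda>(y, n). (f y n, g y n)) u)"
  using assms(1)
proof (induction u)
  case (Cons p u)
  obtain y n where p: "p = (y, n)" by fastforce
  have u: "u \<in> formal_sums Y N" and yn: "y \<in> carrier Y" "n \<in> carrier N"
    using Cons by (auto simp: formal_sums_def p)
  then have "map (\<lambda>(y, n). (f y n, g y n)) u \<in> FS"
    using assms(2) by (force simp: formal_sums_def)
  then show ?case using Cons.IH[OF u] yn assms(2) by (simp add: p tensor_simps)
qed (simp add: tensor_simps)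

lemma pure_tensor_balanced: "balanced_map R X M (tensor R X M act) (\<lambda>x m. cls [(x, m)])"
  by (rule balanced_mapI)
    (simp_all add: tensor_simps image_eqI[OF HOL.refl] tensor_cls_eq_iff M.smult_closed right_smult_closed
      tensor_eq.add_left tensor_eq.add_right tensor_eq.balanced)

lemma additive_map_tensor_eqI:
  assumes P: "abelian_group P" and f: "additive_map (tensor R X M act) P f"
    and g: "additive_map (tensor R X M act) P g"
    and eq: "\<And>x m. \<lbrakk>x \<in> carrier X; m \<in> carrier M\<rbrakk> \<Longrightarrow> f (cls [(x, m)]) = g (cls [(x, m)])"
    and t: "t \<in> carrier (tensor R X M act)"
  shows "f t = g t"
proof -
  let ?T = "tensor R X M act"
  obtain u where u: "u \<in> FS" "t = cls u" using t by (auto simp: tensor_simps)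
  have "lsum ?T (\<lambda>x m. cls [(x, m)]) u = cls (map (\<lambda>(x, m). (x, m)) u)"
    by (rule lsum_pure[OF u(1)]) auto
  then have t': "t = lsum ?T (\<lambda>x m. cls [(x, m)]) u" using u by simp
  have pc: "\<And>x m. (x, m) \<in> set u \<Longrightarrow> cls [(x, m)] \<in> carrier ?T"
    using u by (auto simp: formal_sums_def tensor_simps)
  have "f t = lsum P (\<lambda>x m. f (cls [(x, m)])) u"
    unfolding t' by (rule lsum_additive_map[OF abelian_group_tensor P f pc])
  also have "\<dots> = lsum P (\<lambda>x m. g (cls [(x, m)])) u"
    by (rule lsum_cong, rule eq) (use u in \<open>auto simp: formal_sums_def\<close>)
  also have "\<dots> = g t"
    unfolding t' by (rule lsum_additive_map[OF abelian_group_tensor P g pc, symmetric])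
  finally show ?thesis .
qed

end

section \<open>The calculus\<close>

lemma left_module_of_module: "Module.module K M \<Longrightarrow> left_module K M"
  unfolding Module.module_def module_axioms_def left_module_def left_module_axioms_def
  by (auto intro: cring.axioms)

lemma module_of_left_module: "\<lbrakk>cring K; left_module K M\<rbrakk> \<Longrightarrow> Module.module K M"
  unfolding Module.module_def module_axioms_def left_module_def left_module_axioms_def by auto

context exterior_algebra
begin

abbreviation "Sc \<equiv> scalars D"
abbreviation "A \<equiv> alg D"
abbreviation "W \<equiv> forms D"

sublocale W: assoc_algebra "scalars D" "forms D" by (rule algebra)

lemma degree_carrier: "\<omega> \<in> degree_part D n \<Longrightarrow> \<omega> \<in> carrier W"
  using degree_submodule[of n] by (auto simp: submodule_def subgroup_def)

lemma degree_zero: "\<zero>\<^bsub>W\<^esub> \<in> degree_part D n"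
  using degree_submodule[of n] by (auto simp: submodule_def subgroup_def)

lemma degree_add: "\<lbrakk>\<omega> \<in> degree_part D n; \<eta> \<in> degree_part D n\<rbrakk> \<Longrightarrow> \<omega> \<oplus>\<^bsub>W\<^esub> \<eta> \<in> degree_part D n"
  using degree_submodule[of n] by (auto simp: submodule_def subgroup_def)

lemma degree_neg: "\<omega> \<in> degree_part D n \<Longrightarrow> \<ominus>\<^bsub>W\<^esub> \<omega> \<in> degree_part D n"
  using degree_submodule[of n] by (auto simp: submodule_def subgroup_def a_inv_def)

lemma degree_smult: "\<lbrakk>k \<in> carrier Sc; \<omega> \<in> degree_part D n\<rbrakk> \<Longrightarrow> k \<odot>\<^bsub>W\<^esub> \<omega> \<in> degree_part D n"
  using degree_submodule[of n] by (auto simp: submodule_def submodule_axioms_def)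

lemma degree_mult0:
  "\<lbrakk>a \<in> degree_part D 0; \<omega> \<in> degree_part D k\<rbrakk> \<Longrightarrow> a \<otimes>\<^bsub>W\<^esub> \<omega> \<in> degree_part D k"
  "\<lbrakk>\<omega> \<in> degree_part D k; a \<in> degree_part D 0\<rbrakk> \<Longrightarrow> \<omega> \<otimes>\<^bsub>W\<^esub> a \<in> degree_part D k"
  using degree_mult[of a 0 \<omega> k] degree_mult[of \<omega> k a 0] by simp_all

lemma degree_mult_one:
  "\<lbrakk>\<omega> \<in> degree_part D (Suc 0); \<eta> \<in> degree_part D (Suc 0)\<rbrakk> \<Longrightarrow> \<omega> \<otimes>\<^bsub>W\<^esub> \<eta> \<in> degree_part D 2"
  using degree_mult[of \<omega> "Suc 0" \<eta> "Suc 0"] by (simp add: numeral_2_eq_2)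

lemmas degree_simps = degree_carrier degree_zero degree_add degree_neg degree_one degree_mult0
  degree_smult degree_mult_one d_degree

lemma d_closed: "\<omega> \<in> carrier W \<Longrightarrow> extd D \<omega> \<in> carrier W"
  using d_linear by (auto simp: lin_map_def)

lemma d_add: "\<lbrakk>\<omega> \<in> carrier W; \<eta> \<in> carrier W\<rbrakk> \<Longrightarrow> extd D (\<omega> \<oplus>\<^bsub>W\<^esub> \<eta>) = extd D \<omega> \<oplus>\<^bsub>W\<^esub> extd D \<eta>"
  using d_linear by (auto simp: lin_map_def)

lemma d_smult: "\<lbrakk>k \<in> carrier Sc; \<omega> \<in> carrier W\<rbrakk> \<Longrightarrow> extd D (k \<odot>\<^bsub>W\<^esub> \<omega>) = k \<odot>\<^bsub>W\<^esub> extd D \<omega>"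
  using d_linear by (auto simp: lin_map_def)

lemma d_mult0: "\<lbrakk>a \<in> degree_part D 0; \<omega> \<in> carrier W\<rbrakk> \<Longrightarrow>
    extd D (a \<otimes>\<^bsub>W\<^esub> \<omega>) = extd D a \<otimes>\<^bsub>W\<^esub> \<omega> \<oplus>\<^bsub>W\<^esub> a \<otimes>\<^bsub>W\<^esub> extd D \<omega>"
  using d_leibniz[of a 0 \<omega>] by simp

lemma d_mult1: "\<lbrakk>w \<in> degree_part D (Suc 0); \<omega> \<in> carrier W\<rbrakk> \<Longrightarrow>
    extd D (w \<otimes>\<^bsub>W\<^esub> \<omega>) = extd D w \<otimes>\<^bsub>W\<^esub> \<omega> \<ominus>\<^bsub>W\<^esub> w \<otimes>\<^bsub>W\<^esub> extd D \<omega>"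
  using d_leibniz[of w "Suc 0" \<omega>] by (simp add: a_minus_def)

text \<open>The Leibniz rule for \<open>1 * 1\<close> makes \<open>d 1\<close> equal to its own
  double.\<close>

lemma d_one: "extd D \<one>\<^bsub>W\<^esub> = \<zero>\<^bsub>W\<^esub>"
proof -
  have c: "extd D \<one>\<^bsub>W\<^esub> \<in> carrier W" by (simp add: d_closed)
  then have "extd D \<one>\<^bsub>W\<^esub> = extd D \<one>\<^bsub>W\<^esub> \<oplus>\<^bsub>W\<^esub> extd D \<one>\<^bsub>W\<^esub>"
    using d_mult0[OF degree_one, of "\<one>\<^bsub>W\<^esub>"] by simp
  then show ?thesis using c by (metis W.add.r_cancel_one')
qed

lemma alg_simps [simp]:
  "carrier A = degree_part D 0" "mult A = mult W" "one A = one W" "zero A = zero W"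
  "add A = add W" "smult A = smult W"
  by (simp_all add: alg_def)

lemma right_forms_simps [simp]:
  "carrier (right_forms D k) = degree_part D k" "zero (right_forms D k) = zero W"
  "add (right_forms D k) = add W" "a \<odot>\<^bsub>right_forms D k\<^esub> \<omega> = \<omega> \<otimes>\<^bsub>W\<^esub> a"
  by (simp_all add: right_forms_def)

lemma restrict_scalars_simps [simp]:
  "carrier (restrict_scalars D M) = carrier M" "zero (restrict_scalars D M) = zero M"
  "add (restrict_scalars D M) = add M"
  "k \<odot>\<^bsub>restrict_scalars D M\<^esub> x = (k \<odot>\<^bsub>W\<^esub> \<one>\<^bsub>W\<^esub>) \<odot>\<^bsub>M\<^esub> x"
  by (simp_all add: restrict_scalars_def)

lemma abelian_group_degree:
  assumes "carrier N = degree_part D k" "zero N = zero W" "add N = add W"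
  shows "abelian_group N"
proof (rule abelian_groupI)
  show "\<exists>y\<in>carrier N. y \<oplus>\<^bsub>N\<^esub> x = \<zero>\<^bsub>N\<^esub>" if "x \<in> carrier N" for x
    using that by (intro bexI[of _ "\<ominus>\<^bsub>W\<^esub> x"]) (auto simp: assms degree_simps W.l_neg)
qed (auto simp: assms degree_simps W.a_ac)

lemma ring_alg: "ring A"
proof (rule ringI)
  show "abelian_group A" by (rule abelian_group_degree[of _ 0]) simp_all
  show "monoid A" by (rule monoidI) (auto simp: degree_simps W.m_assoc)
qed (auto simp: degree_simps W.l_distr W.r_distr)

lemma abelian_group_right_forms: "abelian_group (right_forms D k)"
  by (rule abelian_group_degree[of _ k]) simp_all

text \<open>Scalars act on \<open>A\<close>-modules through multiples of the unit. Their centrality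
  makes multiplication by a scalar an \<open>A\<close>-linear map, from which the linearity of
  quantizations over the scalars will follow.\<close>

lemma scalar_central:
  assumes "k \<in> carrier Sc" "\<omega> \<in> carrier W"
  shows "(k \<odot>\<^bsub>W\<^esub> \<one>\<^bsub>W\<^esub>) \<otimes>\<^bsub>W\<^esub> \<omega> = k \<odot>\<^bsub>W\<^esub> \<omega>" "\<omega> \<otimes>\<^bsub>W\<^esub> (k \<odot>\<^bsub>W\<^esub> \<one>\<^bsub>W\<^esub>) = k \<odot>\<^bsub>W\<^esub> \<omega>"
  using assms by (simp_all add: W.smult_mult_left W.smult_mult_right)

end

locale dga_module = exterior_algebra D + M: left_module "alg D" M
  for D :: "('k, 'w) dga" and M :: "('w, 'm) module"
begin

lemma left_module_restrict_scalars: "left_module Sc (restrict_scalars D M)"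
proof -
  interpret R: abelian_group "restrict_scalars D M"
    by (rule abelian_groupI) (auto simp: M.M.a_ac intro: M.M.l_neg bexI[of _ "\<ominus>\<^bsub>M\<^esub> x" for x])
  have 1: "k \<odot>\<^bsub>W\<^esub> \<one>\<^bsub>W\<^esub> \<in> degree_part D 0" if "k \<in> carrier Sc" for k
    using that by (simp add: degree_simps)
  show ?thesis
  proof (intro left_module.intro left_module_axioms.intro W.R.ring_axioms R.abelian_group_axioms,
      goal_cases)
    case (1 a x) then show ?case using M.smult_closed degree_simps by simp
  next
    case (2 a b x) then show ?case
      using M.smult_l_distr[of "a \<odot>\<^bsub>W\<^esub> \<one>\<^bsub>W\<^esub>" "b \<odot>\<^bsub>W\<^esub> \<one>\<^bsub>W\<^esub>" x] degree_simps
      by (simp add: W.smult_l_distr)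
  next
    case (3 a x y) then show ?case using M.smult_r_distr degree_simps by simp
  next
    case (4 a b x) then show ?case
      using M.smult_assoc[of "a \<odot>\<^bsub>W\<^esub> \<one>\<^bsub>W\<^esub>" "b \<odot>\<^bsub>W\<^esub> \<one>\<^bsub>W\<^esub>" x] degree_simps
        scalar_central(1)[of a "b \<odot>\<^bsub>W\<^esub> \<one>\<^bsub>W\<^esub>"]
      by (simp add: W.smult_assoc1)
  next
    case (5 x) then show ?case using M.smult_one by simp
  qed
qed

sublocale T: tensor_factors "alg D" "right_forms D k" M for k
  by (intro tensor_factors.intro M.left_module_axioms abelian_group_right_forms
      tensor_factors_axioms.intro) (simp add: degree_simps)

abbreviation "T k \<equiv> forms_with_coeffs D k M"
abbreviation "pt k w m \<equiv> forms_cls D k M [(w, m)]"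

lemma left_module_forms: "left_module A (T k)"
  and smult_forms_cls: "\<lbrakk>a \<in> degree_part D 0; u \<in> formal_sums (right_forms D k) M\<rbrakk> \<Longrightarrow>
    a \<odot>\<^bsub>T k\<^esub> forms_cls D k M u = forms_cls D k M (map (apfst (\<lambda>\<omega>. a \<otimes>\<^bsub>W\<^esub> \<omega>)) u)"
proof -
  let ?act = "\<lambda>a. apfst (\<lambda>\<omega>. a \<otimes>\<^bsub>W\<^esub> \<omega>) :: 'w \<times> 'm \<Rightarrow> 'w \<times> 'm"
  let ?e = "tensor_eq A (right_forms D k) M"
  note tens = T.left_module_tensor[where S = A and act = ?act and k = k]
  have 1: "?e [(\<zero>\<^bsub>W\<^esub>, m)] []" if "m \<in> carrier M" for m
    using that tensor_eq.zero[of m M A "right_forms D k"] by (simp add: degree_simps)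
  have 2: "?e [(a \<otimes>\<^bsub>W\<^esub> (x \<oplus>\<^bsub>W\<^esub> y), m)] [(a \<otimes>\<^bsub>W\<^esub> x, m), (a \<otimes>\<^bsub>W\<^esub> y, m)]"
    if "a \<in> degree_part D 0" "m \<in> carrier M" "x \<in> degree_part D k" "y \<in> degree_part D k" for a m x y
    using that tensor_eq.add_left[of "a \<otimes>\<^bsub>W\<^esub> x" "right_forms D k" "a \<otimes>\<^bsub>W\<^esub> y" m M A]
    by (simp add: degree_simps W.r_distr)
  have 3: "?e [(x, m \<oplus>\<^bsub>M\<^esub> n)] [(x, m), (x, n)]"
    if "m \<in> carrier M" "x \<in> degree_part D k" "n \<in> carrier M" for m x n
    using that tensor_eq.add_right[of "x" "right_forms D k" m M n A] by simp
  have 4: "?e [(a \<otimes>\<^bsub>W\<^esub> (x \<otimes>\<^bsub>W\<^esub> r), m)] [(a \<otimes>\<^bsub>W\<^esub> x, r \<odot>\<^bsub>M\<^esub> m)]"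
    if "a \<in> degree_part D 0" "m \<in> carrier M" "x \<in> degree_part D k" "r \<in> degree_part D 0" for a m x r
    using that tensor_eq.balanced[of r A "a \<otimes>\<^bsub>W\<^esub> x" "right_forms D k" m M]
    by (simp add: degree_simps W.m_assoc)
  have 5: "?e [((a \<oplus>\<^bsub>W\<^esub> b) \<otimes>\<^bsub>W\<^esub> x, m)] [(a \<otimes>\<^bsub>W\<^esub> x, m), (b \<otimes>\<^bsub>W\<^esub> x, m)]"
    if "a \<in> degree_part D 0" "m \<in> carrier M" "x \<in> degree_part D k" "b \<in> degree_part D 0" for a m x b
    using that tensor_eq.add_left[of "a \<otimes>\<^bsub>W\<^esub> x" "right_forms D k" "b \<otimes>\<^bsub>W\<^esub> x" m M A]
    by (simp add: degree_simps W.l_distr)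
  show "left_module A (T k)"
    unfolding forms_with_coeffs_def
    by (rule tens(1)) (simp_all add: ring_alg degree_simps 1 2 3 4 5 W.m_assoc)
  show "a \<odot>\<^bsub>T k\<^esub> forms_cls D k M u = forms_cls D k M (map (apfst (\<lambda>\<omega>. a \<otimes>\<^bsub>W\<^esub> \<omega>)) u)"
    if "a \<in> degree_part D 0" "u \<in> formal_sums (right_forms D k) M"
    unfolding forms_with_coeffs_def forms_cls_def
    by (rule tens(2)) (use that in \<open>simp_all add: ring_alg degree_simps 1 2 3 4 5 W.m_assoc\<close>)
qed

sublocale TM: left_module "alg D" "T k" for k by (rule left_module_forms)

lemma pt_simps:
  assumes "w \<in> degree_part D k" "m \<in> carrier M"
  shows pt_closed: "pt k w m \<in> carrier (T k)"
    and pt_add_left: "w' \<in> degree_part D k \<Longrightarrow> pt k (w \<oplus>\<^bsub>W\<^esub> w') m = pt k w m \<oplus>\<^bsub>T k\<^esub> pt k w' m"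
    and pt_add_right: "m' \<in> carrier M \<Longrightarrow> pt k w (m \<oplus>\<^bsub>M\<^esub> m') = pt k w m \<oplus>\<^bsub>T k\<^esub> pt k w m'"
    and pt_balanced: "a \<in> degree_part D 0 \<Longrightarrow> pt k (w \<otimes>\<^bsub>W\<^esub> a) m = pt k w (a \<odot>\<^bsub>M\<^esub> m)"
    and pt_smult: "a \<in> degree_part D 0 \<Longrightarrow> a \<odot>\<^bsub>T k\<^esub> pt k w m = pt k (a \<otimes>\<^bsub>W\<^esub> w) m"
  using T.pure_tensor_balanced[of k "\<lambda>a. apfst (\<lambda>\<omega>. a \<otimes>\<^bsub>W\<^esub> \<omega>)"] assms
  unfolding balanced_map_def forms_cls_def[symmetric] forms_with_coeffs_def[symmetric]
  by (simp_all add: smult_forms_cls)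

lemma pt_zero: "m \<in> carrier M \<Longrightarrow> pt k \<zero>\<^bsub>W\<^esub> m = \<zero>\<^bsub>T k\<^esub>"
  using additive_map_zero[OF abelian_group_right_forms[of k] TM.M.abelian_group_axioms[of k],
      of "\<lambda>w. pt k w m"]
  by (simp add: additive_map_def pt_simps)

lemma pt_zero_right: "w \<in> degree_part D k \<Longrightarrow> pt k w \<zero>\<^bsub>M\<^esub> = \<zero>\<^bsub>T k\<^esub>"
  using additive_map_zero[OF M.M.abelian_group_axioms TM.M.abelian_group_axioms[of k],
      of "\<lambda>m. pt k w m"]
  by (simp add: additive_map_def pt_simps)

lemma forms_additive_eqI:
  assumes "abelian_group P" "additive_map (T k) P f" "additive_map (T k) P g"
    "\<And>w m. \<lbrakk>w \<in> degree_part D k; m \<in> carrier M\<rbrakk> \<Longrightarrow> f (pt k w m) = g (pt k w m)"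
    "t \<in> carrier (T k)"
  shows "f t = g t"
  by (rule T.additive_map_tensor_eqI[where f = f and g = g and k = k and P = P,
        OF assms(1) assms(2,3)[unfolded forms_with_coeffs_def] _ assms(5)[unfolded forms_with_coeffs_def]])
    (simp add: assms(4)[unfolded forms_cls_def])

lemma forms_lift:
  assumes P: "abelian_group P" and b: "balanced_map A (right_forms D k) M P \<phi>"
  shows "additive_map (T k) P (tensor_lift P \<phi>)"
    and "\<lbrakk>w \<in> degree_part D k; m \<in> carrier M\<rbrakk> \<Longrightarrow> tensor_lift P \<phi> (pt k w m) = \<phi> w m"
proof -
  interpret P: abelian_group P by (rule P)
  show "additive_map (T k) P (tensor_lift P \<phi>)"
    unfolding forms_with_coeffs_def by (rule T.tensor_lift_additive[OF P b])
  show "tensor_lift P \<phi> (pt k w m) = \<phi> w m" if "w \<in> degree_part D k" "m \<in> carrier M"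
    using T.tensor_lift_cls[OF P b, of "[(w, m)]"] T.balanced_mapD(1)[OF P b, of w m] that
    by (simp add: forms_cls_def)
qed

lemma forms_cls_lsum:
  assumes "u \<in> formal_sums Y N"
    "\<And>y n. \<lbrakk>y \<in> carrier Y; n \<in> carrier N\<rbrakk> \<Longrightarrow> f y n \<in> degree_part D k \<and> g y n \<in> carrier M"
  shows "forms_cls D k M (map (\<lambda>(y, n). (f y n, g y n)) u) = lsum (T k) (\<lambda>y n. pt k (f y n) (g y n)) u"
  unfolding forms_cls_def forms_with_coeffs_def
  by (rule T.lsum_pure[symmetric]) (use assms in auto)

text \<open>Left multiplication by a 1-form on the level of classes, so that the second holonomy map
  can be expressed by \<open>jet_diff\<close> of the inner jet.\<close>

definition wedge :: "'w \<Rightarrow> ('w \<times> 'm) list set \<Rightarrow> ('w \<times> 'm) list set"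
  where "wedge w = tensor_lift (T 2) (\<lambda>\<eta> m. pt 2 (w \<otimes>\<^bsub>W\<^esub> \<eta>) m)"

lemma wedge_simps:
  assumes "w \<in> degree_part D (Suc 0)"
  shows wedge_additive: "additive_map (T (Suc 0)) (T 2) (wedge w)"
    and wedge_pt: "\<lbrakk>\<eta> \<in> degree_part D (Suc 0); m \<in> carrier M\<rbrakk> \<Longrightarrow>
      wedge w (pt (Suc 0) \<eta> m) = pt 2 (w \<otimes>\<^bsub>W\<^esub> \<eta>) m"
proof -
  have b: "balanced_map A (right_forms D (Suc 0)) M (T 2) (\<lambda>\<eta> m. pt 2 (w \<otimes>\<^bsub>W\<^esub> \<eta>) m)"
    by (rule balanced_mapI)
      (use assms in \<open>simp_all add: pt_simps degree_simps W.r_distr W.m_assoc[symmetric]\<close>)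
  show "additive_map (T (Suc 0)) (T 2) (wedge w)"
    unfolding wedge_def by (rule forms_lift(1)[OF TM.M.abelian_group_axioms b])
  show "\<lbrakk>\<eta> \<in> degree_part D (Suc 0); m \<in> carrier M\<rbrakk> \<Longrightarrow>
      wedge w (pt (Suc 0) \<eta> m) = pt 2 (w \<otimes>\<^bsub>W\<^esub> \<eta>) m"
    unfolding wedge_def by (rule forms_lift(2)[OF TM.M.abelian_group_axioms b])
qed

lemmas wedge_closed = additive_mapD(1)[OF wedge_additive]
lemmas wedge_add_right = additive_mapD(2)[OF wedge_additive]

lemma additive_map_sum:
  assumes "additive_map N (T k) f" "additive_map N (T k) g"
  shows "additive_map N (T k) (\<lambda>x. f x \<oplus>\<^bsub>T k\<^esub> g x)"
  using assms by (auto simp: additive_map_def TM.M.a_ac Pi_iff)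

lemma additive_map_smult:
  assumes "additive_map N (T k) f" "a \<in> degree_part D 0"
  shows "additive_map N (T k) (\<lambda>x. a \<odot>\<^bsub>T k\<^esub> f x)"
  using assms by (auto simp: additive_map_def TM.smult_r_distr TM.smult_closed Pi_iff)

lemma additive_map_pre_smult:
  assumes "additive_map (T k) N f" "a \<in> degree_part D 0"
  shows "additive_map (T k) N (\<lambda>x. f (a \<odot>\<^bsub>T k\<^esub> x))"
  using assms by (auto simp: additive_map_def TM.smult_r_distr TM.smult_closed Pi_iff)

lemma wedge_add_left:
  assumes "w \<in> degree_part D (Suc 0)" "w' \<in> degree_part D (Suc 0)" "t \<in> carrier (T (Suc 0))"
  shows "wedge (w \<oplus>\<^bsub>W\<^esub> w') t = wedge w t \<oplus>\<^bsub>T 2\<^esub> wedge w' t"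
  by (rule forms_additive_eqI[OF TM.M.abelian_group_axioms[of 2] _ _ _ assms(3)])
    (use assms in \<open>simp_all add: wedge_simps degree_simps additive_map_sum W.l_distr pt_simps\<close>)

lemma wedge_smult_left:
  assumes "w \<in> degree_part D (Suc 0)" "a \<in> degree_part D 0" "t \<in> carrier (T (Suc 0))"
  shows "wedge (a \<otimes>\<^bsub>W\<^esub> w) t = a \<odot>\<^bsub>T 2\<^esub> wedge w t"
  by (rule forms_additive_eqI[OF TM.M.abelian_group_axioms[of 2] _ _ _ assms(3)])
    (use assms in \<open>simp_all add: wedge_simps degree_simps additive_map_smult W.m_assoc pt_simps\<close>)

lemma wedge_balanced:
  assumes "w \<in> degree_part D (Suc 0)" "a \<in> degree_part D 0" "t \<in> carrier (T (Suc 0))"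
  shows "wedge (w \<otimes>\<^bsub>W\<^esub> a) t = wedge w (a \<odot>\<^bsub>T (Suc 0)\<^esub> t)"
  by (rule forms_additive_eqI[OF TM.M.abelian_group_axioms[of 2] _ _ _ assms(3)])
    (use assms in \<open>simp_all add: wedge_simps degree_simps additive_map_pre_smult W.m_assoc pt_simps\<close>)

lemma wedge_zero: "t \<in> carrier (T (Suc 0)) \<Longrightarrow> wedge \<zero>\<^bsub>W\<^esub> t = \<zero>\<^bsub>T 2\<^esub>"
  using additive_map_zero[OF abelian_group_right_forms[of "Suc 0"] TM.M.abelian_group_axioms[of 2],
      of "\<lambda>w. wedge w t"]
  by (simp add: additive_map_def wedge_add_left wedge_closed)

end

section \<open>1-jets\<close>

text \<open>The two components of the embedding of \<^term>\<open>jet1 D M\<close> into the sum of \<open>M\<close> and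
  \<open>\<Omega>\<^sup>1 \<otimes> M\<close>: the relations defining 1-jets are those that both components satisfy.\<close>

definition jet_val :: "('k, 'w) dga \<Rightarrow> ('w, 'm) module \<Rightarrow> ('w \<times> 'm) list set set \<Rightarrow> 'm"
  where "jet_val D M X = lsum M (smult M) (jet1_rep D M X)"

definition jet_diff ::
  "('k, 'w) dga \<Rightarrow> ('w, 'm) module \<Rightarrow> ('w \<times> 'm) list set set \<Rightarrow> ('w \<times> 'm) list set"
  where "jet_diff D M X = lsum (forms_with_coeffs D (Suc 0) M)
    (\<lambda>a m. forms_cls D (Suc 0) M [(extd D a, m)]) (jet1_rep D M X)"

definition forms_map ::
  "('k, 'w) dga \<Rightarrow> nat \<Rightarrow> ('w, 'm) module \<Rightarrow> ('w, 'n) module \<Rightarrow> ('m \<Rightarrow> 'n) \<Rightarrow>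
    ('w \<times> 'm) list set \<Rightarrow> ('w \<times> 'n) list set"
  where "forms_map D k M N f =
    tensor_lift (forms_with_coeffs D k N) (\<lambda>w m. forms_cls D k N [(w, f m)])"

lemma (in abelian_group) minus_eq_zero_iff:
  assumes "x \<in> carrier G" "y \<in> carrier G" shows "x \<ominus> y = \<zero> \<longleftrightarrow> x = y"
  using assms by (metis a_minus_def minus_equality minus_minus r_neg a_inv_closed)

context dga_module
begin

sublocale F: tensor_factors "scalars D" "alg D" "restrict_scalars D M"
proof (intro tensor_factors.intro left_module_restrict_scalars tensor_factors_axioms.intro)
  show "abelian_group A" using ring_alg by (rule ring.is_abelian_group)
qed (simp add: degree_simps)

lemma formal_sums_restrict [simp]: "formal_sums X (restrict_scalars D M) = formal_sums X M"
  by (simp add: formal_sums_def)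

lemma jet_formal_sums_simps [simp]:
  "[] \<in> formal_sums A M"
  "(a, m) # u \<in> formal_sums A M \<longleftrightarrow> a \<in> degree_part D 0 \<and> m \<in> carrier M \<and> u \<in> formal_sums A M"
  "u @ v \<in> formal_sums A M \<longleftrightarrow> u \<in> formal_sums A M \<and> v \<in> formal_sums A M"
  by (auto simp: formal_sums_def)

lemma jet_formal_sums_mem:
  "\<lbrakk>u \<in> formal_sums A M; (a, m) \<in> set u\<rbrakk> \<Longrightarrow> a \<in> degree_part D 0 \<and> m \<in> carrier M"
  by (auto simp: formal_sums_def)

abbreviation "FJ \<equiv> free_jet D M"

lemma free_jet_simps:
  "carrier FJ = free_jet_cls D M ` formal_sums A M" "\<zero>\<^bsub>FJ\<^esub> = free_jet_cls D M []"
  "\<lbrakk>u \<in> formal_sums A M; v \<in> formal_sums A M\<rbrakk> \<Longrightarrow>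
    free_jet_cls D M u \<oplus>\<^bsub>FJ\<^esub> free_jet_cls D M v = free_jet_cls D M (u @ v)"
  by (simp_all add: free_jet_def free_jet_cls_def F.tensor_simps)

lemma left_module_free_jet: "left_module A FJ"
  and smult_free_jet_cls: "\<lbrakk>a \<in> degree_part D 0; u \<in> formal_sums A M\<rbrakk> \<Longrightarrow>
    a \<odot>\<^bsub>FJ\<^esub> free_jet_cls D M u = free_jet_cls D M (map (apfst (\<lambda>b. a \<otimes>\<^bsub>W\<^esub> b)) u)"
proof -
  let ?act = "\<lambda>a. apfst (\<lambda>\<omega>. a \<otimes>\<^bsub>W\<^esub> \<omega>) :: 'w \<times> 'm \<Rightarrow> 'w \<times> 'm"
  let ?R = "restrict_scalars D M"
  let ?e = "tensor_eq Sc A ?R"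
  note tens = F.left_module_tensor[where S = A and act = ?act]
  have 1: "?e [(\<zero>\<^bsub>W\<^esub>, m)] []" if "m \<in> carrier M" for m
    using that tensor_eq.zero[of m ?R Sc A] by simp
  have 2: "?e [(a \<otimes>\<^bsub>W\<^esub> (x \<oplus>\<^bsub>W\<^esub> y), m)] [(a \<otimes>\<^bsub>W\<^esub> x, m), (a \<otimes>\<^bsub>W\<^esub> y, m)]"
    if "a \<in> degree_part D 0" "m \<in> carrier M" "x \<in> degree_part D 0" "y \<in> degree_part D 0" for a m x y
    using that tensor_eq.add_left[of "a \<otimes>\<^bsub>W\<^esub> x" A "a \<otimes>\<^bsub>W\<^esub> y" m ?R Sc]
    by (simp add: degree_simps W.r_distr)
  have 3: "?e [(x, m \<oplus>\<^bsub>M\<^esub> n)] [(x, m), (x, n)]"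
    if "m \<in> carrier M" "x \<in> degree_part D 0" "n \<in> carrier M" for m x n
    using that tensor_eq.add_right[of x A m ?R n Sc] by simp
  have 4: "?e [(a \<otimes>\<^bsub>W\<^esub> (r \<odot>\<^bsub>W\<^esub> x), m)] [(a \<otimes>\<^bsub>W\<^esub> x, (r \<odot>\<^bsub>W\<^esub> \<one>\<^bsub>W\<^esub>) \<odot>\<^bsub>M\<^esub> m)]"
    if "a \<in> degree_part D 0" "m \<in> carrier M" "x \<in> degree_part D 0" "r \<in> carrier Sc" for a m x r
    using that tensor_eq.balanced[of r Sc "a \<otimes>\<^bsub>W\<^esub> x" A m ?R]
    by (simp add: degree_simps W.smult_mult_right)
  have 5: "?e [((a \<oplus>\<^bsub>W\<^esub> b) \<otimes>\<^bsub>W\<^esub> x, m)] [(a \<otimes>\<^bsub>W\<^esub> x, m), (b \<otimes>\<^bsub>W\<^esub> x, m)]"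
    if "a \<in> degree_part D 0" "m \<in> carrier M" "x \<in> degree_part D 0" "b \<in> degree_part D 0" for a m x b
    using that tensor_eq.add_left[of "a \<otimes>\<^bsub>W\<^esub> x" A "b \<otimes>\<^bsub>W\<^esub> x" m ?R Sc]
    by (simp add: degree_simps W.l_distr)
  show "left_module A FJ"
    unfolding free_jet_def
    by (rule tens(1)) (simp_all add: ring_alg degree_simps 1 2 3 4 5 W.m_assoc)
  show "a \<odot>\<^bsub>FJ\<^esub> free_jet_cls D M u = free_jet_cls D M (map (apfst (\<lambda>b. a \<otimes>\<^bsub>W\<^esub> b)) u)"
    if "a \<in> degree_part D 0" "u \<in> formal_sums A M"
    unfolding free_jet_def free_jet_cls_def
    by (rule tens(2)) (use that in \<open>simp_all add: ring_alg degree_simps 1 2 3 4 5 W.m_assoc\<close>)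
qed

sublocale FJ: left_module "alg D" "free_jet D M" by (rule left_module_free_jet)

definition free_val :: "('w \<times> 'm) list set \<Rightarrow> 'm"
  where "free_val = tensor_lift M (smult M)"

definition free_diff :: "('w \<times> 'm) list set \<Rightarrow> ('w \<times> 'm) list set"
  where "free_diff = tensor_lift (T (Suc 0)) (\<lambda>a m. pt (Suc 0) (extd D a) m)"

abbreviation "lval \<equiv> lsum M (smult M)"
abbreviation "ldiff \<equiv> lsum (T (Suc 0)) (\<lambda>a m. pt (Suc 0) (extd D a) m)"

lemma free_val_simps:
  shows "additive_map FJ M free_val"
    and "u \<in> formal_sums A M \<Longrightarrow> free_val (free_jet_cls D M u) = lval u"
proof -
  have b: "balanced_map Sc A (restrict_scalars D M) M (smult M)"
  proof (rule balanced_mapI, goal_cases)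
    case (4 r x m)
    then show ?case
      using M.smult_assoc[of x "r \<odot>\<^bsub>W\<^esub> \<one>\<^bsub>W\<^esub>" m] by (simp add: degree_simps scalar_central)
  qed (simp_all add: M.smult_closed M.smult_l_distr[simplified] M.smult_r_distr)
  show "additive_map FJ M free_val"
    unfolding free_val_def free_jet_def by (rule F.tensor_lift_additive[OF M.M.abelian_group_axioms b])
  show "free_val (free_jet_cls D M u) = lval u" if "u \<in> formal_sums A M"
    unfolding free_val_def free_jet_cls_def
    by (rule F.tensor_lift_cls[OF M.M.abelian_group_axioms b]) (use that in simp)
qed

text \<open>Balanced over the scalars because \<open>d\<close> is linear over them and they are
  central; over \<open>A\<close> the Leibniz rule would leave an extra term.\<close>

lemma free_diff_simps:
  shows "additive_map FJ (T (Suc 0)) free_diff"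
    and "u \<in> formal_sums A M \<Longrightarrow> free_diff (free_jet_cls D M u) = ldiff u"
proof -
  have b: "balanced_map Sc A (restrict_scalars D M) (T (Suc 0)) (\<lambda>a m. pt (Suc 0) (extd D a) m)"
  proof (rule balanced_mapI, goal_cases)
    case (4 r x m)
    then have "extd D (r \<odot>\<^bsub>W\<^esub> x) = extd D x \<otimes>\<^bsub>W\<^esub> (r \<odot>\<^bsub>W\<^esub> \<one>\<^bsub>W\<^esub>)"
      by (simp add: d_smult d_closed degree_simps scalar_central)
    with 4 show ?case using pt_balanced[of "extd D x" "Suc 0" m "r \<odot>\<^bsub>W\<^esub> \<one>\<^bsub>W\<^esub>"]
      by (simp add: degree_simps)
  qed (simp_all add: pt_simps degree_simps d_add)
  show "additive_map FJ (T (Suc 0)) free_diff"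
    unfolding free_diff_def free_jet_def
    by (rule F.tensor_lift_additive[OF TM.M.abelian_group_axioms b])
  show "free_diff (free_jet_cls D M u) = ldiff u" if "u \<in> formal_sums A M"
    unfolding free_diff_def free_jet_cls_def
    by (rule F.tensor_lift_cls[OF TM.M.abelian_group_axioms b]) (use that in simp)
qed

lemma lval_closed: "u \<in> formal_sums A M \<Longrightarrow> lval u \<in> carrier M"
  by (rule M.M.lsum_closed) (auto dest: jet_formal_sums_mem intro: M.smult_closed[simplified])

lemma ldiff_closed: "u \<in> formal_sums A M \<Longrightarrow> ldiff u \<in> carrier (T (Suc 0))"
  by (rule TM.M.lsum_closed) (auto dest: jet_formal_sums_mem intro!: pt_simps d_degree)

lemma lval_append:
  "\<lbrakk>u \<in> formal_sums A M; v \<in> formal_sums A M\<rbrakk> \<Longrightarrow> lval (u @ v) = lval u \<oplus>\<^bsub>M\<^esub> lval v"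
  by (rule M.M.lsum_append) (auto dest: jet_formal_sums_mem intro: M.smult_closed[simplified])

lemma ldiff_append:
  "\<lbrakk>u \<in> formal_sums A M; v \<in> formal_sums A M\<rbrakk> \<Longrightarrow> ldiff (u @ v) = ldiff u \<oplus>\<^bsub>T (Suc 0)\<^esub> ldiff v"
  by (rule TM.M.lsum_append) (auto dest: jet_formal_sums_mem intro!: pt_simps d_degree)

lemma lval_smult:
  assumes "a \<in> degree_part D 0" "u \<in> formal_sums A M"
  shows "lval (map (apfst (\<lambda>b. a \<otimes>\<^bsub>W\<^esub> b)) u) = a \<odot>\<^bsub>M\<^esub> lval u"
  using assms(2)
proof (induction u)
  case (Cons p u)
  then show ?case using assms(1) M.smult_assoc[simplified]
    by (cases p) (simp add: M.smult_r_distr M.smult_closed lval_closed)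
qed (simp add: assms M.smult_zero_right)

text \<open>This is \<open>d(ab) = da b + a db\<close>, summed over the list. The defect from
  linearity depends on \<open>lval\<close> only, so the common kernel of \<open>lval\<close> and
  \<open>ldiff\<close> is stable under \<open>A\<close>.\<close>

lemma ldiff_smult:
  assumes "a \<in> degree_part D 0" "u \<in> formal_sums A M"
  shows "ldiff (map (apfst (\<lambda>b. a \<otimes>\<^bsub>W\<^esub> b)) u) = a \<odot>\<^bsub>T (Suc 0)\<^esub> ldiff u \<oplus>\<^bsub>T (Suc 0)\<^esub> pt (Suc 0) (extd D a) (lval u)"
  using assms(2)
proof (induction u)
  case Nil
  then show ?case using assms by (simp add: TM.smult_zero_right pt_zero_right degree_simps)
next
  case (Cons p u)
  obtain b m where p: "p = (b, m)" by fastforce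
  have c: "b \<in> degree_part D 0" "m \<in> carrier M" "u \<in> formal_sums A M" using Cons p by auto
  have "pt (Suc 0) (extd D (a \<otimes>\<^bsub>W\<^esub> b)) m =
      a \<odot>\<^bsub>T (Suc 0)\<^esub> pt (Suc 0) (extd D b) m \<oplus>\<^bsub>T (Suc 0)\<^esub> pt (Suc 0) (extd D a) (b \<odot>\<^bsub>M\<^esub> m)"
    using assms c by (simp add: d_mult0 degree_simps pt_simps M.smult_closed[simplified] TM.M.a_comm)
  then show ?case using Cons c assms
    by (simp add: p pt_simps degree_simps lval_closed ldiff_closed M.smult_closed TM.smult_closed
        TM.smult_r_distr TM.M.a_ac)
qed

text \<open>The definition asks for some representing list with the two properties; both are
  invariants of the class, so the relations form a joint kernel.\<close>

lemma jet1_relations_eq: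
  "jet1_relations D M = {x \<in> carrier FJ. free_val x = \<zero>\<^bsub>M\<^esub> \<and> free_diff x = \<zero>\<^bsub>T (Suc 0)\<^esub>}"
proof -
  have "forms_cls D (Suc 0) M (map (apfst (extd D)) l) = ldiff l" if "l \<in> formal_sums A M" for l
    using forms_cls_lsum[of l A M "\<lambda>a _. extd D a" "Suc 0" "\<lambda>_ m. m"] that
    by (simp add: degree_simps apfst_def map_prod_def)
  then show ?thesis
    unfolding jet1_relations_def free_jet_simps(1) lsum_def[of M "smult M", symmetric] One_nat_def
    by (auto simp: free_val_simps free_diff_simps)
qed

lemma left_submodule_relations: "left_submodule A FJ (jet1_relations D M)"
proof (rule left_submoduleI)
  show "\<zero>\<^bsub>FJ\<^esub> \<in> jet1_relations D M"
    by (simp add: jet1_relations_eq free_jet_simps(2) free_val_simps free_diff_simps)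
      (simp add: free_jet_simps)
  show "x \<oplus>\<^bsub>FJ\<^esub> y \<in> jet1_relations D M" if "x \<in> jet1_relations D M" "y \<in> jet1_relations D M" for x y
    using that additive_mapD(2)[OF free_val_simps(1), of x y]
      additive_mapD(2)[OF free_diff_simps(1), of x y]
    by (simp add: jet1_relations_eq)
  show "a \<odot>\<^bsub>FJ\<^esub> x \<in> jet1_relations D M" if a: "a \<in> carrier A" and x: "x \<in> jet1_relations D M" for a x
  proof -
    obtain u where u: "u \<in> formal_sums A M" "x = free_jet_cls D M u"
      using x by (auto simp: jet1_relations_eq free_jet_simps)
    then have z: "lval u = \<zero>\<^bsub>M\<^esub>" "ldiff u = \<zero>\<^bsub>T (Suc 0)\<^esub>"
      using x by (simp_all add: jet1_relations_eq free_val_simps free_diff_simps)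
    have "map (apfst (\<lambda>b. a \<otimes>\<^bsub>W\<^esub> b)) u \<in> formal_sums A M"
      using a u by (force simp: formal_sums_def degree_simps)
    then show ?thesis using a u z FJ.smult_closed[of a x] x
      by (simp add: jet1_relations_eq smult_free_jet_cls free_val_simps free_diff_simps lval_smult
          ldiff_smult M.smult_zero_right TM.smult_zero_right pt_zero_right degree_simps)
  qed
qed (auto simp: jet1_relations_eq)

abbreviation "J1 \<equiv> jet1 D M"

lemma map_smult_formal_sums:
  "\<lbrakk>a \<in> degree_part D 0; u \<in> formal_sums A M\<rbrakk> \<Longrightarrow> map (apfst (\<lambda>b. a \<otimes>\<^bsub>W\<^esub> b)) u \<in> formal_sums A M"
  by (force simp: formal_sums_def degree_simps)

lemma left_module_jet1: "left_module A J1"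
  unfolding jet1_def by (rule FJ.left_module_quot[OF left_submodule_relations])

sublocale J1: left_module "alg D" "jet1 D M" by (rule left_module_jet1)

lemma jet1_simps:
  shows "carrier J1 = jet1_cls D M ` formal_sums A M"
    and "\<zero>\<^bsub>J1\<^esub> = jet1_cls D M []"
    and "\<lbrakk>u \<in> formal_sums A M; v \<in> formal_sums A M\<rbrakk> \<Longrightarrow>
      jet1_cls D M u \<oplus>\<^bsub>J1\<^esub> jet1_cls D M v = jet1_cls D M (u @ v)"
    and "\<lbrakk>a \<in> degree_part D 0; u \<in> formal_sums A M\<rbrakk> \<Longrightarrow>
      a \<odot>\<^bsub>J1\<^esub> jet1_cls D M u = jet1_cls D M (map (apfst (\<lambda>b. a \<otimes>\<^bsub>W\<^esub> b)) u)"
  using FJ.quot_module_simps[OF left_submodule_relations]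
  by (auto simp: jet1_def jet1_cls_def free_jet_simps smult_free_jet_cls)

lemma jet1_cls_eq_iff:
  assumes "u \<in> formal_sums A M" "v \<in> formal_sums A M"
  shows "jet1_cls D M u = jet1_cls D M v \<longleftrightarrow> lval u = lval v \<and> ldiff u = ldiff v"
proof -
  let ?u = "free_jet_cls D M u" and ?v = "free_jet_cls D M v"
  have c: "?u \<in> carrier FJ" "?v \<in> carrier FJ" using assms by (simp_all add: free_jet_simps)
  have "jet1_cls D M u = jet1_cls D M v \<longleftrightarrow> ?u \<ominus>\<^bsub>FJ\<^esub> ?v \<in> jet1_relations D M"
    unfolding jet1_cls_def by (rule FJ.coset_eq_iff[OF left_submodule_relations c])
  also have "\<dots> \<longleftrightarrow> lval u \<ominus>\<^bsub>M\<^esub> lval v = \<zero>\<^bsub>M\<^esub> \<and> ldiff u \<ominus>\<^bsub>T (Suc 0)\<^esub> ldiff v = \<zero>\<^bsub>T (Suc 0)\<^esub>"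
    using additive_map_minus[OF FJ.M.abelian_group_axioms M.M.abelian_group_axioms free_val_simps(1) c]
      additive_map_minus[OF FJ.M.abelian_group_axioms TM.M.abelian_group_axioms free_diff_simps(1) c]
      c assms
    by (simp add: jet1_relations_eq free_val_simps free_diff_simps)
  finally show ?thesis
    using assms by (simp add: lval_closed ldiff_closed M.M.minus_eq_zero_iff TM.M.minus_eq_zero_iff)
qed

lemma jet1_rep:
  assumes "X \<in> carrier J1"
  shows "jet1_rep D M X \<in> formal_sums A M" "jet1_cls D M (jet1_rep D M X) = X"
proof -
  have "\<exists>l. l \<in> formal_sums A M \<and> jet1_cls D M l = X" using assms by (auto simp: jet1_simps)
  from someI_ex[OF this] show "jet1_rep D M X \<in> formal_sums A M"
    "jet1_cls D M (jet1_rep D M X) = X"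
    by (auto simp: jet1_rep_def)
qed

lemma jet1_cls_closed: "u \<in> formal_sums A M \<Longrightarrow> jet1_cls D M u \<in> carrier J1"
  by (simp add: jet1_simps)

lemma jet_val_cls: "u \<in> formal_sums A M \<Longrightarrow> jet_val D M (jet1_cls D M u) = lval u"
  and jet_diff_cls: "u \<in> formal_sums A M \<Longrightarrow> jet_diff D M (jet1_cls D M u) = ldiff u"
  using jet1_rep[of "jet1_cls D M u"] jet1_cls_eq_iff[of "jet1_rep D M (jet1_cls D M u)" u]
  by (simp_all add: jet_val_def jet_diff_def jet1_cls_closed)

lemma jet1_eq_iff:
  assumes "X \<in> carrier J1" "Y \<in> carrier J1"
  shows "X = Y \<longleftrightarrow> jet_val D M X = jet_val D M Y \<and> jet_diff D M X = jet_diff D M Y"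
  using jet1_rep[OF assms(1)] jet1_rep[OF assms(2)]
    jet1_cls_eq_iff[of "jet1_rep D M X" "jet1_rep D M Y"]
  by (auto simp: jet_val_def jet_diff_def)

lemma lin_map_jet_val: "lin_map A J1 M (jet_val D M)"
  unfolding lin_map_def jet1_simps(1)
  by (simp add: Pi_iff jet_val_cls lval_closed jet1_simps lval_append lval_smult map_smult_formal_sums)

lemma additive_map_jet_diff: "additive_map J1 (T (Suc 0)) (jet_diff D M)"
  unfolding additive_map_def jet1_simps(1)
  by (simp add: Pi_iff jet_diff_cls ldiff_closed jet1_simps ldiff_append)

lemmas jet_val_closed = lin_mapD(1)[OF lin_map_jet_val]
lemmas jet_diff_closed = additive_mapD(1)[OF additive_map_jet_diff]

lemma jet_diff_smult:
  assumes "a \<in> degree_part D 0" "X \<in> carrier J1"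
  shows "jet_diff D M (a \<odot>\<^bsub>J1\<^esub> X) =
    a \<odot>\<^bsub>T (Suc 0)\<^esub> jet_diff D M X \<oplus>\<^bsub>T (Suc 0)\<^esub> pt (Suc 0) (extd D a) (jet_val D M X)"
  using assms by (auto simp: jet1_simps jet_diff_cls jet_val_cls map_smult_formal_sums ldiff_smult)

lemma prolong1_closed: "e \<in> carrier M \<Longrightarrow> prolong1 D M e \<in> carrier J1"
  by (simp add: prolong1_def jet1_cls_closed degree_simps)

lemma jet_val_prolong1: "e \<in> carrier M \<Longrightarrow> jet_val D M (prolong1 D M e) = e"
  using M.smult_one by (simp add: prolong1_def jet_val_cls degree_simps)

lemma jet_diff_prolong1: "e \<in> carrier M \<Longrightarrow> jet_diff D M (prolong1 D M e) = \<zero>\<^bsub>T (Suc 0)\<^esub>"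
  by (simp add: prolong1_def jet_diff_cls degree_simps d_one pt_zero)

end

subsection \<open>Functoriality\<close>

locale dga_module_hom = M: dga_module D M + N: dga_module D N
  for D :: "('k, 'w) dga" and M :: "('w, 'm) module" and N :: "('w, 'n) module" +
  fixes f :: "'m \<Rightarrow> 'n"
  assumes linear: "lin_map (alg D) M N f"
begin

lemma hom_closed: "m \<in> carrier M \<Longrightarrow> f m \<in> carrier N"
  and hom_add: "\<lbrakk>m \<in> carrier M; m' \<in> carrier M\<rbrakk> \<Longrightarrow> f (m \<oplus>\<^bsub>M\<^esub> m') = f m \<oplus>\<^bsub>N\<^esub> f m'"
  and hom_smult: "\<lbrakk>a \<in> degree_part D 0; m \<in> carrier M\<rbrakk> \<Longrightarrow> f (a \<odot>\<^bsub>M\<^esub> m) = a \<odot>\<^bsub>N\<^esub> f m"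
  using lin_mapD[OF linear] by simp_all

abbreviation "Tf k \<equiv> forms_map D k M N f"

lemma forms_map_simps:
  shows "additive_map (M.T k) (N.T k) (Tf k)"
    and "\<lbrakk>w \<in> degree_part D k; m \<in> carrier M\<rbrakk> \<Longrightarrow> Tf k (M.pt k w m) = N.pt k w (f m)"
proof -
  have b: "balanced_map (alg D) (right_forms D k) M (N.T k) (\<lambda>w m. N.pt k w (f m))"
    by (rule balanced_mapI) (simp_all add: hom_closed hom_add hom_smult N.pt_simps)
  show "additive_map (M.T k) (N.T k) (Tf k)"
    unfolding forms_map_def by (rule M.forms_lift(1)[OF N.TM.M.abelian_group_axioms b])
  show "\<lbrakk>w \<in> degree_part D k; m \<in> carrier M\<rbrakk> \<Longrightarrow> Tf k (M.pt k w m) = N.pt k w (f m)"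
    unfolding forms_map_def by (rule M.forms_lift(2)[OF N.TM.M.abelian_group_axioms b])
qed

lemma forms_map_smult:
  assumes "a \<in> degree_part D 0" "t \<in> carrier (M.T k)"
  shows "Tf k (a \<odot>\<^bsub>M.T k\<^esub> t) = a \<odot>\<^bsub>N.T k\<^esub> Tf k t"
  by (rule M.forms_additive_eqI[OF N.TM.M.abelian_group_axioms[of k] _ _ _ assms(2)])
    (use assms in \<open>simp_all add: forms_map_simps M.additive_map_pre_smult N.additive_map_smult
      M.pt_simps N.pt_simps M.degree_simps hom_closed\<close>)

lemma forms_map_wedge:
  assumes w: "w \<in> degree_part D (Suc 0)" and t: "t \<in> carrier (M.T (Suc 0))"
  shows "Tf 2 (M.wedge w t) = N.wedge w (Tf (Suc 0) t)"
proof (rule M.forms_additive_eqI[OF N.TM.M.abelian_group_axioms[of 2] _ _ _ t])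
  show "additive_map (M.T (Suc 0)) (N.T 2) (\<lambda>t. Tf 2 (M.wedge w t))"
    using forms_map_simps(1)[of 2] M.wedge_additive[OF w] by (auto simp: additive_map_def Pi_iff)
  show "additive_map (M.T (Suc 0)) (N.T 2) (\<lambda>t. N.wedge w (Tf (Suc 0) t))"
    using forms_map_simps(1)[of "Suc 0"] N.wedge_additive[OF w] by (auto simp: additive_map_def Pi_iff)
qed (use w in \<open>simp_all add: forms_map_simps M.wedge_pt N.wedge_pt M.degree_simps hom_closed\<close>)

lemma map_hom_formal_sums: "u \<in> formal_sums (alg D) M \<Longrightarrow> map (apsnd f) u \<in> formal_sums (alg D) N"
  by (force simp: formal_sums_def hom_closed)

lemma lval_map:
  assumes "u \<in> formal_sums (alg D) M" shows "N.lval (map (apsnd f) u) = f (M.lval u)"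
proof -
  have "f (M.lval u) = lsum N (\<lambda>a m. f (a \<odot>\<^bsub>M\<^esub> m)) u"
    by (rule lsum_additive_map[OF M.M.M.abelian_group_axioms N.M.M.abelian_group_axioms
          lin_map_additive[OF linear]])
      (use assms in \<open>auto dest: M.jet_formal_sums_mem intro: M.M.smult_closed[simplified]\<close>)
  also have "\<dots> = N.lval (map (apsnd f) u)"
    unfolding lsum_map_apsnd
    by (rule lsum_cong) (use assms in \<open>auto dest: M.jet_formal_sums_mem simp: hom_smult\<close>)
  finally show ?thesis by simp
qed

lemma ldiff_map:
  assumes "u \<in> formal_sums (alg D) M"
  shows "N.ldiff (map (apsnd f) u) = Tf (Suc 0) (M.ldiff u)"
proof -
  have "Tf (Suc 0) (M.ldiff u) = lsum (N.T (Suc 0)) (\<lambda>a m. Tf (Suc 0) (M.pt (Suc 0) (extd D a) m)) u"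
    by (rule lsum_additive_map[OF M.TM.M.abelian_group_axioms N.TM.M.abelian_group_axioms
          forms_map_simps(1)])
      (use assms in \<open>auto dest: M.jet_formal_sums_mem intro!: M.pt_simps M.d_degree\<close>)
  also have "\<dots> = N.ldiff (map (apsnd f) u)"
    unfolding lsum_map_apsnd
    by (rule lsum_cong)
      (use assms in \<open>auto dest: M.jet_formal_sums_mem intro!: forms_map_simps M.d_degree\<close>)
  finally show ?thesis by simp
qed

abbreviation "Jf \<equiv> jet1_map D M N f"

lemma jet1_map_closed: "X \<in> carrier M.J1 \<Longrightarrow> Jf X \<in> carrier N.J1"
  using M.jet1_rep by (simp add: jet1_map_def N.jet1_cls_closed map_hom_formal_sums)

lemma jet_val_map: "X \<in> carrier M.J1 \<Longrightarrow> jet_val D N (Jf X) = f (jet_val D M X)"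
  using M.jet1_rep
  by (simp add: jet1_map_def N.jet_val_cls map_hom_formal_sums lval_map jet_val_def[of D M])

lemma jet_diff_map: "X \<in> carrier M.J1 \<Longrightarrow> jet_diff D N (Jf X) = Tf (Suc 0) (jet_diff D M X)"
  using M.jet1_rep
  by (simp add: jet1_map_def N.jet_diff_cls map_hom_formal_sums ldiff_map jet_diff_def[of D M])

text \<open>\<open>jet1_map\<close> applies \<open>f\<close> to a chosen representative. For linear
  \<open>f\<close> the two components of the result are determined by those of the argument, hence
  every representative gives the same jet.\<close>

lemma jet1_map_cls:
  "u \<in> formal_sums (alg D) M \<Longrightarrow> Jf (jet1_cls D M u) = jet1_cls D N (map (apsnd f) u)"
  by (simp add: N.jet1_eq_iff jet1_map_closed jet_val_map jet_diff_map M.jet1_cls_closed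
      N.jet1_cls_closed map_hom_formal_sums M.jet_val_cls M.jet_diff_cls N.jet_val_cls
      N.jet_diff_cls lval_map ldiff_map)

lemma jet1_map_linear: "lin_map (alg D) M.J1 N.J1 Jf"
  unfolding lin_map_def M.jet1_simps(1)
proof (intro conjI ballI, goal_cases)
  case 1
  then show ?case using jet1_map_closed by (auto simp: M.jet1_simps)
next
  case (2 X Y)
  then show ?case
    by (auto simp: M.jet1_simps jet1_map_cls N.jet1_simps map_hom_formal_sums)
next
  case (3 a X)
  then obtain u where u: "u \<in> formal_sums (alg D) M" "X = jet1_cls D M u" by auto
  moreover have "map (apsnd f) (map (apfst (\<lambda>b. a \<otimes>\<^bsub>M.W\<^esub> b)) u) =
      map (apfst (\<lambda>b. a \<otimes>\<^bsub>M.W\<^esub> b)) (map (apsnd f) u)"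
    by simp
  ultimately show ?case using 3
    by (simp add: M.jet1_simps jet1_map_cls N.jet1_simps map_hom_formal_sums M.map_smult_formal_sums
        del: map_map)
qed

lemma jet1_map_prolong1: "e \<in> carrier M \<Longrightarrow> Jf (prolong1 D M e) = prolong1 D N (f e)"
  by (simp add: prolong1_def jet1_map_cls M.degree_simps)

end

lemma jet1_map_cong:
  assumes "dga_module D M" "\<And>m. m \<in> carrier M \<Longrightarrow> f m = g m" "X \<in> carrier (jet1 D M)"
  shows "jet1_map D M N f X = jet1_map D M N g X"
proof -
  interpret M: dga_module D M by fact
  have "map (apsnd f) (jet1_rep D M X) = map (apsnd g) (jet1_rep D M X)"
    using M.jet1_rep[OF assms(3)] assms(2) by (auto dest: M.jet_formal_sums_mem)
  then show ?thesis unfolding jet1_map_def by (rule arg_cong)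
qed

lemma jet1_map_comp:
  assumes "dga_module_hom D M N f" "dga_module_hom D N P g" "X \<in> carrier (jet1 D M)"
  shows "jet1_map D N P g (jet1_map D M N f X) = jet1_map D M P (\<lambda>m. g (f m)) X"
proof -
  interpret f: dga_module_hom D M N f by fact
  interpret g: dga_module_hom D N P g by fact
  have "map (apsnd g) (map (apsnd f) (jet1_rep D M X)) = map (apsnd (\<lambda>m. g (f m))) (jet1_rep D M X)"
    by (simp add: apsnd_compose comp_def)
  then show ?thesis
    using f.M.jet1_rep[OF assms(3)]
    by (simp add: jet1_map_def[of D M] g.jet1_map_cls f.map_hom_formal_sums del: map_map)
qed

subsection \<open>The holonomy maps\<close>

context dga_module
begin

interpretation J: dga_module D "jet1 D M"
  by (intro dga_module.intro exterior_algebra_axioms left_module_jet1)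

text \<open>The parameter \<open>\<theta>\<close> serves both holonomy maps: it is
  \<open>a dc\<close> for the first and \<open>da \<wedge> dc\<close> for the second.\<close>

lemma forms_cls_concat:
  assumes "u \<in> formal_sums A J1"
    "\<And>a c. \<lbrakk>a \<in> degree_part D 0; c \<in> degree_part D 0\<rbrakk> \<Longrightarrow> \<theta> a c \<in> degree_part D k"
  shows "forms_cls D k M (concat (map (\<lambda>(a, x). map (apfst (\<theta> a)) (jet1_rep D M x)) u)) =
    lsum (T k) (\<lambda>a x. lsum (T k) (\<lambda>c m. pt k (\<theta> a c) m) (jet1_rep D M x)) u"
  using assms(1)
proof (induction u)
  case Nil then show ?case by (simp add: forms_with_coeffs_def forms_cls_def T.tensor_simps)
next
  case (Cons p u)
  obtain a x where p: "p = (a, x)" by fastforce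
  have c: "a \<in> degree_part D 0" "x \<in> carrier J1" "u \<in> formal_sums A J1" using Cons p by auto
  let ?l = "map (apfst (\<theta> a)) (jet1_rep D M x)"
    and ?r = "concat (map (\<lambda>(a, x). map (apfst (\<theta> a)) (jet1_rep D M x)) u)"
  have l: "?l \<in> formal_sums (right_forms D k) M"
    using jet1_rep(1)[OF c(2)] c assms(2) by (force simp: formal_sums_def)
  have r: "?r \<in> formal_sums (right_forms D k) M"
    using c(3)
  proof (induction u)
    case (Cons q u)
    then show ?case using jet1_rep(1)[of "snd q"] assms(2)
      by (cases q) (force simp: formal_sums_def)
  qed simp
  have "forms_cls D k M ?l = lsum (T k) (\<lambda>c m. pt k (\<theta> a c) m) (jet1_rep D M x)"
    using forms_cls_lsum[OF jet1_rep(1)[OF c(2)], of "\<lambda>b m. \<theta> a b" k "\<lambda>_ m. m"] c assms(2)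
    by (simp add: apfst_def map_prod_def)
  moreover have "forms_cls D k M (?l @ ?r) = forms_cls D k M ?l \<oplus>\<^bsub>T k\<^esub> forms_cls D k M ?r"
    using l r by (simp add: forms_with_coeffs_def forms_cls_def T.tensor_simps)
  ultimately show ?case using Cons c by (simp add: p)
qed

text \<open>The holonomy maps as functions of the outer formal sum. The inner jets enter only
  through \<open>jet_diff\<close>, so only the choice of the outer representative remains to be
  dealt with.\<close>

abbreviation "lhol1 \<equiv> lsum (T (Suc 0)) (\<lambda>a x. a \<odot>\<^bsub>T (Suc 0)\<^esub> jet_diff D M x)"
abbreviation "lhol2 \<equiv> lsum (T 2) (\<lambda>a x. wedge (extd D a) (jet_diff D M x))"

lemma holonomy_rep:
  assumes X: "X \<in> carrier (jet1 D J1)"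
  shows "holonomy1 D M X = lhol1 (jet1_rep D J1 X)"
    and "holonomy2 D M X = lhol2 (jet1_rep D J1 X)"
proof -
  note rep = J.jet1_rep(1)[OF X]
  have mem: "a \<in> degree_part D 0 \<and> x \<in> carrier J1" if "(a, x) \<in> set (jet1_rep D J1 X)" for a x
    using J.jet_formal_sums_mem[OF rep that] .
  have 1: "lsum (T (Suc 0)) (\<lambda>c m. pt (Suc 0) (a \<otimes>\<^bsub>W\<^esub> extd D c) m) (jet1_rep D M x) =
      a \<odot>\<^bsub>T (Suc 0)\<^esub> jet_diff D M x" if ax: "a \<in> degree_part D 0" "x \<in> carrier J1" for a x
  proof -
    have "additive_map (T (Suc 0)) (T (Suc 0)) (\<lambda>t. a \<odot>\<^bsub>T (Suc 0)\<^esub> t)"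
      using ax by (auto simp: additive_map_def TM.smult_closed TM.smult_r_distr)
    then have "a \<odot>\<^bsub>T (Suc 0)\<^esub> jet_diff D M x =
        lsum (T (Suc 0)) (\<lambda>c m. a \<odot>\<^bsub>T (Suc 0)\<^esub> pt (Suc 0) (extd D c) m) (jet1_rep D M x)"
      unfolding jet_diff_def
      by (rule lsum_additive_map[OF TM.M.abelian_group_axioms TM.M.abelian_group_axioms])
        (use jet_formal_sums_mem[OF jet1_rep(1)[OF ax(2)]] in \<open>auto intro!: pt_simps d_degree\<close>)
    also have "\<dots> = lsum (T (Suc 0)) (\<lambda>c m. pt (Suc 0) (a \<otimes>\<^bsub>W\<^esub> extd D c) m) (jet1_rep D M x)"
      by (rule lsum_cong)
        (use ax jet_formal_sums_mem[OF jet1_rep(1)[OF ax(2)]] in \<open>simp add: pt_simps d_degree\<close>)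
    finally show ?thesis by simp
  qed
  have 2: "lsum (T 2) (\<lambda>c m. pt 2 (extd D a \<otimes>\<^bsub>W\<^esub> extd D c) m) (jet1_rep D M x) =
      wedge (extd D a) (jet_diff D M x)" if ax: "a \<in> degree_part D 0" "x \<in> carrier J1" for a x
  proof -
    have da: "extd D a \<in> degree_part D (Suc 0)" using ax by (simp add: d_degree)
    have "wedge (extd D a) (jet_diff D M x) =
        lsum (T 2) (\<lambda>c m. wedge (extd D a) (pt (Suc 0) (extd D c) m)) (jet1_rep D M x)"
      unfolding jet_diff_def
      by (rule lsum_additive_map[OF TM.M.abelian_group_axioms TM.M.abelian_group_axioms
            wedge_additive[OF da]])
        (use jet_formal_sums_mem[OF jet1_rep(1)[OF ax(2)]] in \<open>auto intro!: pt_simps d_degree\<close>)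
    also have "\<dots> = lsum (T 2) (\<lambda>c m. pt 2 (extd D a \<otimes>\<^bsub>W\<^esub> extd D c) m) (jet1_rep D M x)"
      by (rule lsum_cong)
        (use da jet_formal_sums_mem[OF jet1_rep(1)[OF ax(2)]] in \<open>simp add: wedge_pt d_degree\<close>)
    finally show ?thesis by simp
  qed
  have "holonomy1 D M X = lsum (T (Suc 0))
      (\<lambda>a x. lsum (T (Suc 0)) (\<lambda>c m. pt (Suc 0) (a \<otimes>\<^bsub>W\<^esub> extd D c) m) (jet1_rep D M x)) (jet1_rep D J1 X)"
    unfolding holonomy1_def One_nat_def
    by (rule forms_cls_concat[OF rep, of "\<lambda>a c. a \<otimes>\<^bsub>W\<^esub> extd D c"]) (simp add: degree_simps)
  also have "\<dots> = lhol1 (jet1_rep D J1 X)"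
    by (rule lsum_cong) (use mem 1 in auto)
  finally show "holonomy1 D M X = lhol1 (jet1_rep D J1 X)" .
  have "holonomy2 D M X = lsum (T 2)
      (\<lambda>a x. lsum (T 2) (\<lambda>c m. pt 2 (extd D a \<otimes>\<^bsub>W\<^esub> extd D c) m) (jet1_rep D M x)) (jet1_rep D J1 X)"
    unfolding holonomy2_def
    by (rule forms_cls_concat[OF rep, of "\<lambda>a c. extd D a \<otimes>\<^bsub>W\<^esub> extd D c"]) (simp add: degree_simps)
  also have "\<dots> = lhol2 (jet1_rep D J1 X)"
    by (rule lsum_cong) (use mem 2 in auto)
  finally show "holonomy2 D M X = lhol2 (jet1_rep D J1 X)" .
qed

lemma lhol_closed:
  assumes "u \<in> formal_sums A J1"
  shows "lhol1 u \<in> carrier (T (Suc 0))" "lhol2 u \<in> carrier (T 2)"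
proof -
  have mem: "a \<in> degree_part D 0 \<and> x \<in> carrier J1" if "(a, x) \<in> set u" for a x
    using J.jet_formal_sums_mem[OF assms that] .
  show "lhol1 u \<in> carrier (T (Suc 0))"
    by (rule TM.M.lsum_closed) (use mem in \<open>auto simp: TM.smult_closed jet_diff_closed\<close>)
  show "lhol2 u \<in> carrier (T 2)"
    by (rule TM.M.lsum_closed) (use mem in \<open>auto intro!: wedge_closed d_degree jet_diff_closed\<close>)
qed

interpretation val_hom: dga_module_hom D "jet1 D M" M "jet_val D M"
  by (intro dga_module_hom.intro J.dga_module_axioms dga_module_axioms dga_module_hom_axioms.intro
      lin_map_jet_val)

text \<open>The Leibniz rule \<open>jet_diff_smult\<close>, summed over the list. It shows
  \<open>lhol1\<close> as the difference between the second components of the two projections from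
  \<open>J1 J1\<close> to \<open>J1\<close>, the evaluation and the prolongation of
  \<open>jet_val\<close>; both depend only on the class of \<open>u\<close>.\<close>

lemma jet_diff_lval:
  assumes "u \<in> formal_sums A J1"
  shows "jet_diff D M (J.lval u) = val_hom.Tf (Suc 0) (J.ldiff u) \<oplus>\<^bsub>T (Suc 0)\<^esub> lhol1 u"
proof -
  have mem: "a \<in> degree_part D 0 \<and> x \<in> carrier J1" if "(a, x) \<in> set u" for a x
    using J.jet_formal_sums_mem[OF assms that] .
  have "jet_diff D M (J.lval u) = lsum (T (Suc 0)) (\<lambda>a x. jet_diff D M (a \<odot>\<^bsub>J1\<^esub> x)) u"
    by (rule lsum_additive_map[OF J1.M.abelian_group_axioms TM.M.abelian_group_axioms
          additive_map_jet_diff]) (use mem in \<open>auto intro: J1.smult_closed[simplified]\<close>)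
  also have "\<dots> = lsum (T (Suc 0)) (\<lambda>a x. val_hom.Tf (Suc 0) (J.pt (Suc 0) (extd D a) x)
      \<oplus>\<^bsub>T (Suc 0)\<^esub> a \<odot>\<^bsub>T (Suc 0)\<^esub> jet_diff D M x) u"
    by (rule lsum_cong) (use mem in \<open>auto simp: jet_diff_smult val_hom.forms_map_simps d_degree
        pt_simps TM.smult_closed jet_diff_closed jet_val_closed intro!: TM.M.a_comm\<close>)
  also have "\<dots> = lsum (T (Suc 0)) (\<lambda>a x. val_hom.Tf (Suc 0) (J.pt (Suc 0) (extd D a) x)) u
      \<oplus>\<^bsub>T (Suc 0)\<^esub> lhol1 u"
    by (rule TM.M.lsum_add) (use mem in \<open>auto simp: val_hom.forms_map_simps d_degree
        pt_simps TM.smult_closed jet_diff_closed jet_val_closed\<close>)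
  also have "lsum (T (Suc 0)) (\<lambda>a x. val_hom.Tf (Suc 0) (J.pt (Suc 0) (extd D a) x)) u
      = val_hom.Tf (Suc 0) (J.ldiff u)"
    by (rule lsum_additive_map[OF J.TM.M.abelian_group_axioms TM.M.abelian_group_axioms
          val_hom.forms_map_simps(1), symmetric]) (use mem in \<open>auto intro!: J.pt_simps d_degree\<close>)
  finally show ?thesis .
qed

lemma d_degree_one: "w \<in> degree_part D (Suc 0) \<Longrightarrow> extd D w \<in> degree_part D 2"
  using d_degree[of w "Suc 0"] by (simp add: numeral_2_eq_2)

text \<open>The map \<open>w \<otimes> [c \<otimes> e] \<mapsto> w \<and> dc \<otimes> e\<close> is not balanced; the correction by \<open>dw \<otimes> ce\<close>
  makes it so and vanishes on \<open>w = da\<close>. This is why \<^const>\<open>holonomy2\<close> is well defined.\<close>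

definition wedge_jet :: "'w \<Rightarrow> ('w \<times> 'm) list set set \<Rightarrow> ('w \<times> 'm) list set"
  where "wedge_jet w x = wedge w (jet_diff D M x) \<ominus>\<^bsub>T 2\<^esub> pt 2 (extd D w) (jet_val D M x)"

lemma wedge_jet_balanced: "balanced_map A (right_forms D (Suc 0)) J1 (T 2) wedge_jet"
proof (rule balanced_mapI, goal_cases)
  case (1 w x)
  then show ?case
    by (simp add: wedge_jet_def wedge_closed jet_diff_closed pt_simps d_degree_one jet_val_closed)
next
  case (2 w w' x)
  then show ?case
    by (simp add: wedge_jet_def wedge_closed wedge_add_left jet_diff_closed pt_simps d_degree_one
        jet_val_closed d_add degree_carrier a_minus_def TM.M.minus_add TM.M.a_ac)
next
  case (3 w x y)
  then show ?case
    by (simp add: wedge_jet_def wedge_closed wedge_add_right jet_diff_closed pt_simps d_degree_one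
        jet_val_closed additive_mapD(2)[OF additive_map_jet_diff] lin_mapD(2)[OF lin_map_jet_val]
        a_minus_def TM.M.minus_add TM.M.a_ac)
next
  case (4 a w x)
  have neg: "pt 2 (\<ominus>\<^bsub>W\<^esub> \<eta>) m = \<ominus>\<^bsub>T 2\<^esub> pt 2 \<eta> m" if "\<eta> \<in> degree_part D 2" "m \<in> carrier M" for \<eta> m
    using pt_add_left[of "\<ominus>\<^bsub>W\<^esub> \<eta>" 2 m \<eta>] that
    by (intro TM.M.minus_equality[symmetric])
      (simp_all add: pt_closed degree_simps W.l_neg pt_zero)
  let ?v = "jet_val D M x" and ?t = "jet_diff D M x"
  have c: "?v \<in> carrier M" "?t \<in> carrier (T (Suc 0))" using 4 by (simp_all add: jet_val_closed jet_diff_closed)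
  have av: "a \<odot>\<^bsub>M\<^esub> ?v \<in> carrier M" using 4 c by (simp add: M.smult_closed)
  \<comment> \<open>Here \<open>d(w a) = dw a - w \<wedge> da\<close>. The last term reappears on
    the other side, where \<open>jet_diff_smult\<close> contributes \<open>da\<close> tensored with
    the value of \<open>x\<close>.\<close>
  have "wedge_jet (w \<otimes>\<^bsub>W\<^esub> a) x = wedge w (a \<odot>\<^bsub>T (Suc 0)\<^esub> ?t) \<ominus>\<^bsub>T 2\<^esub>
      pt 2 (extd D w \<otimes>\<^bsub>W\<^esub> a \<oplus>\<^bsub>W\<^esub> (\<ominus>\<^bsub>W\<^esub> (w \<otimes>\<^bsub>W\<^esub> extd D a))) ?v"
    using 4 c by (simp add: wedge_jet_def wedge_balanced d_mult1 degree_carrier a_minus_def)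
  also have "pt 2 (extd D w \<otimes>\<^bsub>W\<^esub> a \<oplus>\<^bsub>W\<^esub> (\<ominus>\<^bsub>W\<^esub> (w \<otimes>\<^bsub>W\<^esub> extd D a))) ?v =
      pt 2 (extd D w) (a \<odot>\<^bsub>M\<^esub> ?v) \<oplus>\<^bsub>T 2\<^esub> (\<ominus>\<^bsub>T 2\<^esub> pt 2 (w \<otimes>\<^bsub>W\<^esub> extd D a) ?v)"
    using 4 c by (simp add: pt_simps neg degree_simps d_degree_one)
  finally have l: "wedge_jet (w \<otimes>\<^bsub>W\<^esub> a) x = wedge w (a \<odot>\<^bsub>T (Suc 0)\<^esub> ?t) \<ominus>\<^bsub>T 2\<^esub>
      (pt 2 (extd D w) (a \<odot>\<^bsub>M\<^esub> ?v) \<oplus>\<^bsub>T 2\<^esub> (\<ominus>\<^bsub>T 2\<^esub> pt 2 (w \<otimes>\<^bsub>W\<^esub> extd D a) ?v))" .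
  have "wedge_jet w (a \<odot>\<^bsub>J1\<^esub> x) = (wedge w (a \<odot>\<^bsub>T (Suc 0)\<^esub> ?t) \<oplus>\<^bsub>T 2\<^esub> pt 2 (w \<otimes>\<^bsub>W\<^esub> extd D a) ?v)
      \<ominus>\<^bsub>T 2\<^esub> pt 2 (extd D w) (a \<odot>\<^bsub>M\<^esub> ?v)"
    using 4 c lin_mapD(3)[OF lin_map_jet_val, of x a]
    by (simp add: wedge_jet_def jet_diff_smult wedge_add_right wedge_pt TM.smult_closed pt_closed
        d_degree)
  then show ?case using l 4 c av
    by (simp add: a_minus_def TM.M.minus_add wedge_closed TM.smult_closed pt_closed degree_simps
        d_degree_one TM.M.a_ac)
qed

lemma lhol2_eq:
  assumes "u \<in> formal_sums A J1"
  shows "lhol2 u = tensor_lift (T 2) wedge_jet (J.ldiff u)"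
proof -
  have mem: "a \<in> degree_part D 0 \<and> x \<in> carrier J1" if "(a, x) \<in> set u" for a x
    using J.jet_formal_sums_mem[OF assms that] .
  note lift = J.forms_lift[OF TM.M.abelian_group_axioms[of 2] wedge_jet_balanced]
  have "tensor_lift (T 2) wedge_jet (J.ldiff u) =
      lsum (T 2) (\<lambda>a x. tensor_lift (T 2) wedge_jet (J.pt (Suc 0) (extd D a) x)) u"
    by (rule lsum_additive_map[OF J.TM.M.abelian_group_axioms TM.M.abelian_group_axioms lift(1)])
      (use mem in \<open>auto intro!: J.pt_simps d_degree\<close>)
  also have "\<dots> = lhol2 u"
    by (rule lsum_cong, drule mem, elim conjE)
      (simp add: lift(2) d_degree wedge_jet_def d_d degree_carrier pt_zero wedge_closed
        jet_val_closed jet_diff_closed a_minus_def)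
  finally show ?thesis by simp
qed

text \<open>The chosen representative and \<open>u\<close> have the same \<open>lval\<close> and
  \<open>ldiff\<close>. Now \<open>lhol2\<close> is a function of \<open>ldiff\<close> by
  \<open>lhol2_eq\<close>, and \<open>lhol1\<close> is recovered by cancelling the common term in
  \<open>jet_diff_lval\<close>.\<close>

lemma holonomy_cls:
  assumes "u \<in> formal_sums A J1"
  shows "holonomy1 D M (jet1_cls D J1 u) = lhol1 u"
    and "holonomy2 D M (jet1_cls D J1 u) = lhol2 u"
proof -
  let ?X = "jet1_cls D J1 u"
  have X: "?X \<in> carrier (jet1 D J1)" using assms by (rule J.jet1_cls_closed)
  let ?r = "jet1_rep D J1 ?X"
  have r: "?r \<in> formal_sums A J1" "J.lval ?r = J.lval u" "J.ldiff ?r = J.ldiff u"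
    using J.jet1_rep[OF X] J.jet1_cls_eq_iff[of ?r u] assms by simp_all
  show "holonomy2 D M ?X = lhol2 u"
    using holonomy_rep[OF X] lhol2_eq[OF r(1)] lhol2_eq[OF assms] r by simp
  let ?t = "val_hom.Tf (Suc 0) (J.ldiff u)"
  have t: "?t \<in> carrier (T (Suc 0))"
    by (rule additive_mapD(1)[OF val_hom.forms_map_simps(1) J.ldiff_closed[OF assms]])
  have "?t \<oplus>\<^bsub>T (Suc 0)\<^esub> lhol1 ?r = ?t \<oplus>\<^bsub>T (Suc 0)\<^esub> lhol1 u"
    using jet_diff_lval[OF r(1)] jet_diff_lval[OF assms] r by simp
  then have "lhol1 ?r = lhol1 u"
    using lhol_closed(1)[OF r(1)] lhol_closed(1)[OF assms] t
    by (simp add: TM.M.a_comm[of ?t] TM.M.add.right_cancel)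
  then show "holonomy1 D M ?X = lhol1 u" using holonomy_rep[OF X] by simp
qed

end

section \<open>The holonomy maps under module operations, prolongation and linear maps\<close>

context dga_module
begin

interpretation J: dga_module D "jet1 D M"
  by (intro dga_module.intro exterior_algebra_axioms left_module_jet1)

abbreviation "JJ \<equiv> jet1 D (jet1 D M)"

lemma jet1_jet1_cases:
  assumes "X \<in> carrier JJ"
  obtains u where "u \<in> formal_sums A J1" "X = jet1_cls D J1 u"
  using assms by (auto simp: J.jet1_simps)

lemma lhol_append:
  assumes "u \<in> formal_sums A J1" "v \<in> formal_sums A J1"
  shows "lhol1 (u @ v) = lhol1 u \<oplus>\<^bsub>T (Suc 0)\<^esub> lhol1 v" "lhol2 (u @ v) = lhol2 u \<oplus>\<^bsub>T 2\<^esub> lhol2 v"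
proof -
  have mem: "a \<in> degree_part D 0 \<and> x \<in> carrier J1" if "(a, x) \<in> set u \<union> set v" for a x
    using J.jet_formal_sums_mem[OF assms(1)] J.jet_formal_sums_mem[OF assms(2)] that by blast
  show "lhol1 (u @ v) = lhol1 u \<oplus>\<^bsub>T (Suc 0)\<^esub> lhol1 v"
    by (rule TM.M.lsum_append, drule mem) (simp add: TM.smult_closed jet_diff_closed)
  show "lhol2 (u @ v) = lhol2 u \<oplus>\<^bsub>T 2\<^esub> lhol2 v"
    by (rule TM.M.lsum_append, drule mem) (simp add: wedge_closed d_degree jet_diff_closed)
qed

lemma holonomy_add:
  assumes "X \<in> carrier JJ" "Y \<in> carrier JJ"
  shows "holonomy1 D M (X \<oplus>\<^bsub>JJ\<^esub> Y) = holonomy1 D M X \<oplus>\<^bsub>T (Suc 0)\<^esub> holonomy1 D M Y"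
    and "holonomy2 D M (X \<oplus>\<^bsub>JJ\<^esub> Y) = holonomy2 D M X \<oplus>\<^bsub>T 2\<^esub> holonomy2 D M Y"
proof -
  obtain u v where uv: "u \<in> formal_sums A J1" "X = jet1_cls D J1 u"
      "v \<in> formal_sums A J1" "Y = jet1_cls D J1 v"
    using assms by (auto elim!: jet1_jet1_cases)
  then show "holonomy1 D M (X \<oplus>\<^bsub>JJ\<^esub> Y) = holonomy1 D M X \<oplus>\<^bsub>T (Suc 0)\<^esub> holonomy1 D M Y"
    "holonomy2 D M (X \<oplus>\<^bsub>JJ\<^esub> Y) = holonomy2 D M X \<oplus>\<^bsub>T 2\<^esub> holonomy2 D M Y"
    by (simp_all add: J.jet1_simps holonomy_cls lhol_append)
qed

lemma holonomy_zero: "holonomy1 D M \<zero>\<^bsub>JJ\<^esub> = \<zero>\<^bsub>T (Suc 0)\<^esub>" "holonomy2 D M \<zero>\<^bsub>JJ\<^esub> = \<zero>\<^bsub>T 2\<^esub>"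
  by (simp_all add: J.jet1_simps(2) holonomy_cls)

text \<open>The first map is linear. The Leibniz rule spoils linearity of the second by a term that
  vanishes on the kernel of the first, so the two conditions together cut out a submodule.\<close>

lemma holonomy_smult:
  assumes b: "b \<in> degree_part D 0" and X: "X \<in> carrier JJ"
  shows "holonomy1 D M (b \<odot>\<^bsub>JJ\<^esub> X) = b \<odot>\<^bsub>T (Suc 0)\<^esub> holonomy1 D M X"
    and "holonomy2 D M (b \<odot>\<^bsub>JJ\<^esub> X) =
      b \<odot>\<^bsub>T 2\<^esub> holonomy2 D M X \<oplus>\<^bsub>T 2\<^esub> wedge (extd D b) (holonomy1 D M X)"
proof -
  obtain u where u: "u \<in> formal_sums A J1" "X = jet1_cls D J1 u"
    using X by (auto elim!: jet1_jet1_cases)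
  have mem: "a \<in> degree_part D 0 \<and> x \<in> carrier J1" if "(a, x) \<in> set u" for a x
    using J.jet_formal_sums_mem[OF u(1) that] .
  have sm: "additive_map (T k) (T k) (\<lambda>t. b \<odot>\<^bsub>T k\<^esub> t)" for k
    using b by (auto simp: additive_map_def TM.smult_closed TM.smult_r_distr)
  have db: "extd D b \<in> degree_part D (Suc 0)" using b by (rule d_degree)
  let ?bu = "map (apfst (\<lambda>c. b \<otimes>\<^bsub>W\<^esub> c)) u"
  have "lhol1 ?bu = lsum (T (Suc 0)) (\<lambda>a x. b \<odot>\<^bsub>T (Suc 0)\<^esub> (a \<odot>\<^bsub>T (Suc 0)\<^esub> jet_diff D M x)) u"
    unfolding lsum_map_apfst
    by (rule lsum_cong, drule mem)
      (use b TM.smult_assoc[simplified] in \<open>simp add: jet_diff_closed\<close>)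
  also have "\<dots> = b \<odot>\<^bsub>T (Suc 0)\<^esub> lhol1 u"
    by (rule lsum_additive_map[OF TM.M.abelian_group_axioms TM.M.abelian_group_axioms sm, symmetric],
        drule mem) (simp add: TM.smult_closed jet_diff_closed)
  finally show "holonomy1 D M (b \<odot>\<^bsub>JJ\<^esub> X) = b \<odot>\<^bsub>T (Suc 0)\<^esub> holonomy1 D M X"
    using b u by (simp add: J.jet1_simps holonomy_cls J.map_smult_formal_sums)
  have "lhol2 ?bu = lsum (T 2) (\<lambda>a x. b \<odot>\<^bsub>T 2\<^esub> wedge (extd D a) (jet_diff D M x) \<oplus>\<^bsub>T 2\<^esub>
      wedge (extd D b) (a \<odot>\<^bsub>T (Suc 0)\<^esub> jet_diff D M x)) u"
    unfolding lsum_map_apfst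
    by (rule lsum_cong, drule mem, elim conjE)
      (use b in \<open>simp add: jet_diff_closed d_mult0 degree_carrier wedge_add_left degree_mult0 d_degree
        wedge_smult_left wedge_balanced[symmetric] TM.smult_closed wedge_closed TM.M.a_comm\<close>)
  also have "\<dots> = lsum (T 2) (\<lambda>a x. b \<odot>\<^bsub>T 2\<^esub> wedge (extd D a) (jet_diff D M x)) u \<oplus>\<^bsub>T 2\<^esub>
      lsum (T 2) (\<lambda>a x. wedge (extd D b) (a \<odot>\<^bsub>T (Suc 0)\<^esub> jet_diff D M x)) u"
    by (rule TM.M.lsum_add, drule mem)
      (use b db in \<open>simp add: jet_diff_closed d_degree TM.smult_closed wedge_closed\<close>)
  also have "lsum (T 2) (\<lambda>a x. b \<odot>\<^bsub>T 2\<^esub> wedge (extd D a) (jet_diff D M x)) u = b \<odot>\<^bsub>T 2\<^esub> lhol2 u"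
    by (rule lsum_additive_map[OF TM.M.abelian_group_axioms TM.M.abelian_group_axioms sm, symmetric],
        drule mem) (simp add: wedge_closed d_degree jet_diff_closed)
  also have "lsum (T 2) (\<lambda>a x. wedge (extd D b) (a \<odot>\<^bsub>T (Suc 0)\<^esub> jet_diff D M x)) u =
      wedge (extd D b) (lhol1 u)"
    by (rule lsum_additive_map[OF TM.M.abelian_group_axioms TM.M.abelian_group_axioms
          wedge_additive[OF db], symmetric], drule mem) (simp add: TM.smult_closed jet_diff_closed)
  finally show "holonomy2 D M (b \<odot>\<^bsub>JJ\<^esub> X) =
      b \<odot>\<^bsub>T 2\<^esub> holonomy2 D M X \<oplus>\<^bsub>T 2\<^esub> wedge (extd D b) (holonomy1 D M X)"
    using b u by (simp add: J.jet1_simps holonomy_cls J.map_smult_formal_sums)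
qed

lemma holonomy_prolong1:
  assumes "e \<in> carrier M"
  shows "holonomy1 D M (prolong1 D J1 (prolong1 D M e)) = \<zero>\<^bsub>T (Suc 0)\<^esub>"
    and "holonomy2 D M (prolong1 D J1 (prolong1 D M e)) = \<zero>\<^bsub>T 2\<^esub>"
  using assms
  by (simp_all add: prolong1_def[of D J1] holonomy_cls prolong1_closed jet_diff_prolong1 degree_simps
      d_one wedge_zero TM.smult_zero_right)

end

text \<open>Naturality for arbitrary linear \<open>f\<close> is what keeps lifted maps inside the
  holonomic jets.\<close>

lemma (in dga_module_hom) holonomy_natural:
  assumes "X \<in> carrier (jet1 D (jet1 D M))"
  shows "holonomy1 D N (jet1_map D M.J1 N.J1 Jf X) = Tf (Suc 0) (holonomy1 D M X)"
    and "holonomy2 D N (jet1_map D M.J1 N.J1 Jf X) = Tf 2 (holonomy2 D M X)"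
proof -
  interpret JM: dga_module D "jet1 D M"
    by (intro dga_module.intro M.exterior_algebra_axioms M.left_module_jet1)
  interpret JN: dga_module D "jet1 D N"
    by (intro dga_module.intro M.exterior_algebra_axioms N.left_module_jet1)
  interpret JJ: dga_module_hom D "jet1 D M" "jet1 D N" Jf
    by (intro dga_module_hom.intro JM.dga_module_axioms JN.dga_module_axioms
        dga_module_hom_axioms.intro jet1_map_linear)
  obtain u where u: "u \<in> formal_sums M.A M.J1" "X = jet1_cls D M.J1 u"
    using assms by (rule M.jet1_jet1_cases)
  have mem: "a \<in> degree_part D 0 \<and> x \<in> carrier M.J1" if "(a, x) \<in> set u" for a x
    using JM.jet_formal_sums_mem[OF u(1) that] .
  have "N.lhol1 (map (apsnd Jf) u) = lsum (N.T (Suc 0))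
      (\<lambda>a x. Tf (Suc 0) (a \<odot>\<^bsub>M.T (Suc 0)\<^esub> jet_diff D M x)) u"
    unfolding lsum_map_apsnd
    by (rule lsum_cong, drule mem) (simp add: jet_diff_map forms_map_smult M.jet_diff_closed)
  also have "\<dots> = Tf (Suc 0) (M.lhol1 u)"
    by (rule lsum_additive_map[OF M.TM.M.abelian_group_axioms N.TM.M.abelian_group_axioms
          forms_map_simps(1), symmetric], drule mem) (simp add: M.TM.smult_closed M.jet_diff_closed)
  finally show "holonomy1 D N (jet1_map D M.J1 N.J1 Jf X) = Tf (Suc 0) (holonomy1 D M X)"
    using u by (simp add: JJ.jet1_map_cls N.holonomy_cls M.holonomy_cls JJ.map_hom_formal_sums)
  have "N.lhol2 (map (apsnd Jf) u) = lsum (N.T 2)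
      (\<lambda>a x. Tf 2 (M.wedge (extd D a) (jet_diff D M x))) u"
    unfolding lsum_map_apsnd
    by (rule lsum_cong, drule mem)
      (simp add: jet_diff_map forms_map_wedge M.jet_diff_closed M.d_degree)
  also have "\<dots> = Tf 2 (M.lhol2 u)"
    by (rule lsum_additive_map[OF M.TM.M.abelian_group_axioms N.TM.M.abelian_group_axioms
          forms_map_simps(1), symmetric], drule mem)
      (simp add: M.wedge_closed M.d_degree M.jet_diff_closed)
  finally show "holonomy2 D N (jet1_map D M.J1 N.J1 Jf X) = Tf 2 (holonomy2 D M X)"
    using u by (simp add: JJ.jet1_map_cls N.holonomy_cls M.holonomy_cls JJ.map_hom_formal_sums)
qed

section \<open>Higher jets\<close>

text \<open>The carrier condition in the recursion for \<open>jets\<close>, with the decoding map as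
  a parameter \<open>\<iota>\<close>. Linearity of \<open>\<iota>\<close> is all that the submodule
  property will use about the coding.\<close>

definition holonomic_jets ::
  "('k, 'w) dga \<Rightarrow> ('w, 'p) module \<Rightarrow> ('w, 'q) module \<Rightarrow> ('p \<Rightarrow> ('w \<times> 'q) list set set) \<Rightarrow>
    ('w \<times> 'p) list set set set"
  where "holonomic_jets D P Q \<iota> = {x \<in> carrier (jet1 D P).
    let y = jet1_map D P (jet1 D Q) \<iota> x in
      holonomy1 D Q y = \<zero>\<^bsub>forms_with_coeffs D 1 Q\<^esub> \<and> holonomy2 D Q y = \<zero>\<^bsub>forms_with_coeffs D 2 Q\<^esub>}"

lemma (in exterior_algebra) dga_module_hom_jet1:
  assumes "left_module A P" "left_module A Q" "lin_map A P (jet1 D Q) \<iota>"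
  shows "dga_module_hom D P (jet1 D Q) \<iota>"
proof -
  interpret Q: dga_module D Q by (intro dga_module.intro exterior_algebra_axioms assms)
  show ?thesis
    by (intro dga_module_hom.intro dga_module.intro exterior_algebra_axioms assms Q.left_module_jet1
        dga_module_hom_axioms.intro)
qed

lemma (in exterior_algebra) left_submodule_holonomic_jets:
  assumes "left_module A P" "left_module A Q" "lin_map A P (jet1 D Q) \<iota>"
  shows "left_submodule A (jet1 D P) (holonomic_jets D P Q \<iota>)"
proof -
  interpret Q: dga_module D Q by (intro dga_module.intro exterior_algebra_axioms assms)
  interpret I: dga_module_hom D P "jet1 D Q" \<iota> by (rule dga_module_hom_jet1[OF assms])
  note I.jet1_map_closed[simp]
  show ?thesis
  proof (rule left_submoduleI)
    have "I.Jf \<zero>\<^bsub>jet1 D P\<^esub> = \<zero>\<^bsub>jet1 D (jet1 D Q)\<^esub>"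
      by (rule additive_map_zero[OF I.M.J1.M.abelian_group_axioms I.N.J1.M.abelian_group_axioms
            lin_map_additive[OF I.jet1_map_linear]])
    then show "\<zero>\<^bsub>jet1 D P\<^esub> \<in> holonomic_jets D P Q \<iota>"
      by (simp add: holonomic_jets_def Q.holonomy_zero)
    show "x \<oplus>\<^bsub>jet1 D P\<^esub> y \<in> holonomic_jets D P Q \<iota>"
      if "x \<in> holonomic_jets D P Q \<iota>" "y \<in> holonomic_jets D P Q \<iota>" for x y
      using that
      by (simp add: holonomic_jets_def Let_def lin_mapD(2)[OF I.jet1_map_linear] Q.holonomy_add)
    show "a \<odot>\<^bsub>jet1 D P\<^esub> x \<in> holonomic_jets D P Q \<iota>"
      if a: "a \<in> carrier A" and x: "x \<in> holonomic_jets D P Q \<iota>" for a x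
    proof -
      have x': "x \<in> carrier (jet1 D P)" using x by (simp add: holonomic_jets_def)
      have "I.Jf (a \<odot>\<^bsub>jet1 D P\<^esub> x) = a \<odot>\<^bsub>jet1 D (jet1 D Q)\<^esub> I.Jf x"
        using lin_mapD(3)[OF I.jet1_map_linear x'] a by simp
      moreover have "Q.wedge (extd D a) \<zero>\<^bsub>Q.T (Suc 0)\<^esub> = \<zero>\<^bsub>Q.T 2\<^esub>"
        using additive_map_zero[OF Q.TM.M.abelian_group_axioms Q.TM.M.abelian_group_axioms
            Q.wedge_additive] a d_degree by simp
      ultimately show ?thesis using a x x' I.M.J1.smult_closed[of a x]
        by (simp add: holonomic_jets_def Let_def Q.holonomy_smult Q.TM.smult_zero_right)
    qed
  qed (auto simp: holonomic_jets_def)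
qed

context dga_module
begin

text \<open>The index is that of the source: \<open>jets D M (Suc n)\<close> consists of codes of
  \<open>jet_part n\<close>. First-order jets satisfy no condition, and \<open>jets_Suc\<close> can
  thus replace the last two clauses of the recursion by one.\<close>

definition jet_part :: "nat \<Rightarrow> ('w \<times> ('w, 'm) jet) list set set set"
  where "jet_part n = (case n of 0 \<Rightarrow> carrier (jet1 D (jets D M 0))
    | Suc m \<Rightarrow> holonomic_jets D (jets D M (Suc m)) (jets D M m) (jet_decode D (jets D M m)))"

lemma jets_Suc: "jets D M (Suc n) = transport_module (jet_code D (jets D M n))
    ((jet1 D (jets D M n))\<lparr>carrier := jet_part n\<rparr>)"
  by (cases n) (simp_all add: jet_part_def holonomic_jets_def Let_def)

end

lemma (in exterior_algebra) jet_code_inj: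
  assumes "left_module A P" shows "inj_on (jet_code D P) (carrier (jet1 D P))"
proof -
  interpret P: dga_module D P by (intro dga_module.intro exterior_algebra_axioms assms)
  show ?thesis by (rule inj_onI) (metis P.jet1_rep(2) jet_code_def jet.inject(2))
qed

text \<open>One step of the recursion for an arbitrary submodule \<open>S\<close>, in order to be
  usable inside the induction that proves \<open>jet_part n\<close> to be a submodule.\<close>

lemma (in exterior_algebra) jet_step:
  assumes P: "left_module A P" and S: "left_submodule A (jet1 D P) S"
    and N: "N = transport_module (jet_code D P) ((jet1 D P)\<lparr>carrier := S\<rparr>)"
  shows "left_module A N" and "carrier N = jet_code D P ` S"
    and "x \<in> carrier (jet1 D P) \<Longrightarrow> jet_decode D P (jet_code D P x) = x"
    and "y \<in> carrier N \<Longrightarrow> jet_decode D P y \<in> S"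
    and "lin_map A N (jet1 D P) (jet_decode D P)"
    and "lin_map A ((jet1 D P)\<lparr>carrier := S\<rparr>) N (jet_code D P)"
proof -
  interpret P: dga_module D P by (intro dga_module.intro exterior_algebra_axioms P)
  have SJ: "S \<subseteq> carrier (jet1 D P)" using S by (simp add: left_submodule_def)
  interpret S: left_module A "(jet1 D P)\<lparr>carrier := S\<rparr>"
    by (rule P.J1.left_module_submodule[OF S])
  have inj: "inj_on (jet_code D P) (carrier ((jet1 D P)\<lparr>carrier := S\<rparr>))"
    using inj_on_subset[OF jet_code_inj[OF P] SJ] by simp
  note simps = S.transport_module_simps[OF inj]
  show "left_module A N" unfolding N by (rule S.left_module_transport[OF inj])
  show carr: "carrier N = jet_code D P ` S" using simps(1) by (simp add: N)
  show dec: "jet_decode D P (jet_code D P x) = x" if "x \<in> carrier (jet1 D P)" for x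
    unfolding jet_decode_def by (rule inv_into_f_f[OF jet_code_inj[OF P] that])
  show dS: "jet_decode D P y \<in> S" if "y \<in> carrier N" for y
    using that SJ dec by (auto simp: carr)
  show code: "lin_map A ((jet1 D P)\<lparr>carrier := S\<rparr>) N (jet_code D P)"
    using simps by (simp add: N lin_map_def)
  show "lin_map A N (jet1 D P) (jet_decode D P)"
    unfolding lin_map_def
  proof (intro conjI ballI)
    show "jet_decode D P \<in> carrier N \<rightarrow> carrier (jet1 D P)" using dS SJ by auto
    fix x y assume "x \<in> carrier N" "y \<in> carrier N"
    then obtain x' y' where xy: "x = jet_code D P x'" "x' \<in> S" "y = jet_code D P y'" "y' \<in> S"
      by (auto simp: carr)
    then have "x \<oplus>\<^bsub>N\<^esub> y = jet_code D P (x' \<oplus>\<^bsub>jet1 D P\<^esub> y')" "x' \<oplus>\<^bsub>jet1 D P\<^esub> y' \<in> S"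
      using simps(2)[of x' y'] S by (auto simp: N left_submodule_def)
    then show "jet_decode D P (x \<oplus>\<^bsub>N\<^esub> y) = jet_decode D P x \<oplus>\<^bsub>jet1 D P\<^esub> jet_decode D P y"
      using xy subsetD[OF SJ] by (simp add: dec)
  next
    fix a x assume "a \<in> carrier A" "x \<in> carrier N"
    then obtain x' where x: "x = jet_code D P x'" "x' \<in> S" by (auto simp: carr)
    then have "a \<odot>\<^bsub>N\<^esub> x = jet_code D P (a \<odot>\<^bsub>jet1 D P\<^esub> x')" "a \<odot>\<^bsub>jet1 D P\<^esub> x' \<in> S"
      using simps(3)[of a x'] S \<open>a \<in> carrier A\<close> by (auto simp: N left_submodule_def)
    then show "jet_decode D P (a \<odot>\<^bsub>N\<^esub> x) = a \<odot>\<^bsub>jet1 D P\<^esub> jet_decode D P x"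
      using x subsetD[OF SJ] by (simp add: dec)
  qed
qed

context dga_module
begin

lemma jets_zero:
  shows "left_module A (jets D M 0)" and "carrier (jets D M 0) = Base ` carrier M"
    and "lin_map A M (jets D M 0) Base"
proof -
  have inj: "inj_on (Base :: 'm \<Rightarrow> ('w, 'm) jet) (carrier M)" by (simp add: inj_on_def)
  note simps = M.transport_module_simps[OF inj]
  show "left_module A (jets D M 0)" using M.left_module_transport[OF inj] by simp
  show "carrier (jets D M 0) = Base ` carrier M" using simps by simp
  show "lin_map A M (jets D M 0) Base" using simps by (auto simp: lin_map_def)
qed

text \<open>Both claims must be proved together: the module structure at level \<open>Suc n\<close>
  comes from the submodule at level \<open>n\<close>, and the submodule at level
  \<open>Suc n\<close> requires linearity of the decoding between these levels.\<close>

lemma jets_module: "left_module A (jets D M n) \<and> left_submodule A (jet1 D (jets D M n)) (jet_part n)"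
proof (induction n)
  case 0
  interpret P: dga_module D "jets D M 0"
    by (intro dga_module.intro exterior_algebra_axioms jets_zero)
  show ?case using jets_zero(1) P.J1.smult_closed
    by (simp add: jet_part_def left_submodule_def del: jets.simps)
next
  case (Suc n)
  note step = jet_step[OF conjunct1[OF Suc] conjunct2[OF Suc] jets_Suc]
  show ?case using step(1) left_submodule_holonomic_jets[OF step(1) conjunct1[OF Suc] step(5)]
    by (simp add: jet_part_def del: jets.simps)
qed

lemmas left_module_jets = conjunct1[OF jets_module]
lemmas left_submodule_jet_part = conjunct2[OF jets_module]
lemmas jet_steps = jet_step[OF left_module_jets left_submodule_jet_part jets_Suc]

lemma jet_part_subset: "jet_part n \<subseteq> carrier (jet1 D (jets D M n))"
  using left_submodule_jet_part by (simp add: left_submodule_def)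

lemma dga_module_jets: "dga_module D (jets D M n)"
  by (intro dga_module.intro exterior_algebra_axioms left_module_jets)

text \<open>The holonomy condition reaches two levels down, hence the strong induction. After
  decoding, the prolongation is a 1-jet of a 1-jet of one element, and
  \<open>holonomy_prolong1\<close> applies.\<close>

lemma prolong_closed: "e \<in> carrier M \<Longrightarrow> prolong D M n e \<in> carrier (jets D M n)"
proof (induction n rule: less_induct)
  case (less n)
  interpret P: dga_module D "jets D M k" for k by (rule dga_module_jets)
  show ?case
  proof (cases n)
    case 0 then show ?thesis using less.prems by (simp add: jets_zero del: jets.simps)
  next
    case (Suc m)
    have m: "prolong D M m e \<in> carrier (jets D M m)" using less Suc by simp
    have "prolong1 D (jets D M m) (prolong D M m e) \<in> jet_part m"
    proof (cases m)
      case 0 then show ?thesis using P.prolong1_closed[OF m] by (simp add: jet_part_def del: jets.simps)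
    next
      case (Suc k)
      have k: "prolong D M k e \<in> carrier (jets D M k)" using less \<open>n = Suc m\<close> Suc by simp
      interpret I: dga_module_hom D "jets D M (Suc k)" "jet1 D (jets D M k)" "jet_decode D (jets D M k)"
        by (rule dga_module_hom_jet1[OF left_module_jets left_module_jets jet_steps(5)])
      show ?thesis
        using P.prolong1_closed[OF m] m k P.holonomy_prolong1[OF k] unfolding Suc
        by (simp add: jet_part_def holonomic_jets_def Let_def I.jet1_map_prolong1 jet_steps(3)
            P.prolong1_closed del: jets.simps)
    qed
    then show ?thesis by (simp add: Suc jet_steps(2) del: jets.simps)
  qed
qed

lemma decode_prolong: "e \<in> carrier M \<Longrightarrow>
    jet_decode D (jets D M n) (prolong D M (Suc n) e) = prolong1 D (jets D M n) (prolong D M n e)"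
proof -
  assume e: "e \<in> carrier M"
  interpret P: dga_module D "jets D M n" by (rule dga_module_jets)
  show ?thesis using P.prolong1_closed[OF prolong_closed[OF e]] by (simp add: jet_steps(3))
qed

lemma jets_projection:
  shows "lin_map A (jets D M (Suc n)) (jets D M n) (\<lambda>x. jet_val D (jets D M n) (jet_decode D (jets D M n) x))"
    and "e \<in> carrier M \<Longrightarrow>
      jet_val D (jets D M n) (jet_decode D (jets D M n) (prolong D M (Suc n) e)) = prolong D M n e"
proof -
  interpret P: dga_module D "jets D M n" by (rule dga_module_jets)
  show "lin_map A (jets D M (Suc n)) (jets D M n) (\<lambda>x. jet_val D (jets D M n) (jet_decode D (jets D M n) x))"
    by (rule lin_map_comp[OF jet_steps(5) P.lin_map_jet_val])
  show "e \<in> carrier M \<Longrightarrow>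
      jet_val D (jets D M n) (jet_decode D (jets D M n) (prolong D M (Suc n) e)) = prolong D M n e"
    by (simp add: decode_prolong P.jet_val_prolong1 prolong_closed del: prolong.simps)
qed

end

section \<open>Lifting linear maps to higher jets\<close>

primrec jet_lift ::
  "('k, 'w) dga \<Rightarrow> ('w, 'e) module \<Rightarrow> ('w, 'f) module \<Rightarrow> nat \<Rightarrow> (('w, 'e) jet \<Rightarrow> ('w, 'f) jet) \<Rightarrow>
    nat \<Rightarrow> ('w, 'e) jet \<Rightarrow> ('w, 'f) jet" where
  "jet_lift D E F n g 0 = g"
| "jet_lift D E F n g (Suc k) = (\<lambda>x. jet_code D (jets D F k)
    (jet1_map D (jets D E (k + n)) (jets D F k) (jet_lift D E F n g k)
      (jet_decode D (jets D E (k + n)) x)))"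

text \<open>Linearity is inherited from \<open>J1\<close>; the point is that the prolonged lift
  sends holonomic jets to holonomic ones. That condition involves the two preceding lifts, hence the
  strong induction.\<close>

lemma jet_lift_linear:
  assumes E: "dga_module D E" and F: "dga_module D F"
    and g: "lin_map (alg D) (jets D E n) (jets D F 0) g"
  shows "lin_map (alg D) (jets D E (k + n)) (jets D F k) (jet_lift D E F n g k)"
proof (induction k rule: less_induct)
  case (less k)
  interpret E: dga_module D E by fact
  interpret F: dga_module D F by fact
  let ?g = "jet_lift D E F n g"
  show ?case
  proof (cases k)
    case 0 then show ?thesis using g by simp
  next
    case (Suc j)
    interpret G: dga_module_hom D "jets D E (j + n)" "jets D F j" "?g j"
      by (intro dga_module_hom.intro E.dga_module_jets F.dga_module_jets
          dga_module_hom_axioms.intro less.IH) (simp add: Suc)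
    let ?dE = "jet_decode D (jets D E (j + n))"
    have part: "G.Jf (?dE x) \<in> F.jet_part j" if x: "x \<in> carrier (jets D E (Suc (j + n)))" for x
    proof -
      have dx: "?dE x \<in> E.jet_part (j + n)" by (rule E.jet_steps(4)[OF x])
      then have dx': "?dE x \<in> carrier G.M.J1" using E.jet_part_subset by blast
      show ?thesis
      proof (cases j)
        case 0 then show ?thesis using G.jet1_map_closed[OF dx'] by (simp add: F.jet_part_def)
      next
        case (Suc i)
        let ?PE = "jets D E (i + n)" and ?PF = "jets D F i"
        have IHi: "lin_map (alg D) ?PE ?PF (?g i)" by (rule less.IH) (use \<open>k = Suc j\<close> Suc in simp)
        interpret I: dga_module_hom D ?PE ?PF "?g i"
          by (intro dga_module_hom.intro E.dga_module_jets F.dga_module_jets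
              dga_module_hom_axioms.intro IHi)
        interpret dE: dga_module_hom D "jets D E (Suc (i + n))" "jet1 D ?PE" "jet_decode D ?PE"
          by (rule E.dga_module_hom_jet1[OF E.left_module_jets E.left_module_jets E.jet_steps(5)])
        interpret dF: dga_module_hom D "jets D F (Suc i)" "jet1 D ?PF" "jet_decode D ?PF"
          by (rule E.dga_module_hom_jet1[OF F.left_module_jets F.left_module_jets F.jet_steps(5)])
        interpret JI: dga_module_hom D "jet1 D ?PE" "jet1 D ?PF" I.Jf
          by (intro dga_module_hom.intro dE.N.dga_module_axioms dF.N.dga_module_axioms
              dga_module_hom_axioms.intro I.jet1_map_linear)
        let ?x = "?dE x"
        \<comment> \<open>The commuting square from the recursion: on decoded jets, the lift at
          level \<open>Suc i\<close> is the prolongation of the lift at level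
          \<open>i\<close>.\<close>
        have eq: "jet_decode D ?PF (?g (Suc i) z) = I.Jf (jet_decode D ?PE z)"
          if "z \<in> carrier (jets D E (Suc (i + n)))" for z
        proof -
          have "I.Jf (jet_decode D ?PE z) \<in> carrier I.N.J1"
            by (rule I.jet1_map_closed) (use E.jet_steps(4)[OF that] E.jet_part_subset in blast)
          then show ?thesis by (simp add: F.jet_steps(3))
        qed
        have Gh: "dga_module_hom D (jets D E (Suc (i + n))) (jets D F (Suc i)) (?g (Suc i))"
          using G.dga_module_hom_axioms Suc by simp
        have xc: "?x \<in> carrier (jet1 D (jets D E (Suc (i + n))))" using dx' Suc by simp
        have y: "jet1_map D (jets D E (Suc (i + n))) (jet1 D ?PE) (jet_decode D ?PE) ?x \<in> carrier (jet1 D (jet1 D ?PE))"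
          by (rule dE.jet1_map_closed[OF xc])
        \<comment> \<open>Applying \<open>J1\<close> to the square shows that the twice decoded
          image arises from that of \<open>?x\<close> by prolonging the lift at level
          \<open>i\<close> twice. Naturality of holonomy then reduces the conditions to those on
          \<open>?x\<close>.\<close>
        have "dF.Jf (jet1_map D (jets D E (Suc (i + n))) (jets D F (Suc i)) (?g (Suc i)) ?x) =
            jet1_map D (jets D E (Suc (i + n))) (jet1 D ?PF) (\<lambda>z. jet_decode D ?PF (?g (Suc i) z)) ?x"
          by (rule jet1_map_comp[OF Gh dF.dga_module_hom_axioms xc])
        also have "\<dots> = jet1_map D (jets D E (Suc (i + n))) (jet1 D ?PF) (\<lambda>z. I.Jf (jet_decode D ?PE z)) ?x"
          by (rule jet1_map_cong[OF dE.M.dga_module_axioms eq xc])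
        also have "\<dots> = JI.Jf (dE.Jf ?x)"
          by (rule jet1_map_comp[OF dE.dga_module_hom_axioms JI.dga_module_hom_axioms xc, symmetric])
        finally have e: "dF.Jf (jet1_map D (jets D E (Suc (i + n))) (jets D F (Suc i)) (?g (Suc i)) ?x) =
            JI.Jf (dE.Jf ?x)" .
        have z: "holonomy1 D ?PE (dE.Jf ?x) = \<zero>\<^bsub>I.M.T (Suc 0)\<^esub>" "holonomy2 D ?PE (dE.Jf ?x) = \<zero>\<^bsub>I.M.T 2\<^esub>"
          using dx Suc by (simp_all add: E.jet_part_def holonomic_jets_def Let_def del: jets.simps)
        have t0: "I.Tf m \<zero>\<^bsub>I.M.T m\<^esub> = \<zero>\<^bsub>I.N.T m\<^esub>" for m
          by (rule additive_map_zero[OF I.M.TM.M.abelian_group_axioms I.N.TM.M.abelian_group_axioms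
                I.forms_map_simps(1)])
        have "jet1_map D (jets D E (Suc (i + n))) (jets D F (Suc i)) (?g (Suc i)) ?x \<in> F.jet_part (Suc i)"
          using G.jet1_map_closed[OF dx'] Suc e I.holonomy_natural[OF y] z t0
          by (simp add: F.jet_part_def holonomic_jets_def Let_def del: jets.simps jet_lift.simps)
        then show ?thesis using Suc by simp
      qed
    qed
    have "lin_map (alg D) (jets D E (Suc (j + n))) ((jet1 D (jets D F j))\<lparr>carrier := F.jet_part j\<rparr>)
        (\<lambda>x. G.Jf (?dE x))"
      using lin_map_comp[OF E.jet_steps(5) G.jet1_map_linear] part by (simp add: lin_map_def)
    from lin_map_comp[OF this F.jet_steps(6)] show ?thesis by (simp add: Suc del: jets.simps)
  qed
qed

lemma jet_lift_prolong:
  assumes E: "dga_module D E" and F: "dga_module D F"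
    and g: "lin_map (alg D) (jets D E n) (jets D F 0) g"
    and e: "e \<in> carrier E" and p: "g (prolong D E n e) = Base (\<Delta> e)" and \<Delta>: "\<Delta> e \<in> carrier F"
  shows "jet_lift D E F n g k (prolong D E (k + n) e) = prolong D F k (\<Delta> e)"
proof (induction k)
  case (Suc k)
  interpret E: dga_module D E by fact
  interpret F: dga_module D F by fact
  interpret G: dga_module_hom D "jets D E (k + n)" "jets D F k" "jet_lift D E F n g k"
    by (intro dga_module_hom.intro E.dga_module_jets F.dga_module_jets
        dga_module_hom_axioms.intro jet_lift_linear[OF E F g])
  show ?case
    using Suc E.decode_prolong[OF e, of "k + n"]
    by (simp add: G.jet1_map_prolong1 E.prolong_closed[OF e])
qed (simp add: p)

section \<open>Polynomials over an associative algebra\<close>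

lemma (in abelian_monoid) finsum_mem:
  assumes "\<zero> \<in> H" "\<And>x y. \<lbrakk>x \<in> H; y \<in> H\<rbrakk> \<Longrightarrow> x \<oplus> y \<in> H" "H \<subseteq> carrier G" "\<And>i. i \<in> A \<Longrightarrow> f i \<in> H"
  shows "finsum G f A \<in> H"
  using assms(4)
proof (induction A rule: infinite_finite_induct)
  case (insert i A)
  then show ?case using assms(1-3) by (subst finsum_insert) auto
qed (use assms(1) in simp_all)

lemma additive_map_finsum:
  assumes "abelian_group M" "abelian_group N" "additive_map M N f" "g \<in> A \<rightarrow> carrier M"
  shows "f (finsum M g A) = finsum N (\<lambda>i. f (g i)) A"
  using assms(4)
proof (induction A rule: infinite_finite_induct)
  case (insert i A)
  interpret M: abelian_group M by fact
  interpret N: abelian_group N by fact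
  have "(\<lambda>i. f (g i)) \<in> insert i A \<rightarrow> carrier N"
    using insert.prems additive_mapD(1)[OF assms(3)] by auto
  then show ?case using insert additive_mapD(2)[OF assms(3)]
    by (simp add: Pi_iff M.finsum_insert N.finsum_insert)
next
  case (infinite A)
  interpret M: abelian_group M by fact
  interpret N: abelian_group N by fact
  show ?case using infinite additive_map_zero[OF assms(1-3)] by (simp add: M.finsum_infinite N.finsum_infinite)
next
  case empty
  interpret M: abelian_group M by fact
  interpret N: abelian_group N by fact
  show ?case using additive_map_zero[OF assms(1-3)] by simp
qed

context assoc_algebra
begin

sublocale UK: UP_cring K "UP K" by (intro UP_cring.intro R.is_cring) simp
sublocale US: UP_ring S "UP S" by (intro UP_ring.intro ring_axioms) simp

abbreviation "U \<equiv> UP K"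
abbreviation "V \<equiv> UP S"
abbreviation "scal k \<equiv> k \<odot>\<^bsub>S\<^esub> \<one>\<^bsub>S\<^esub>"

lemma scal_hom: "ring_hom_ring K S (\<lambda>k. scal k)"
  by (intro ring_hom_ring.intro ring_hom_ring_axioms.intro R.ring_axioms ring_axioms ring_hom_memI)
    (simp_all add: smult_l_distr smult_assoc1 smult_mult_left)

sublocale scal: ring_hom_ring K S "\<lambda>k. scal k" by (rule scal_hom)

lemma scal_mult:
  assumes "k \<in> carrier K" "x \<in> carrier S"
  shows "scal k \<otimes>\<^bsub>S\<^esub> x = k \<odot>\<^bsub>S\<^esub> x" "x \<otimes>\<^bsub>S\<^esub> scal k = k \<odot>\<^bsub>S\<^esub> x"
  using assms by (simp_all add: smult_mult_left smult_mult_right)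

lemma coeff_up: "(\<And>i. f i \<in> carrier S) \<Longrightarrow> (\<forall>i>n. f i = \<zero>\<^bsub>S\<^esub>) \<Longrightarrow> f \<in> carrier V \<and> (\<forall>i. coeff V f i = f i)"
  by (auto simp: UP_def intro!: mem_upI)

text \<open>The base change from \<open>K[h]\<close> to \<open>S[h]\<close>. Its image is central,
  so multiplication by it replaces a separate \<open>K[h]\<close>-module structure on
  \<open>UP S\<close>.\<close>

definition poly_scal :: "(nat \<Rightarrow> 'a) \<Rightarrow> nat \<Rightarrow> 'b"
  where "poly_scal p = (\<lambda>i. scal (coeff U p i))"

lemma poly_scal_simps:
  assumes "p \<in> carrier U"
  shows "poly_scal p \<in> carrier V" "coeff V (poly_scal p) i = scal (coeff U p i)"
proof -
  have "poly_scal p \<in> carrier V \<and> (\<forall>i. coeff V (poly_scal p) i = scal (coeff U p i))"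
    using coeff_up[of "poly_scal p" "deg K p"] assms UK.deg_aboveD[OF _ assms]
    by (simp add: poly_scal_def)
  then show "poly_scal p \<in> carrier V" "coeff V (poly_scal p) i = scal (coeff U p i)" by simp_all
qed

lemma poly_scal_add: "\<lbrakk>p \<in> carrier U; r \<in> carrier U\<rbrakk> \<Longrightarrow>
    poly_scal (p \<oplus>\<^bsub>U\<^esub> r) = poly_scal p \<oplus>\<^bsub>V\<^esub> poly_scal r"
  by (rule US.up_eqI) (simp_all add: poly_scal_simps smult_l_distr)

lemma poly_scal_mult:
  assumes "p \<in> carrier U" "r \<in> carrier U"
  shows "poly_scal (p \<otimes>\<^bsub>U\<^esub> r) = poly_scal p \<otimes>\<^bsub>V\<^esub> poly_scal r"
proof (rule US.up_eqI)
  fix n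
  have "scal (\<Oplus>\<^bsub>K\<^esub>i\<in>{..n}. coeff U p i \<otimes>\<^bsub>K\<^esub> coeff U r (n - i)) =
      (\<Oplus>\<^bsub>S\<^esub>i\<in>{..n}. scal (coeff U p i \<otimes>\<^bsub>K\<^esub> coeff U r (n - i)))"
    by (subst scal.hom_finsum) (use assms in \<open>auto simp: comp_def\<close>)
  also have "\<dots> = (\<Oplus>\<^bsub>S\<^esub>i\<in>{..n}. scal (coeff U p i) \<otimes>\<^bsub>S\<^esub> scal (coeff U r (n - i)))"
    by (rule M.finsum_cong) (use assms in \<open>auto simp: scal.hom_mult simp_implies_def\<close>)
  finally show "coeff V (poly_scal (p \<otimes>\<^bsub>U\<^esub> r)) n = coeff V (poly_scal p \<otimes>\<^bsub>V\<^esub> poly_scal r) n"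
    using assms by (simp add: poly_scal_simps)
qed (use assms in \<open>simp_all add: poly_scal_simps\<close>)

lemma poly_scal_monom: "k \<in> carrier K \<Longrightarrow> poly_scal (monom U k j) = monom V (scal k) j"
  by (rule US.up_eqI) (simp_all add: poly_scal_simps)

text \<open>Allows scalars from \<open>K[h]\<close> to be pulled out of the right factor of a star
  product.\<close>

lemma poly_scal_central:
  assumes "p \<in> carrier U" "P \<in> carrier V"
  shows "poly_scal p \<otimes>\<^bsub>V\<^esub> P = P \<otimes>\<^bsub>V\<^esub> poly_scal p"
proof (rule US.up_eqI)
  fix n
  let ?f = "\<lambda>i. coeff V P i \<otimes>\<^bsub>S\<^esub> scal (coeff U p (n - i))"
  have "(\<Oplus>\<^bsub>S\<^esub>i\<in>{..n}. scal (coeff U p i) \<otimes>\<^bsub>S\<^esub> coeff V P (n - i)) = (\<Oplus>\<^bsub>S\<^esub>i\<in>{..n}. ?f (n - i))"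
    by (rule M.finsum_cong) (use assms in \<open>auto simp: scal_mult simp_implies_def\<close>)
  also have "\<dots> = finsum S ?f ((\<lambda>i. n - i) ` {..n})"
    by (rule M.finsum_reindex[symmetric]) (use assms in \<open>auto simp: inj_on_def\<close>)
  also have "(\<lambda>i. n - i) ` {..n} = {..n}"
  proof (intro equalityI subsetI)
    fix i assume "i \<in> {..n}"
    then have "i = n - (n - i)" "n - i \<in> {..n}" by simp_all
    then show "i \<in> (\<lambda>i. n - i) ` {..n}" by (rule image_eqI)
  qed auto
  finally show "coeff V (poly_scal p \<otimes>\<^bsub>V\<^esub> P) n = coeff V (P \<otimes>\<^bsub>V\<^esub> poly_scal p) n"
    using assms by (simp add: poly_scal_simps)
qed (use assms in \<open>simp_all add: poly_scal_simps\<close>)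

end

section \<open>The Rees algebra of a split filtration\<close>

text \<open>\<open>W\<close> is a multiplicative filtration of a subalgebra of \<open>S\<close>, the module \<open>M n\<close> is its \<open>n\<close>-th
  graded part, and \<open>Q n\<close> is a section of the projection of \<open>W n\<close> onto \<open>M n\<close>. The assumptions
  \<open>Q_inj\<close> and \<open>Q_split\<close> express this without mentioning the projection.\<close>

locale split_filtration = assoc_algebra K S
  for K :: "('a, 'c) ring_scheme" and S :: "('a, 'b, 'd) module_scheme" +
  fixes M :: "nat \<Rightarrow> ('a, 'm, 'z) module_scheme" and Q :: "nat \<Rightarrow> 'm \<Rightarrow> 'b" and W :: "nat \<Rightarrow> 'b set"
  assumes graded_module: "left_module K (M n)"
    and Q_linear: "lin_map K (M n) S (Q n)"
    and Q_mem: "a \<in> carrier (M n) \<Longrightarrow> Q n a \<in> W n"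
    and W_submodule: "left_submodule K S (W n)"
    and W_mono: "W n \<subseteq> W (Suc n)"
    and W_one: "\<one>\<^bsub>S\<^esub> \<in> W 0"
    and W_mult: "\<lbrakk>x \<in> W n; y \<in> W m\<rbrakk> \<Longrightarrow> x \<otimes>\<^bsub>S\<^esub> y \<in> W (n + m)"
    and Q_inj: "\<lbrakk>a \<in> carrier (M n); Q n a \<in> (case n of 0 \<Rightarrow> {\<zero>\<^bsub>S\<^esub>} | Suc m \<Rightarrow> W m)\<rbrakk> \<Longrightarrow> a = \<zero>\<^bsub>M n\<^esub>"
    and Q_split: "x \<in> W n \<Longrightarrow> \<exists>a\<in>carrier (M n). x \<ominus>\<^bsub>S\<^esub> Q n a \<in> (case n of 0 \<Rightarrow> {\<zero>\<^bsub>S\<^esub>} | Suc m \<Rightarrow> W m)"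
begin

lemma left_module_S: "left_module K S"
  by (intro left_module_of_module module_axioms)

sublocale LS: left_module K S by (rule left_module_S)
sublocale gr: left_module K "M n" for n by (rule graded_module)

lemmas Q_add = lin_mapD(2)[OF Q_linear]
lemmas Q_smult = lin_mapD(3)[OF Q_linear]
lemmas Q_closed = lin_mapD(1)[OF Q_linear]

lemma Q_zero: "Q n \<zero>\<^bsub>M n\<^esub> = \<zero>\<^bsub>S\<^esub>"
  by (rule additive_map_zero[OF gr.M.abelian_group_axioms abelian_group_axioms
        lin_map_additive[OF Q_linear]])

lemma W_simps:
  "x \<in> W n \<Longrightarrow> x \<in> carrier S" "\<zero>\<^bsub>S\<^esub> \<in> W n" "\<lbrakk>x \<in> W n; y \<in> W n\<rbrakk> \<Longrightarrow> x \<oplus>\<^bsub>S\<^esub> y \<in> W n"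
  "\<lbrakk>x \<in> W n; y \<in> W n\<rbrakk> \<Longrightarrow> x \<ominus>\<^bsub>S\<^esub> y \<in> W n" "\<lbrakk>k \<in> carrier K; x \<in> W n\<rbrakk> \<Longrightarrow> k \<odot>\<^bsub>S\<^esub> x \<in> W n"
  using W_submodule[of n] LS.left_submodule_minus[OF W_submodule[of n]]
  by (auto simp: left_submodule_def)

lemma W_le: "\<lbrakk>m \<le> n; x \<in> W m\<rbrakk> \<Longrightarrow> x \<in> W n"
  using lift_Suc_mono_le[of W m n] W_mono by blast

lemma W_finsum: "(\<And>i. i \<in> I \<Longrightarrow> f i \<in> W n) \<Longrightarrow> finsum S f I \<in> W n"
  by (rule M.finsum_mem) (auto simp: W_simps)

abbreviation "qsum n a \<equiv> (\<Oplus>\<^bsub>S\<^esub>k\<in>{..n}. Q k (a k))"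

lemma qsum_Suc: "(\<forall>k\<le>Suc n. a k \<in> carrier (M k)) \<Longrightarrow> qsum (Suc n) a = Q (Suc n) (a (Suc n)) \<oplus>\<^bsub>S\<^esub> qsum n a"
  by (subst M.finsum_Suc) (auto simp: Q_closed)

lemma qsum_mem: "(\<forall>k\<le>n. a k \<in> carrier (M k)) \<Longrightarrow> qsum n a \<in> W n"
  by (rule W_finsum) (auto intro: W_le Q_mem)

text \<open>All terms below the top one already lie in the preceding step of the filtration, hence
  so does the top term, and \<open>Q_inj\<close> applies.\<close>

lemma qsum_top:
  assumes a: "\<forall>k\<le>n. a k \<in> carrier (M k)" and x: "qsum n a \<in> (case n of 0 \<Rightarrow> {\<zero>\<^bsub>S\<^esub>} | Suc m \<Rightarrow> W m)"
  shows "a n = \<zero>\<^bsub>M n\<^esub>"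
proof (rule Q_inj)
  show "Q n (a n) \<in> (case n of 0 \<Rightarrow> {\<zero>\<^bsub>S\<^esub>} | Suc m \<Rightarrow> W m)"
  proof (cases n)
    case 0 then show ?thesis using a x by (simp add: Q_closed)
  next
    case (Suc m)
    then have m: "qsum m a \<in> W m" using a by (intro qsum_mem) simp
    have "Q (Suc m) (a (Suc m)) \<oplus>\<^bsub>S\<^esub> qsum m a \<in> W m" using a x qsum_Suc[of m a] Suc by simp
    then have "(Q (Suc m) (a (Suc m)) \<oplus>\<^bsub>S\<^esub> qsum m a) \<ominus>\<^bsub>S\<^esub> qsum m a \<in> W m" using m by (rule W_simps)
    moreover have "(Q (Suc m) (a (Suc m)) \<oplus>\<^bsub>S\<^esub> qsum m a) \<ominus>\<^bsub>S\<^esub> qsum m a = Q (Suc m) (a (Suc m))"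
      using W_simps(1)[OF m] Q_closed[of "a (Suc m)" "Suc m"] a Suc
      by (simp add: a_minus_def M.a_assoc M.r_neg)
    ultimately show ?thesis using Suc by simp
  qed
qed (use a in simp)

lemma qsum_filtration:
  "\<lbrakk>\<forall>k\<le>n. a k \<in> carrier (M k); qsum n a \<in> W m; m < k; k \<le> n\<rbrakk> \<Longrightarrow> a k = \<zero>\<^bsub>M k\<^esub>"
proof (induction n)
  case (Suc n)
  have "qsum (Suc n) a \<in> W n" using Suc.prems by (auto intro: W_le[of m])
  then have top: "a (Suc n) = \<zero>\<^bsub>M (Suc n)\<^esub>" using qsum_top[of "Suc n" a] Suc.prems by simp
  moreover have "qsum n a \<in> carrier S" using qsum_mem[of n a] W_simps(1) Suc.prems by simp
  ultimately have "qsum n a \<in> W m" using Suc.prems qsum_Suc[of n a] by (simp add: Q_zero)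
  then show ?case using Suc top by (cases "k = Suc n") auto
qed simp

text \<open>Since zero lies in \<open>W 0\<close>, \<open>qsum_filtration\<close> kills every
  component of positive index. The component of index 0 has no lower step to be compared with and is
  treated through the zero case of \<open>Q_inj\<close>.\<close>

lemma qsum_unique: "\<lbrakk>\<forall>k\<le>n. a k \<in> carrier (M k); qsum n a = \<zero>\<^bsub>S\<^esub>; k \<le> n\<rbrakk> \<Longrightarrow> a k = \<zero>\<^bsub>M k\<^esub>"
proof (cases k)
  case 0
  assume *: "\<forall>k\<le>n. a k \<in> carrier (M k)" "qsum n a = \<zero>\<^bsub>S\<^esub>"
  have "a i = \<zero>\<^bsub>M i\<^esub>" if "0 < i" "i \<le> n" for i
    by (rule qsum_filtration[of n a 0]) (use * that W_simps(2)[of 0] in auto)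
  then have "qsum n a = (\<Oplus>\<^bsub>S\<^esub>i\<in>{..n}. if 0 = i then Q 0 (a 0) else \<zero>\<^bsub>S\<^esub>)"
    by (intro M.finsum_cong) (use *(1) in \<open>auto simp: Q_zero Q_closed simp_implies_def\<close>)
  also have "\<dots> = Q 0 (a 0)"
    using M.finsum_singleton[of 0 "{..n}" "\<lambda>_. Q 0 (a 0)"] * by (simp add: Q_closed)
  finally have "Q 0 (a 0) = \<zero>\<^bsub>S\<^esub>" using * by simp
  then show ?thesis using Q_inj[of "a 0" 0] * 0 by simp
next
  case (Suc i)
  assume *: "\<forall>k\<le>n. a k \<in> carrier (M k)" "qsum n a = \<zero>\<^bsub>S\<^esub>" "k \<le> n"
  show ?thesis by (rule qsum_filtration[of n a 0]) (use * Suc W_simps(2)[of 0] in auto)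
qed

lemma qsum_exists: "x \<in> W n \<Longrightarrow> \<exists>a. (\<forall>k. a k \<in> carrier (M k)) \<and> x = qsum n a"
proof (induction n arbitrary: x)
  case 0
  obtain b where b: "b \<in> carrier (M 0)" "x \<ominus>\<^bsub>S\<^esub> Q 0 b = \<zero>\<^bsub>S\<^esub>" using Q_split[OF 0] by auto
  then have "x = Q 0 b" using W_simps(1)[OF 0] by (simp add: M.minus_eq_zero_iff Q_closed)
  then show ?case using b
    by (intro exI[of _ "\<lambda>k. if k = 0 then b else \<zero>\<^bsub>M k\<^esub>"]) (auto simp: Q_closed)
next
  case (Suc n)
  obtain b where b: "b \<in> carrier (M (Suc n))" "x \<ominus>\<^bsub>S\<^esub> Q (Suc n) b \<in> W n" using Q_split[OF Suc.prems] by auto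
  obtain a where a: "\<forall>k. a k \<in> carrier (M k)" "x \<ominus>\<^bsub>S\<^esub> Q (Suc n) b = qsum n a" using Suc.IH[OF b(2)] by auto
  let ?a = "a(Suc n := b)"
  have a': "\<forall>k. ?a k \<in> carrier (M k)" using a b by auto
  have "qsum (Suc n) ?a = Q (Suc n) b \<oplus>\<^bsub>S\<^esub> qsum n ?a" using qsum_Suc[of n ?a] a' by simp
  also have "qsum n ?a = qsum n a"
    by (rule M.finsum_cong) (use a in \<open>auto simp: Q_closed simp_implies_def\<close>)
  also have "Q (Suc n) b \<oplus>\<^bsub>S\<^esub> qsum n a = x"
    using W_simps(1)[OF Suc.prems] Q_closed[OF b(1)] a(2)[symmetric]
    by (simp add: a_minus_def M.a_lcomm M.r_neg)
  finally show ?case using a' by metis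
qed

subsection \<open>The tensor product\<close>

abbreviation "DM \<equiv> direct_sum M"

sublocale DM: left_module K "direct_sum M" by (rule left_module_direct_sum[OF graded_module])

lemma direct_sum_simps:
  "s \<in> carrier DM \<Longrightarrow> s n \<in> carrier (M n)" "(s \<oplus>\<^bsub>DM\<^esub> t) n = s n \<oplus>\<^bsub>M n\<^esub> t n"
  "(k \<odot>\<^bsub>DM\<^esub> s) n = k \<odot>\<^bsub>M n\<^esub> s n" "\<zero>\<^bsub>DM\<^esub> n = \<zero>\<^bsub>M n\<^esub>"
  by (simp_all add: direct_sum_def)

lemma direct_sum_bound:
  assumes "s \<in> carrier DM" shows "\<exists>N. \<forall>n>N. s n = \<zero>\<^bsub>M n\<^esub>"
proof -
  have "finite {n. s n \<noteq> \<zero>\<^bsub>M n\<^esub>}" using assms by (simp add: direct_sum_def)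
  then obtain N where "{n. s n \<noteq> \<zero>\<^bsub>M n\<^esub>} \<subseteq> {..N}" using finite_nat_iff_bounded_le by blast
  then show ?thesis by (intro exI[of _ N]) (auto simp: subset_eq not_le[symmetric])
qed

abbreviation "incl n a \<equiv> direct_sum_incl M n a"

lemma incl_simps: "a \<in> carrier (M n) \<Longrightarrow> incl n a \<in> carrier DM"
  by (auto simp: direct_sum_def direct_sum_incl_def intro: finite_subset[of _ "{n}"])

lemma incl_add: "\<lbrakk>a \<in> carrier (M n); b \<in> carrier (M n)\<rbrakk> \<Longrightarrow>
    incl n (a \<oplus>\<^bsub>M n\<^esub> b) = incl n a \<oplus>\<^bsub>DM\<^esub> incl n b"
  by (rule ext) (simp add: direct_sum_incl_def direct_sum_simps)

lemma incl_smult: "\<lbrakk>a \<in> carrier (M n); k \<in> carrier K\<rbrakk> \<Longrightarrow> incl n (k \<odot>\<^bsub>M n\<^esub> a) = k \<odot>\<^bsub>DM\<^esub> incl n a"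
  by (rule ext) (simp add: direct_sum_incl_def direct_sum_simps gr.smult_zero_right)

lemma additive_map_component: "additive_map DM (M n) (\<lambda>s. s n)"
  by (auto simp: additive_map_def direct_sum_simps)

lemma direct_sum_expand:
  assumes s: "s \<in> carrier DM" and N: "\<forall>n>N. s n = \<zero>\<^bsub>M n\<^esub>"
  shows "s = (\<Oplus>\<^bsub>DM\<^esub>n\<in>{..N}. incl n (s n))"
proof
  fix i
  have "(\<Oplus>\<^bsub>DM\<^esub>n\<in>{..N}. incl n (s n)) i = (\<Oplus>\<^bsub>M i\<^esub>n\<in>{..N}. incl n (s n) i)"
    by (rule additive_map_finsum[OF DM.M.abelian_group_axioms gr.M.abelian_group_axioms
          additive_map_component]) (use s in \<open>auto intro: incl_simps direct_sum_simps(1)\<close>)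
  also have "\<dots> = (\<Oplus>\<^bsub>M i\<^esub>n\<in>{..N}. if i = n then s i else \<zero>\<^bsub>M i\<^esub>)"
    by (rule gr.M.finsum_cong)
      (use s in \<open>auto simp: direct_sum_incl_def direct_sum_simps simp_implies_def\<close>)
  also have "\<dots> = s i"
  proof (cases "i \<le> N")
    case True
    then show ?thesis using gr.M.finsum_singleton[of i "{..N}" "\<lambda>_. s i"] s
      by (simp add: direct_sum_simps)
  next
    case False
    then have "(\<Oplus>\<^bsub>M i\<^esub>n\<in>{..N}. if i = n then s i else \<zero>\<^bsub>M i\<^esub>) = (\<Oplus>\<^bsub>M i\<^esub>n\<in>{..N}. \<zero>\<^bsub>M i\<^esub>)"
      by (intro gr.M.finsum_cong) (auto simp: simp_implies_def)
    then show ?thesis using N False by simp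
  qed
  finally show "s i = (\<Oplus>\<^bsub>DM\<^esub>n\<in>{..N}. incl n (s n)) i" by simp
qed

lemma left_module_U: "left_module K U"
  using algebra.module[OF UK.UP_algebra] by (rule left_module_of_module)

sublocale LU: left_module K "UP K" by (rule left_module_U)

sublocale TF: tensor_factors K "direct_sum M" "UP K"
  by (intro tensor_factors.intro left_module_U DM.M.abelian_group_axioms tensor_factors_axioms.intro)
    (rule DM.smult_closed)

abbreviation "B \<equiv> tensor K DM U (\<lambda>p. apsnd (\<lambda>r. p \<otimes>\<^bsub>U\<^esub> r))"
abbreviation "pure s p \<equiv> tensor_cls K DM U [(s, p)]"

lemma left_module_B: "left_module U B"
  and smult_B_cls: "\<lbrakk>p \<in> carrier U; u \<in> formal_sums DM U\<rbrakk> \<Longrightarrow>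
    p \<odot>\<^bsub>B\<^esub> tensor_cls K DM U u = tensor_cls K DM U (map (apsnd (\<lambda>r. p \<otimes>\<^bsub>U\<^esub> r)) u)"
proof -
  let ?act = "\<lambda>p. apsnd (\<lambda>r. p \<otimes>\<^bsub>U\<^esub> r) :: _ \<times> _ \<Rightarrow> (nat \<Rightarrow> 'm) \<times> (nat \<Rightarrow> 'a)"
  let ?e = "tensor_eq K DM U"
  note tens = TF.left_module_tensor[where S = U and act = ?act]
  have 1: "?e [(x, s \<otimes>\<^bsub>U\<^esub> (m \<oplus>\<^bsub>U\<^esub> n))] [(x, s \<otimes>\<^bsub>U\<^esub> m), (x, s \<otimes>\<^bsub>U\<^esub> n)]"
    if "x \<in> carrier DM" "s \<in> carrier U" "m \<in> carrier U" "n \<in> carrier U" for x s m n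
    using tensor_eq.add_right[of x DM "s \<otimes>\<^bsub>U\<^esub> m" U "s \<otimes>\<^bsub>U\<^esub> n" K] that by (simp add: UK.P.r_distr)
  have 2: "?e [(k \<odot>\<^bsub>DM\<^esub> x, s \<otimes>\<^bsub>U\<^esub> m)] [(x, s \<otimes>\<^bsub>U\<^esub> (k \<odot>\<^bsub>U\<^esub> m))]"
    if "x \<in> carrier DM" "s \<in> carrier U" "m \<in> carrier U" "k \<in> carrier K" for x s m k
    using tensor_eq.balanced[of k K x DM "s \<otimes>\<^bsub>U\<^esub> m" U] that UK.smult_assoc2[of k m s]
    by (simp add: UK.P.m_comm)
  have 3: "?e [(x, (s \<oplus>\<^bsub>U\<^esub> t) \<otimes>\<^bsub>U\<^esub> m)] [(x, s \<otimes>\<^bsub>U\<^esub> m), (x, t \<otimes>\<^bsub>U\<^esub> m)]"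
    if "x \<in> carrier DM" "s \<in> carrier U" "m \<in> carrier U" "t \<in> carrier U" for x s m t
    using tensor_eq.add_right[of x DM "s \<otimes>\<^bsub>U\<^esub> m" U "t \<otimes>\<^bsub>U\<^esub> m" K] that by (simp add: UK.P.l_distr)
  show "left_module U B"
    by (rule tens(1)) (simp_all add: UK.P.ring_axioms tensor_eq.zero tensor_eq.add_left 1 2 3 UK.P.m_assoc)
  show "p \<odot>\<^bsub>B\<^esub> tensor_cls K DM U u = tensor_cls K DM U (map (apsnd (\<lambda>r. p \<otimes>\<^bsub>U\<^esub> r)) u)"
    if "p \<in> carrier U" "u \<in> formal_sums DM U"
    by (rule tens(2))
      (use that in \<open>simp_all add: UK.P.ring_axioms tensor_eq.zero tensor_eq.add_left 1 2 3 UK.P.m_assoc\<close>)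
qed

sublocale LB: left_module "UP K" "tensor K (direct_sum M) (UP K) (\<lambda>p. apsnd (\<lambda>r. p \<otimes>\<^bsub>UP K\<^esub> r))"
  by (rule left_module_B)

lemma pure_simps:
  assumes "s \<in> carrier DM" "p \<in> carrier U"
  shows pure_closed: "pure s p \<in> carrier B"
    and pure_add_left: "t \<in> carrier DM \<Longrightarrow> pure (s \<oplus>\<^bsub>DM\<^esub> t) p = pure s p \<oplus>\<^bsub>B\<^esub> pure t p"
    and pure_add_right: "r \<in> carrier U \<Longrightarrow> pure s (p \<oplus>\<^bsub>U\<^esub> r) = pure s p \<oplus>\<^bsub>B\<^esub> pure s r"
    and pure_balanced: "k \<in> carrier K \<Longrightarrow> pure (k \<odot>\<^bsub>DM\<^esub> s) p = pure s (k \<odot>\<^bsub>U\<^esub> p)"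
    and pure_smult: "r \<in> carrier U \<Longrightarrow> r \<odot>\<^bsub>B\<^esub> pure s p = pure s (r \<otimes>\<^bsub>U\<^esub> p)"
  using TF.pure_tensor_balanced[of "\<lambda>p. apsnd (\<lambda>r. p \<otimes>\<^bsub>U\<^esub> r)"] assms
  unfolding balanced_map_def by (simp_all add: smult_B_cls)

lemma additive_pure: "s \<in> carrier DM \<Longrightarrow> additive_map U B (pure s)"
  "p \<in> carrier U \<Longrightarrow> additive_map DM B (\<lambda>s. pure s p)"
  by (auto simp: additive_map_def pure_simps)

subsection \<open>The embedding into the polynomial algebra\<close>

definition symbol_poly :: "(nat \<Rightarrow> 'm) \<Rightarrow> nat \<Rightarrow> 'b"
  where "symbol_poly s = (\<lambda>n. Q n (s n))"

lemma symbol_poly_simps: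
  assumes "s \<in> carrier DM"
  shows "symbol_poly s \<in> carrier V" "coeff V (symbol_poly s) i = Q i (s i)"
proof -
  obtain N where "\<forall>n>N. s n = \<zero>\<^bsub>M n\<^esub>" using direct_sum_bound[OF assms] by blast
  then have "symbol_poly s \<in> carrier V \<and> (\<forall>i. coeff V (symbol_poly s) i = Q i (s i))"
    using coeff_up[of "symbol_poly s" N] assms
    by (simp add: symbol_poly_def Q_zero Q_closed direct_sum_simps)
  then show "symbol_poly s \<in> carrier V" "coeff V (symbol_poly s) i = Q i (s i)" by simp_all
qed

lemma symbol_poly_add: "\<lbrakk>s \<in> carrier DM; t \<in> carrier DM\<rbrakk> \<Longrightarrow>
    symbol_poly (s \<oplus>\<^bsub>DM\<^esub> t) = symbol_poly s \<oplus>\<^bsub>V\<^esub> symbol_poly t"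
  by (rule US.up_eqI) (simp_all add: symbol_poly_simps direct_sum_simps Q_add)

lemma symbol_poly_smult: "\<lbrakk>k \<in> carrier K; s \<in> carrier DM\<rbrakk> \<Longrightarrow>
    symbol_poly (k \<odot>\<^bsub>DM\<^esub> s) = scal k \<odot>\<^bsub>V\<^esub> symbol_poly s"
  by (rule US.up_eqI)
    (simp_all add: symbol_poly_simps direct_sum_simps DM.smult_closed Q_smult Q_closed scal_mult)

lemma symbol_poly_incl: "a \<in> carrier (M n) \<Longrightarrow> symbol_poly (incl n a) = monom V (Q n a) n"
  by (rule US.up_eqI)
    (simp_all add: symbol_poly_simps incl_simps Q_closed, auto simp: direct_sum_incl_def Q_zero)

text \<open>A pure tensor \<open>a \<otimes> p\<close> with \<open>a\<close> in degree \<open>n\<close> is sent to \<open>Q n a h\<^sup>n p\<close>, so that powers of \<open>h\<close>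
  record the filtration and the formal star product becomes the product of polynomials.\<close>

definition rees :: "((nat \<Rightarrow> 'm) \<times> (nat \<Rightarrow> 'a)) list set \<Rightarrow> nat \<Rightarrow> 'b"
  where "rees = tensor_lift V (\<lambda>s p. poly_scal p \<otimes>\<^bsub>V\<^esub> symbol_poly s)"

lemma rees_simps:
  shows rees_additive: "additive_map B V rees"
    and rees_pure: "\<lbrakk>s \<in> carrier DM; p \<in> carrier U\<rbrakk> \<Longrightarrow> rees (pure s p) = poly_scal p \<otimes>\<^bsub>V\<^esub> symbol_poly s"
proof -
  have b: "balanced_map K DM U V (\<lambda>s p. poly_scal p \<otimes>\<^bsub>V\<^esub> symbol_poly s)"
  proof (rule balanced_mapI, goal_cases)
    case (4 k s p)
    \<comment> \<open>A scalar crosses the tensor sign as a constant polynomial, which is then moved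
      by associativity in \<open>S[h]\<close>.\<close>
    have kp: "k \<odot>\<^bsub>U\<^esub> p = p \<otimes>\<^bsub>U\<^esub> monom U k 0"
      using 4 UK.monom_mult_is_smult[of k p] by (simp add: UK.P.m_comm)
    have "poly_scal p \<otimes>\<^bsub>V\<^esub> symbol_poly (k \<odot>\<^bsub>DM\<^esub> s) =
        poly_scal p \<otimes>\<^bsub>V\<^esub> (monom V (scal k) 0 \<otimes>\<^bsub>V\<^esub> symbol_poly s)"
      using 4 by (simp add: symbol_poly_smult US.monom_mult_is_smult symbol_poly_simps)
    also have "\<dots> = poly_scal (k \<odot>\<^bsub>U\<^esub> p) \<otimes>\<^bsub>V\<^esub> symbol_poly s"
      using 4 unfolding kp
      by (simp add: poly_scal_mult poly_scal_monom poly_scal_simps symbol_poly_simps US.P.m_assoc)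
    finally show ?case .
  qed (simp_all add: poly_scal_simps symbol_poly_simps poly_scal_add symbol_poly_add US.P.l_distr
      US.P.r_distr)
  show "additive_map B V rees"
    unfolding rees_def by (rule TF.tensor_lift_additive[OF US.P.abelian_group_axioms b])
  show "rees (pure s p) = poly_scal p \<otimes>\<^bsub>V\<^esub> symbol_poly s" if "s \<in> carrier DM" "p \<in> carrier U"
    using TF.tensor_lift_cls[OF US.P.abelian_group_axioms b, of "[(s, p)]"] that
    by (simp add: rees_def poly_scal_simps symbol_poly_simps)
qed

lemmas rees_closed = additive_mapD(1)[OF rees_additive]
lemmas rees_add = additive_mapD(2)[OF rees_additive]

lemma rees_smult:
  assumes "p \<in> carrier U" "b \<in> carrier B"
  shows "rees (p \<odot>\<^bsub>B\<^esub> b) = poly_scal p \<otimes>\<^bsub>V\<^esub> rees b"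
proof (rule TF.additive_map_tensor_eqI[OF US.P.abelian_group_axioms _ _ _ assms(2)])
  show "additive_map B V (\<lambda>b. rees (p \<odot>\<^bsub>B\<^esub> b))"
    using assms by (auto simp: additive_map_def LB.smult_closed LB.smult_r_distr rees_closed rees_add)
  show "additive_map B V (\<lambda>b. poly_scal p \<otimes>\<^bsub>V\<^esub> rees b)"
    using assms by (auto simp: additive_map_def poly_scal_simps rees_closed rees_add US.P.r_distr)
  show "rees (p \<odot>\<^bsub>B\<^esub> pure s r) = poly_scal p \<otimes>\<^bsub>V\<^esub> rees (pure s r)"
    if "s \<in> carrier DM" "r \<in> carrier U" for s r
    using that assms
    by (simp add: pure_smult rees_pure poly_scal_mult US.P.m_assoc poly_scal_simps symbol_poly_simps)
qed

end

section \<open>Injectivity and image of the embedding\<close>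

context split_filtration
begin

text \<open>On a pure tensor, the coefficient at \<open>i\<close> is a combination of values of
  \<open>Q\<close> in orders at most \<open>i\<close>: multiplying by powers of \<open>h\<close>
  raises the exponent without raising the order.\<close>

lemma rees_coeff_mem:
  assumes "b \<in> carrier B" shows "coeff V (rees b) i \<in> W i"
proof -
  let ?H = "{P \<in> carrier V. \<forall>i. coeff V P i \<in> W i}"
  obtain u where u: "u \<in> formal_sums DM U" "b = tensor_cls K DM U u" using assms by (auto simp: TF.tensor_simps)
  have "rees (tensor_cls K DM U u) \<in> ?H" using u(1)
  proof (induction u)
    case Nil
    have "rees (tensor_cls K DM U []) = \<zero>\<^bsub>V\<^esub>"
      using additive_map_zero[OF LB.M.abelian_group_axioms US.P.abelian_group_axioms rees_additive]
      by (simp add: TF.tensor_simps)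
    then show ?case by (simp add: W_simps)
  next
    case (Cons q u)
    obtain s p where q: "q = (s, p)" by fastforce
    have c: "s \<in> carrier DM" "p \<in> carrier U" "u \<in> formal_sums DM U" using Cons by (auto simp: q)
    have cons: "tensor_cls K DM U (q # u) = pure s p \<oplus>\<^bsub>B\<^esub> tensor_cls K DM U u"
      using c by (simp add: TF.tensor_simps q)
    have "tensor_cls K DM U u \<in> carrier B" using c by (simp add: TF.tensor_simps)
    then have e: "rees (tensor_cls K DM U (q # u)) =
        poly_scal p \<otimes>\<^bsub>V\<^esub> symbol_poly s \<oplus>\<^bsub>V\<^esub> rees (tensor_cls K DM U u)"
      unfolding cons by (simp only: rees_add[OF pure_closed[OF c(1,2)]] rees_pure[OF c(1,2)])
    have "coeff V (poly_scal p \<otimes>\<^bsub>V\<^esub> symbol_poly s) i \<in> W i" for i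
    proof -
      have "scal (coeff U p j) \<otimes>\<^bsub>S\<^esub> Q (i - j) (s (i - j)) \<in> W i" if "j \<le> i" for j
        using c W_le[of "i - j" i] Q_mem[of "s (i - j)" "i - j"]
        by (simp add: direct_sum_simps scal_mult Q_closed W_simps)
      then show ?thesis
        using c by (auto simp: poly_scal_simps symbol_poly_simps intro!: W_finsum)
    qed
    then show ?case using Cons.IH[OF c(3)] c unfolding e
      by (simp add: poly_scal_simps symbol_poly_simps W_simps del: US.coeff_mult)
  qed
  then show ?thesis using u by simp
qed

text \<open>The component in \<open>M n\<close> of the coefficient of \<open>h\<close> to the power
  \<open>j\<close>. These functionals are balanced, hence well defined on the tensor product, and
  take the place of a basis of \<open>K[h]\<close>.\<close>

definition coord :: "nat \<Rightarrow> nat \<Rightarrow> ((nat \<Rightarrow> 'm) \<times> (nat \<Rightarrow> 'a)) list set \<Rightarrow> 'm"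
  where "coord n j = tensor_lift (M n) (\<lambda>s p. coeff U p j \<odot>\<^bsub>M n\<^esub> s n)"

lemma coord_simps:
  shows coord_additive: "additive_map B (M n) (coord n j)"
    and coord_pure: "\<lbrakk>s \<in> carrier DM; p \<in> carrier U\<rbrakk> \<Longrightarrow> coord n j (pure s p) = coeff U p j \<odot>\<^bsub>M n\<^esub> s n"
proof -
  have b: "balanced_map K DM U (M n) (\<lambda>s p. coeff U p j \<odot>\<^bsub>M n\<^esub> s n)"
    by (rule balanced_mapI)
      (simp_all add: direct_sum_simps gr.smult_closed gr.smult_l_distr gr.smult_r_distr
        gr.smult_assoc[symmetric] R.m_comm)
  show "additive_map B (M n) (coord n j)"
    unfolding coord_def by (rule TF.tensor_lift_additive[OF gr.M.abelian_group_axioms b])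
  show "coord n j (pure s p) = coeff U p j \<odot>\<^bsub>M n\<^esub> s n" if "s \<in> carrier DM" "p \<in> carrier U"
    using TF.tensor_lift_cls[OF gr.M.abelian_group_axioms b, of "[(s, p)]"] that
    by (simp add: coord_def direct_sum_simps gr.smult_closed)
qed

lemmas coord_closed = additive_mapD(1)[OF coord_additive]

text \<open>A symbol of order \<open>n\<close> reaches the exponent \<open>i\<close> only through
  \<open>h\<close> to the power \<open>i - n\<close>. Thus each coefficient is a sum of the kind
  whose components \<open>qsum_unique\<close> determines.\<close>

lemma rees_coeff:
  assumes "b \<in> carrier B"
  shows "coeff V (rees b) i = qsum i (\<lambda>n. coord n (i - n) b)"
proof (rule TF.additive_map_tensor_eqI[OF abelian_group_axioms _ _ _ assms])
  show "additive_map B S (\<lambda>b. coeff V (rees b) i)"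
    by (auto simp: additive_map_def rees_closed rees_add)
  have "(\<lambda>n. Q n (coord n (i - n) b)) \<in> {..i} \<rightarrow> carrier S" if "b \<in> carrier B" for b
    using that by (auto simp: Q_closed coord_closed)
  note q = this
  have "qsum i (\<lambda>n. coord n (i - n) (b \<oplus>\<^bsub>B\<^esub> c)) =
      qsum i (\<lambda>n. coord n (i - n) b) \<oplus>\<^bsub>S\<^esub> qsum i (\<lambda>n. coord n (i - n) c)"
    if bc: "b \<in> carrier B" "c \<in> carrier B" for b c
  proof -
    have "Q n (coord n (i - n) (b \<oplus>\<^bsub>B\<^esub> c)) = Q n (coord n (i - n) b) \<oplus>\<^bsub>S\<^esub> Q n (coord n (i - n) c)" for n
      using bc by (simp add: additive_mapD(2)[OF coord_additive] Q_add coord_closed)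
    then show ?thesis using M.finsum_addf[OF q[OF bc(1)] q[OF bc(2)]] by simp
  qed
  then show "additive_map B S (\<lambda>b. qsum i (\<lambda>n. coord n (i - n) b))"
    unfolding additive_map_def using q by (blast intro: M.finsum_closed)
  show "coeff V (rees (pure s p)) i = qsum i (\<lambda>n. coord n (i - n) (pure s p))"
    if "s \<in> carrier DM" "p \<in> carrier U" for s p
  proof -
    \<comment> \<open>The central factor is moved to the right, which lets the convolution run over
      the order \<open>n\<close> of the symbol.\<close>
    have "coeff V (rees (pure s p)) i = (\<Oplus>\<^bsub>S\<^esub>n\<in>{..i}. Q n (s n) \<otimes>\<^bsub>S\<^esub> scal (coeff U p (i - n)))"
      using that by (simp add: rees_pure poly_scal_central symbol_poly_simps poly_scal_simps)
    also have "\<dots> = qsum i (\<lambda>n. coord n (i - n) (pure s p))"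
      by (rule M.finsum_cong)
        (use that in \<open>auto simp: coord_pure scal_mult Q_closed direct_sum_simps Q_smult gr.smult_closed
          simp_implies_def\<close>)
    finally show ?thesis .
  qed
qed

abbreviation "gen n j a \<equiv> pure (incl n a) (monom U \<one>\<^bsub>K\<^esub> j)"

lemma gen_closed: "a \<in> carrier (M n) \<Longrightarrow> gen n j a \<in> carrier B"
  by (simp add: pure_closed incl_simps)

lemma gen_additive: "additive_map (M n) B (gen n j)"
  by (auto simp: additive_map_def pure_simps incl_simps incl_add)

lemma gen_zero: "gen n j \<zero>\<^bsub>M n\<^esub> = \<zero>\<^bsub>B\<^esub>"
  by (rule additive_map_zero[OF gr.M.abelian_group_axioms LB.M.abelian_group_axioms gen_additive])

lemma rees_gen: "a \<in> carrier (M n) \<Longrightarrow> rees (gen n j a) = monom V (Q n a) (j + n)"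
  using US.monom_mult[of "\<one>\<^bsub>S\<^esub>" "Q n a" j n]
  by (simp add: rees_pure incl_simps poly_scal_monom symbol_poly_incl Q_closed del: US.monom_mult)

abbreviation "expansion N b \<equiv> (\<Oplus>\<^bsub>B\<^esub>n\<in>{..N}. \<Oplus>\<^bsub>B\<^esub>j\<in>{..N}. gen n j (coord n j b))"

lemma expansion_additive: "additive_map B B (expansion N)"
proof -
  have g: "gen n j (coord n j b) \<in> carrier B" if "b \<in> carrier B" for b n j
    using that by (simp add: gen_closed coord_closed)
  then have s: "(\<lambda>j. gen n j (coord n j b)) \<in> A \<rightarrow> carrier B" if "b \<in> carrier B" for b n A
    using that by blast
  have a: "gen n j (coord n j (b \<oplus>\<^bsub>B\<^esub> c)) = gen n j (coord n j b) \<oplus>\<^bsub>B\<^esub> gen n j (coord n j c)"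
    if "b \<in> carrier B" "c \<in> carrier B" for b c n j
    using that by (simp add: additive_mapD(2)[OF coord_additive] additive_mapD(2)[OF gen_additive] coord_closed)
  have i: "(\<Oplus>\<^bsub>B\<^esub>j\<in>{..N}. gen n j (coord n j (b \<oplus>\<^bsub>B\<^esub> c))) =
      (\<Oplus>\<^bsub>B\<^esub>j\<in>{..N}. gen n j (coord n j b)) \<oplus>\<^bsub>B\<^esub> (\<Oplus>\<^bsub>B\<^esub>j\<in>{..N}. gen n j (coord n j c))"
    if "b \<in> carrier B" "c \<in> carrier B" for b c n
    unfolding a[OF that] by (rule LB.M.finsum_addf) (use s that in auto)
  show ?thesis unfolding additive_map_def
  proof (intro conjI ballI)
    show "expansion N \<in> carrier B \<rightarrow> carrier B" using s by (intro Pi_I LB.M.finsum_closed) auto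
    show "expansion N (b \<oplus>\<^bsub>B\<^esub> c) = expansion N b \<oplus>\<^bsub>B\<^esub> expansion N c"
      if "b \<in> carrier B" "c \<in> carrier B" for b c
      unfolding i[OF that] by (rule LB.M.finsum_addf) (use s that in \<open>auto intro: LB.M.finsum_closed\<close>)
  qed
qed

lemma expansion_pure:
  assumes s: "s \<in> carrier DM" and p: "p \<in> carrier U" and N: "\<forall>n>N. s n = \<zero>\<^bsub>M n\<^esub>" "deg K p \<le> N"
  shows "expansion N (pure s p) = pure s p"
proof -
  have c: "coeff U p j \<odot>\<^bsub>U\<^esub> monom U \<one>\<^bsub>K\<^esub> j = monom U (coeff U p j) j" for j
    using p UK.monom_mult_smult[of "coeff U p j" "\<one>\<^bsub>K\<^esub>" j] by simp
  \<comment> \<open>The coefficient of \<open>p\<close>, which \<open>coord\<close> puts on the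
    symbol, is moved back across the tensor sign.\<close>
  have g: "gen n j (coord n j (pure s p)) = pure (incl n (s n)) (monom U (coeff U p j) j)" for n j
    using s p by (simp add: coord_pure incl_smult pure_balanced incl_simps direct_sum_simps c)
  have "pure (incl n (s n)) p = (\<Oplus>\<^bsub>B\<^esub>j\<in>{..N}. pure (incl n (s n)) (monom U (coeff U p j) j))" for n
  proof -
    have "pure (incl n (s n)) (\<Oplus>\<^bsub>U\<^esub>j\<in>{..N}. monom U (coeff U p j) j) =
        (\<Oplus>\<^bsub>B\<^esub>j\<in>{..N}. pure (incl n (s n)) (monom U (coeff U p j) j))"
      by (rule additive_map_finsum[OF UK.P.abelian_group_axioms LB.M.abelian_group_axioms])
        (use s p in \<open>auto intro!: additive_pure incl_simps simp: direct_sum_simps\<close>)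
    then show ?thesis using UK.up_repr_le[OF N(2) p] by simp
  qed
  then have "expansion N (pure s p) = (\<Oplus>\<^bsub>B\<^esub>n\<in>{..N}. pure (incl n (s n)) p)" by (simp add: g)
  also have "\<dots> = pure (\<Oplus>\<^bsub>DM\<^esub>n\<in>{..N}. incl n (s n)) p"
    by (rule additive_map_finsum[OF DM.M.abelian_group_axioms LB.M.abelian_group_axioms, symmetric])
      (use s p in \<open>auto intro!: additive_pure incl_simps simp: direct_sum_simps\<close>)
  finally show ?thesis by (simp only: direct_sum_expand[OF s N(1), symmetric])
qed

text \<open>Stated for all sufficiently large \<open>N\<close>, since the bounds for the pure
  tensors of a list must be joined by a maximum in the induction.\<close>

lemma expansion_eq:
  assumes "b \<in> carrier B" shows "\<exists>N0. \<forall>N\<ge>N0. expansion N b = b"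
proof -
  obtain u where u: "u \<in> formal_sums DM U" "b = tensor_cls K DM U u" using assms by (auto simp: TF.tensor_simps)
  have "\<exists>N0. \<forall>N\<ge>N0. expansion N (tensor_cls K DM U u) = tensor_cls K DM U u" using u(1)
  proof (induction u)
    case Nil
    show ?case using additive_map_zero[OF LB.M.abelian_group_axioms LB.M.abelian_group_axioms expansion_additive]
      by (simp add: TF.tensor_simps)
  next
    case (Cons q u)
    obtain s p where q: "q = (s, p)" by fastforce
    have c: "s \<in> carrier DM" "p \<in> carrier U" "u \<in> formal_sums DM U" using Cons by (auto simp: q)
    obtain N0 where N0: "\<forall>N\<ge>N0. expansion N (tensor_cls K DM U u) = tensor_cls K DM U u"
      using Cons.IH[OF c(3)] by blast
    obtain N1 where N1: "\<forall>n>N1. s n = \<zero>\<^bsub>M n\<^esub>" using direct_sum_bound[OF c(1)] by blast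
    have e: "tensor_cls K DM U (q # u) = pure s p \<oplus>\<^bsub>B\<^esub> tensor_cls K DM U u"
      using c by (simp add: TF.tensor_simps q)
    have u: "tensor_cls K DM U u \<in> carrier B" using c by (simp add: TF.tensor_simps)
    have "expansion N (tensor_cls K DM U (q # u)) = tensor_cls K DM U (q # u)"
      if "N \<ge> max N0 (max N1 (deg K p))" for N
      unfolding e additive_mapD(2)[OF expansion_additive pure_closed[OF c(1,2)] u]
      using expansion_pure[OF c(1,2), of N] N0 N1 that by simp
    then show ?case by blast
  qed
  then show ?thesis using u by simp
qed

lemma coord_eqI:
  assumes "b \<in> carrier B" "\<And>n j. coord n j b = \<zero>\<^bsub>M n\<^esub>" shows "b = \<zero>\<^bsub>B\<^esub>"
proof -
  obtain N where "expansion N b = b" using expansion_eq[OF assms(1)] by blast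
  then show ?thesis by (simp add: assms(2) gen_zero)
qed

lemma rees_inj: "inj_on rees (carrier B)"
proof (rule inj_onI)
  fix b c assume bc: "b \<in> carrier B" "c \<in> carrier B" "rees b = rees c"
  let ?d = "b \<ominus>\<^bsub>B\<^esub> c"
  have d: "?d \<in> carrier B" using bc by simp
  have "rees ?d = \<zero>\<^bsub>V\<^esub>"
    using additive_map_minus[OF LB.M.abelian_group_axioms US.P.abelian_group_axioms rees_additive bc(1,2)]
      bc rees_closed by (simp add: US.P.minus_eq_zero_iff)
  then have "qsum i (\<lambda>n. coord n (i - n) ?d) = \<zero>\<^bsub>S\<^esub>" for i using rees_coeff[OF d, of i] by simp
  from qsum_unique[OF _ this] d have "coord n (i - n) ?d = \<zero>\<^bsub>M n\<^esub>" if "n \<le> i" for n i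
    using that by (simp add: coord_closed)
  \<comment> \<open>Any pair of order \<open>n\<close> and power \<open>j\<close> occurs, namely in
    the coefficient at \<open>n + j\<close>.\<close>
  from this[of _ "_ + _"] have "coord n j ?d = \<zero>\<^bsub>M n\<^esub>" for n j by (metis add_diff_cancel_left' le_add1)
  then have "?d = \<zero>\<^bsub>B\<^esub>" by (rule coord_eqI[OF d])
  then show "b = c" using bc by (simp add: LB.M.minus_eq_zero_iff)
qed

lemma rees_image: "rees ` carrier B = {P \<in> carrier V. \<forall>i. coeff V P i \<in> W i}"
proof (intro equalityI subsetI)
  fix P assume P: "P \<in> {P \<in> carrier V. \<forall>i. coeff V P i \<in> W i}"
  then have Pc: "P \<in> carrier V" by simp
  have "\<forall>i. \<exists>a. (\<forall>k. a k \<in> carrier (M k)) \<and> coeff V P i = qsum i a" using P qsum_exists by blast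
  then obtain a where a: "\<And>i k. a i k \<in> carrier (M k)" "\<And>i. coeff V P i = qsum i (a i)" by metis
  let ?N = "deg S P"
  \<comment> \<open>A component of order \<open>k\<close> of the coefficient at \<open>i\<close>
    needs the remaining factor \<open>h\<close> to the power \<open>i - k\<close> to land on the
    exponent \<open>i\<close>.\<close>
  let ?t = "\<lambda>i. \<Oplus>\<^bsub>B\<^esub>k\<in>{..i}. gen k (i - k) (a i k)"
  let ?b = "\<Oplus>\<^bsub>B\<^esub>i\<in>{..?N}. ?t i"
  have t: "?t i \<in> carrier B" for i using a by (intro LB.M.finsum_closed) (auto simp: gen_closed)
  have "rees (?t i) = monom V (coeff V P i) i" for i
  proof -
    have "rees (?t i) = (\<Oplus>\<^bsub>V\<^esub>k\<in>{..i}. rees (gen k (i - k) (a i k)))"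
      by (rule additive_map_finsum[OF LB.M.abelian_group_axioms US.P.abelian_group_axioms rees_additive])
        (use a in \<open>auto simp: gen_closed\<close>)
    also have "\<dots> = (\<Oplus>\<^bsub>V\<^esub>k\<in>{..i}. monom V (Q k (a i k)) i)"
      by (rule US.P.finsum_cong) (use a in \<open>auto simp: rees_gen Q_closed simp_implies_def\<close>)
    also have "\<dots> = monom V (qsum i (a i)) i"
      by (rule additive_map_finsum[OF abelian_group_axioms US.P.abelian_group_axioms, symmetric])
        (use a in \<open>auto simp: additive_map_def Q_closed\<close>)
    finally show ?thesis using a by simp
  qed
  moreover have "rees ?b = (\<Oplus>\<^bsub>V\<^esub>i\<in>{..?N}. rees (?t i))"
    by (rule additive_map_finsum[OF LB.M.abelian_group_axioms US.P.abelian_group_axioms rees_additive])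
      (use t in auto)
  ultimately have r: "rees ?b = P" using US.up_repr[OF Pc] by simp
  have "?b \<in> carrier B" using t by (intro LB.M.finsum_closed) auto
  with r show "P \<in> rees ` carrier B" by (rule image_eqI[OF HOL.sym])
qed (auto simp: rees_closed rees_coeff_mem)

subsection \<open>The filtration\<close>

text \<open>The bound is exclusive, as in \<open>symb_h_below\<close>: step \<open>n\<close> of the
  filtration is \<open>below (Suc n)\<close>, and for two symbols of order 0 the remainder term lies
  in \<open>below 0\<close>, the empty sum.\<close>

definition below :: "nat \<Rightarrow> ((nat \<Rightarrow> 'm) \<times> (nat \<Rightarrow> 'a)) list set set"
  where "below n = tensor_cls K DM U `
    {l \<in> formal_sums DM U. \<forall>(s, p)\<in>set l. \<forall>k\<ge>n. s k = \<zero>\<^bsub>M k\<^esub>}"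

lemma below_carrier: "below n \<subseteq> carrier B"
  by (auto simp: below_def TF.tensor_simps)

lemma below_zero: "\<zero>\<^bsub>B\<^esub> \<in> below n"
  by (auto simp: below_def TF.tensor_simps intro!: image_eqI[of _ _ "[]"])

lemma below_add:
  assumes "x \<in> below n" "y \<in> below n" shows "x \<oplus>\<^bsub>B\<^esub> y \<in> below n"
proof -
  obtain u v where uv: "u \<in> formal_sums DM U" "\<forall>(s, p)\<in>set u. \<forall>k\<ge>n. s k = \<zero>\<^bsub>M k\<^esub>" "x = tensor_cls K DM U u"
      "v \<in> formal_sums DM U" "\<forall>(s, p)\<in>set v. \<forall>k\<ge>n. s k = \<zero>\<^bsub>M k\<^esub>" "y = tensor_cls K DM U v"
    using assms unfolding below_def by blast
  then show ?thesis unfolding below_def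
    by (intro image_eqI[of _ _ "u @ v"]) (auto simp: TF.tensor_simps)
qed

lemma below_finsum: "(\<And>i. i \<in> I \<Longrightarrow> f i \<in> below n) \<Longrightarrow> finsum B f I \<in> below n"
  by (rule LB.M.finsum_mem[OF below_zero below_add below_carrier])

lemma below_pure: "\<lbrakk>s \<in> carrier DM; p \<in> carrier U; \<forall>k\<ge>n. s k = \<zero>\<^bsub>M k\<^esub>\<rbrakk> \<Longrightarrow> pure s p \<in> below n"
  unfolding below_def by (intro image_eqI[of _ _ "[(s, p)]"]) auto

lemma below_gen: "\<lbrakk>a \<in> carrier (M k); k < n\<rbrakk> \<Longrightarrow> gen k j a \<in> below n"
  by (rule below_pure) (auto simp: incl_simps, simp add: direct_sum_incl_def)

lemma below_coord:
  assumes "b \<in> below n" "n \<le> k" shows "coord k j b = \<zero>\<^bsub>M k\<^esub>"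
proof -
  obtain u where u: "u \<in> formal_sums DM U" "\<forall>(s, p)\<in>set u. \<forall>k\<ge>n. s k = \<zero>\<^bsub>M k\<^esub>" "b = tensor_cls K DM U u"
    using assms unfolding below_def by blast
  have "coord k j (tensor_cls K DM U u) = \<zero>\<^bsub>M k\<^esub>" using u(1,2)
  proof (induction u)
    case Nil
    show ?case using additive_map_zero[OF LB.M.abelian_group_axioms gr.M.abelian_group_axioms coord_additive]
      by (simp add: TF.tensor_simps)
  next
    case (Cons q u)
    obtain s p where q: "q = (s, p)" by fastforce
    have c: "s \<in> carrier DM" "p \<in> carrier U" "u \<in> formal_sums DM U" using Cons by (auto simp: q)
    have u: "tensor_cls K DM U u \<in> carrier B" using c by (simp add: TF.tensor_simps)
    have "tensor_cls K DM U (q # u) = pure s p \<oplus>\<^bsub>B\<^esub> tensor_cls K DM U u"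
      using c by (simp add: TF.tensor_simps q)
    then show ?case using Cons c assms(2) u
      by (simp add: additive_mapD(2)[OF coord_additive] pure_closed coord_pure q gr.smult_zero_right)
  qed
  then show ?thesis using u by simp
qed

text \<open>Translates the filtration into a condition on coefficients, so that its compatibility
  with products and scalars becomes that of \<open>W\<close>.\<close>

lemma below_iff:
  assumes b: "b \<in> carrier B"
  shows "b \<in> below (Suc n) \<longleftrightarrow> (\<forall>i. coeff V (rees b) i \<in> W n)"
proof
  assume "b \<in> below (Suc n)"
  then have z: "coord k j b = \<zero>\<^bsub>M k\<^esub>" if "n < k" for k j using below_coord that by simp
  have "Q k (coord k j b) \<in> W n" for k j
    using z[of k j] W_le[of k n] Q_mem[of "coord k j b" k] b
    by (cases "k \<le> n") (simp_all add: coord_closed Q_zero W_simps)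
  then show "\<forall>i. coeff V (rees b) i \<in> W n" by (auto simp: rees_coeff[OF b] intro: W_finsum)
next
  assume w: "\<forall>i. coeff V (rees b) i \<in> W n"
  \<comment> \<open>The coordinate in question is a component of the coefficient at
    \<open>k + j\<close>; since that coefficient lies in \<open>W n\<close>, its components of order
    above \<open>n\<close> vanish.\<close>
  have z: "coord k j b = \<zero>\<^bsub>M k\<^esub>" if "n < k" for k j
    using qsum_filtration[of "k + j" "\<lambda>m. coord m (k + j - m) b" n k] w that
    by (simp add: rees_coeff[OF b] coord_closed[OF b])
  obtain N where N: "expansion N b = b" using expansion_eq[OF b] by blast
  have "gen k j (coord k j b) \<in> below (Suc n)" for k j
    using z[of k j] below_gen[of "coord k j b" k "Suc n"] coord_closed[OF b]
    by (cases "k \<le> n") (simp_all add: gen_zero below_zero)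
  then have "expansion N b \<in> below (Suc n)" by (intro below_finsum)
  then show "b \<in> below (Suc n)" using N by simp
qed

subsection \<open>The formal star product\<close>

text \<open>Restricted to the carrier in both arguments, because \<open>is_formal_star\<close> asks
  for extensional functions.\<close>

definition star :: "((nat \<Rightarrow> 'm) \<times> (nat \<Rightarrow> 'a)) list set \<Rightarrow> ((nat \<Rightarrow> 'm) \<times> (nat \<Rightarrow> 'a)) list set \<Rightarrow>
    ((nat \<Rightarrow> 'm) \<times> (nat \<Rightarrow> 'a)) list set"
  where "star = (\<lambda>x\<in>carrier B. \<lambda>y\<in>carrier B. inv_into (carrier B) rees (rees x \<otimes>\<^bsub>V\<^esub> rees y))"

lemma star_simps:
  assumes "x \<in> carrier B" "y \<in> carrier B"
  shows "star x y \<in> carrier B" "rees (star x y) = rees x \<otimes>\<^bsub>V\<^esub> rees y"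
proof -
  have "coeff V (rees x) j \<otimes>\<^bsub>S\<^esub> coeff V (rees y) (i - j) \<in> W i" if "j \<le> i" for i j
    using W_mult[OF rees_coeff_mem[OF assms(1), of j] rees_coeff_mem[OF assms(2), of "i - j"]] that by simp
  then have "coeff V (rees x \<otimes>\<^bsub>V\<^esub> rees y) i \<in> W i" for i
    using assms by (simp add: rees_closed) (auto intro: W_finsum)
  then have "rees x \<otimes>\<^bsub>V\<^esub> rees y \<in> rees ` carrier B"
    unfolding rees_image using assms by (simp add: rees_closed del: US.coeff_mult)
  then show "star x y \<in> carrier B" "rees (star x y) = rees x \<otimes>\<^bsub>V\<^esub> rees y"
    using assms by (auto simp: star_def inv_into_into f_inv_into_f)
qed

lemma rees_eqI: "\<lbrakk>rees x = rees y; x \<in> carrier B; y \<in> carrier B\<rbrakk> \<Longrightarrow> x = y"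
  using rees_inj by (auto dest: inj_onD)

definition star_unit :: "((nat \<Rightarrow> 'm) \<times> (nat \<Rightarrow> 'a)) list set"
  where "star_unit = inv_into (carrier B) rees \<one>\<^bsub>V\<^esub>"

lemma star_unit_simps: "star_unit \<in> carrier B" "rees star_unit = \<one>\<^bsub>V\<^esub>"
proof -
  have "\<one>\<^bsub>V\<^esub> \<in> rees ` carrier B" unfolding rees_image using W_one by (simp add: W_simps)
  then show "star_unit \<in> carrier B" "rees star_unit = \<one>\<^bsub>V\<^esub>"
    unfolding star_unit_def by (auto intro: inv_into_into f_inv_into_f)
qed

abbreviation "SA \<equiv> B\<lparr>mult := star, one := star_unit\<rparr>"

text \<open>All laws hold in \<open>S[h]\<close> and are pulled back along the injective
  \<open>rees\<close>; bilinearity over \<open>K[h]\<close> comes from the centrality of the scalar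
  polynomials.\<close>

lemma star_algebra: "assoc_algebra U SA"
proof -
  have L: "left_module U SA"
    by (rule LB.left_module_surj[where p = "\<lambda>x. x"]) simp_all
  interpret L: left_module U SA by (rule L)
  have d: "star (x \<oplus>\<^bsub>B\<^esub> y) z = star x z \<oplus>\<^bsub>B\<^esub> star y z" "star z (x \<oplus>\<^bsub>B\<^esub> y) = star z x \<oplus>\<^bsub>B\<^esub> star z y"
    if "x \<in> carrier B" "y \<in> carrier B" "z \<in> carrier B" for x y z
    using that
    by (rule_tac rees_eqI, simp_all add: star_simps rees_add rees_closed US.P.l_distr US.P.r_distr)+
  have assoc: "star (star x y) z = star x (star y z)"
    if "x \<in> carrier B" "y \<in> carrier B" "z \<in> carrier B" for x y z
    using that by (intro rees_eqI) (simp_all add: star_simps rees_closed US.P.m_assoc)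
  have unit: "star star_unit x = x" "star x star_unit = x" if "x \<in> carrier B" for x
    using that by (rule_tac rees_eqI, simp_all add: star_simps star_unit_simps rees_closed)+
  have "ring SA"
  proof (rule ringI[OF L.M.abelian_group_axioms])
    show "monoid SA"
      by (rule monoidI) (simp_all add: star_simps star_unit_simps assoc unit)
  qed (simp_all add: d)
  moreover have "star (p \<odot>\<^bsub>B\<^esub> x) y = p \<odot>\<^bsub>B\<^esub> star x y" "star x (p \<odot>\<^bsub>B\<^esub> y) = p \<odot>\<^bsub>B\<^esub> star x y"
    if "p \<in> carrier U" "x \<in> carrier B" "y \<in> carrier B" for p x y
  proof -
    show "star (p \<odot>\<^bsub>B\<^esub> x) y = p \<odot>\<^bsub>B\<^esub> star x y"
      using that by (intro rees_eqI)
        (simp_all add: star_simps rees_smult LB.smult_closed rees_closed poly_scal_simps US.P.m_assoc)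
    have "rees x \<otimes>\<^bsub>V\<^esub> (poly_scal p \<otimes>\<^bsub>V\<^esub> rees y) = poly_scal p \<otimes>\<^bsub>V\<^esub> (rees x \<otimes>\<^bsub>V\<^esub> rees y)"
      using that poly_scal_central[of p "rees x"]
      by (simp add: rees_closed poly_scal_simps US.P.m_assoc[symmetric])
    then show "star x (p \<odot>\<^bsub>B\<^esub> y) = p \<odot>\<^bsub>B\<^esub> star x y"
      using that by (intro rees_eqI) (simp_all add: star_simps rees_smult LB.smult_closed)
  qed
  ultimately show ?thesis
    using module_of_left_module[OF UK.P.is_cring L]
    by (simp add: assoc_algebra_def assoc_algebra_axioms_def)
qed

lemma star_filtered: "filtered_algebra U SA (\<lambda>n. below (Suc n))"
proof -
  interpret SA: assoc_algebra U SA by (rule star_algebra)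
  have sm: "p \<odot>\<^bsub>B\<^esub> x \<in> below (Suc n)" if "p \<in> carrier U" "x \<in> below (Suc n)" for p x n
  proof -
    have x: "x \<in> carrier B" using that below_carrier by blast
    have w: "coeff V (rees x) i \<in> W n" for i using that below_iff[OF x] by blast
    have "scal (coeff U p j) \<otimes>\<^bsub>S\<^esub> coeff V (rees x) i \<in> W n" for i j
      using that w[of i] W_simps(1)[OF w[of i]] by (simp add: scal_mult W_simps(5))
    then have "coeff V (rees (p \<odot>\<^bsub>B\<^esub> x)) i \<in> W n" for i
      using that x by (simp add: rees_smult poly_scal_simps rees_closed) (auto intro: W_finsum)
    then show ?thesis using that x by (simp add: below_iff LB.smult_closed)
  qed
  have sub: "submodule (below (Suc n)) U SA" for n
  proof (rule SA.submoduleI)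
    fix x assume x: "x \<in> below (Suc n)"
    then have xc: "x \<in> carrier B" using below_carrier by blast
    have "\<ominus>\<^bsub>SA\<^esub> x = \<ominus>\<^bsub>B\<^esub> x" by (simp add: a_inv_def)
    moreover have "\<ominus>\<^bsub>B\<^esub> x = (\<ominus>\<^bsub>U\<^esub> \<one>\<^bsub>U\<^esub>) \<odot>\<^bsub>B\<^esub> x"
      using xc LB.smult_minus_left[of "\<one>\<^bsub>U\<^esub>" x] LB.smult_one[of x] by simp
    ultimately show "\<ominus>\<^bsub>SA\<^esub> x \<in> below (Suc n)" using sm[of "\<ominus>\<^bsub>U\<^esub> \<one>\<^bsub>U\<^esub>" x] x by simp
  qed (use below_carrier in \<open>auto simp: below_zero below_add sm\<close>)
  have mono: "below (Suc n) \<subseteq> below (Suc (Suc n))" for n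
    unfolding below_def by (intro image_mono) auto
  have ex: "(\<Union>n. below (Suc n)) = carrier SA"
  proof (intro equalityI subsetI)
    fix b assume "b \<in> carrier SA"
    then have b: "b \<in> carrier B" by simp
    \<comment> \<open>The coefficient at \<open>i\<close> lies in \<open>W i\<close>, so the degree
      of the polynomial bounds the orders of all its coefficients as well.\<close>
    let ?n = "deg S (rees b)"
    have "coeff V (rees b) i \<in> W ?n" for i
    proof (cases "i \<le> ?n")
      case True then show ?thesis using rees_coeff_mem[OF b] W_le by blast
    next
      case False then show ?thesis
        using US.deg_aboveD[of "rees b" i] rees_closed[OF b] by (simp add: W_simps)
    qed
    then have "b \<in> below (Suc ?n)" using below_iff[OF b] by blast
    then show "b \<in> (\<Union>n. below (Suc n))" by blast
  qed (use below_carrier in auto)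
  have one: "star_unit \<in> below (Suc 0)"
    using W_one by (simp add: below_iff star_unit_simps W_simps)
  have mult: "star x y \<in> below (Suc (n + m))" if "x \<in> below (Suc n)" "y \<in> below (Suc m)" for x y n m
  proof -
    have xy: "x \<in> carrier B" "y \<in> carrier B" using that below_carrier by blast+
    then have "coeff V (rees x) i \<otimes>\<^bsub>S\<^esub> coeff V (rees y) j \<in> W (n + m)" for i j
      using that below_iff W_mult by blast
    then have "coeff V (rees (star x y)) i \<in> W (n + m)" for i
      using xy by (simp add: star_simps rees_closed) (auto intro: W_finsum)
    then show ?thesis using xy by (simp add: below_iff star_simps)
  qed
  show ?thesis
    by (intro filtered_algebra.intro filtered_algebra_axioms.intro star_algebra sub mono ex)
      (simp_all add: one mult)
qed

lemma star_linear:
  assumes "x \<in> carrier B"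
  shows "lin_map U B B (\<lambda>y. star x y)" "lin_map U B B (\<lambda>y. star y x)"
proof -
  interpret SA: assoc_algebra U SA by (rule star_algebra)
  show "lin_map U B B (\<lambda>y. star x y)" "lin_map U B B (\<lambda>y. star y x)"
    using SA.r_distr SA.l_distr SA.smult_mult_left SA.smult_mult_right assms
    by (auto simp: lin_map_def star_simps)
qed

abbreviation "hom_incl n a \<equiv> pure (incl n a) \<one>\<^bsub>U\<^esub>"

lemma hom_incl_closed: "a \<in> carrier (M n) \<Longrightarrow> hom_incl n a \<in> carrier B"
  by (simp add: pure_closed incl_simps)

text \<open>The tensor of \<open>s\<close> and \<open>p\<close> is \<open>p\<close> times that of
  \<open>s\<close> and the unit, and \<open>s\<close> is a finite sum of homogeneous parts. This is
  the uniqueness of bilinear extensions.\<close>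

lemma linear_eqI:
  assumes f: "lin_map U B B f" and g: "lin_map U B B g"
    and eq: "\<And>n a. a \<in> carrier (M n) \<Longrightarrow> f (hom_incl n a) = g (hom_incl n a)" and b: "b \<in> carrier B"
  shows "f b = g b"
proof (rule TF.additive_map_tensor_eqI[OF LB.M.abelian_group_axioms lin_map_additive[OF f]
      lin_map_additive[OF g] _ b])
  fix s p assume sp: "s \<in> carrier DM" "p \<in> carrier U"
  obtain N where N: "\<forall>n>N. s n = \<zero>\<^bsub>M n\<^esub>" using direct_sum_bound[OF sp(1)] by blast
  have "pure (\<Oplus>\<^bsub>DM\<^esub>n\<in>{..N}. incl n (s n)) \<one>\<^bsub>U\<^esub> = (\<Oplus>\<^bsub>B\<^esub>n\<in>{..N}. hom_incl n (s n))"
    by (rule additive_map_finsum[OF DM.M.abelian_group_axioms LB.M.abelian_group_axioms])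
      (use sp in \<open>auto intro!: additive_pure incl_simps simp: direct_sum_simps\<close>)
  then have s: "pure s \<one>\<^bsub>U\<^esub> = (\<Oplus>\<^bsub>B\<^esub>n\<in>{..N}. hom_incl n (s n))"
    by (simp only: direct_sum_expand[OF sp(1) N, symmetric])
  have c: "(\<lambda>n. hom_incl n (s n)) \<in> {..N} \<rightarrow> carrier B"
    using sp by (auto simp: hom_incl_closed direct_sum_simps)
  have "f (pure s \<one>\<^bsub>U\<^esub>) = (\<Oplus>\<^bsub>B\<^esub>n\<in>{..N}. f (hom_incl n (s n)))"
    unfolding s by (rule additive_map_finsum[OF LB.M.abelian_group_axioms LB.M.abelian_group_axioms
          lin_map_additive[OF f] c])
  also have "\<dots> = (\<Oplus>\<^bsub>B\<^esub>n\<in>{..N}. g (hom_incl n (s n)))"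
    using sp eq by (simp add: direct_sum_simps)
  also have "\<dots> = g (pure s \<one>\<^bsub>U\<^esub>)"
    unfolding s by (rule additive_map_finsum[OF LB.M.abelian_group_axioms LB.M.abelian_group_axioms
          lin_map_additive[OF g] c, symmetric])
  finally have "f (pure s \<one>\<^bsub>U\<^esub>) = g (pure s \<one>\<^bsub>U\<^esub>)" .
  moreover have "pure s p = p \<odot>\<^bsub>B\<^esub> pure s \<one>\<^bsub>U\<^esub>" using sp by (simp add: pure_smult)
  ultimately show "f (pure s p) = g (pure s p)"
    using sp lin_mapD(3)[OF f] lin_mapD(3)[OF g] by (simp add: pure_closed)
qed

text \<open>Under \<open>rees\<close> the summand with index \<open>k\<close> becomes a monomial of
  exponent \<open>k + (n + m - k)\<close>. The right-hand side therefore collapses to one monomial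
  with coefficient \<open>qsum (n + m) c\<close>, just as the product of the monomials of
  \<open>a\<close> and \<open>b\<close> does.\<close>

lemma star_incl:
  assumes a: "a \<in> carrier (M n)" and b: "b \<in> carrier (M m)"
    and c: "\<And>k. k \<le> n + m \<Longrightarrow> c k \<in> carrier (M k)" and eq: "Q n a \<otimes>\<^bsub>S\<^esub> Q m b = qsum (n + m) c"
  shows "star (hom_incl n a) (hom_incl m b) = (\<Oplus>\<^bsub>B\<^esub>k\<in>{0..n + m}.
    (monom U \<one>\<^bsub>K\<^esub> 1 [^]\<^bsub>U\<^esub> k) \<odot>\<^bsub>B\<^esub> hom_incl (n + m - k) (c (n + m - k)))"
proof (rule rees_eqI)
  let ?N = "n + m"
  have one: "hom_incl k x = gen k 0 x" for k x by simp
  have h: "(monom U \<one>\<^bsub>K\<^esub> 1 [^]\<^bsub>U\<^esub> k) \<odot>\<^bsub>B\<^esub> hom_incl (?N - k) (c (?N - k)) = gen (?N - k) k (c (?N - k))"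
    if "k \<le> ?N" for k
    using that c by (simp add: UK.monom_pow pure_smult incl_simps R.nat_pow_one)
  then have e: "(\<Oplus>\<^bsub>B\<^esub>k\<in>{0..?N}. (monom U \<one>\<^bsub>K\<^esub> 1 [^]\<^bsub>U\<^esub> k) \<odot>\<^bsub>B\<^esub> hom_incl (?N - k) (c (?N - k))) =
      (\<Oplus>\<^bsub>B\<^esub>k\<in>{0..?N}. gen (?N - k) k (c (?N - k)))"
    by (intro LB.M.finsum_cong) (use c in \<open>auto simp: gen_closed simp_implies_def\<close>)
  show "star (hom_incl n a) (hom_incl m b) \<in> carrier B"
    using a b by (simp add: star_simps hom_incl_closed)
  show "(\<Oplus>\<^bsub>B\<^esub>k\<in>{0..?N}. (monom U \<one>\<^bsub>K\<^esub> 1 [^]\<^bsub>U\<^esub> k) \<odot>\<^bsub>B\<^esub> hom_incl (?N - k) (c (?N - k))) \<in> carrier B"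
    unfolding e by (rule LB.M.finsum_closed) (use c in \<open>auto simp: gen_closed\<close>)
  have "rees (\<Oplus>\<^bsub>B\<^esub>k\<in>{0..?N}. gen (?N - k) k (c (?N - k))) =
      (\<Oplus>\<^bsub>V\<^esub>k\<in>{0..?N}. rees (gen (?N - k) k (c (?N - k))))"
    by (rule additive_map_finsum[OF LB.M.abelian_group_axioms US.P.abelian_group_axioms rees_additive])
      (use c in \<open>auto simp: gen_closed\<close>)
  also have "\<dots> = (\<Oplus>\<^bsub>V\<^esub>k\<in>{0..?N}. monom V (Q (?N - k) (c (?N - k))) ?N)"
    by (rule US.P.finsum_cong) (use c in \<open>auto simp: rees_gen Q_closed simp_implies_def\<close>)
  \<comment> \<open>Reindexed by the order \<open>n + m - k\<close> instead of the power of
    \<open>h\<close>.\<close>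
  also have "\<dots> = finsum V (\<lambda>k. monom V (Q k (c k)) ?N) ((\<lambda>k. ?N - k) ` {0..?N})"
    by (rule US.P.finsum_reindex[symmetric]) (use c in \<open>auto simp: Q_closed inj_on_def\<close>)
  also have "(\<lambda>k. ?N - k) ` {0..?N} = {..?N}"
  proof (intro equalityI subsetI)
    fix i assume "i \<in> {..?N}"
    then have "i = ?N - (?N - i)" "?N - i \<in> {0..?N}" by simp_all
    then show "i \<in> (\<lambda>k. ?N - k) ` {0..?N}" by (rule image_eqI)
  qed auto
  also have "(\<Oplus>\<^bsub>V\<^esub>k\<in>{..?N}. monom V (Q k (c k)) ?N) = monom V (qsum ?N c) ?N"
    by (rule additive_map_finsum[OF abelian_group_axioms US.P.abelian_group_axioms, symmetric])
      (use c in \<open>auto simp: additive_map_def Q_closed\<close>)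
  also have "\<dots> = rees (star (hom_incl n a) (hom_incl m b))"
    using a b US.monom_mult[of "Q n a" "Q m b" n m] unfolding eq[symmetric] one
    by (simp add: star_simps gen_closed rees_gen Q_closed del: US.monom_mult UK.monom_one)
  finally show "rees (star (hom_incl n a) (hom_incl m b)) =
      rees (\<Oplus>\<^bsub>B\<^esub>k\<in>{0..?N}. (monom U \<one>\<^bsub>K\<^esub> 1 [^]\<^bsub>U\<^esub> k) \<odot>\<^bsub>B\<^esub> hom_incl (?N - k) (c (?N - k)))"
    unfolding e by simp
qed

end

section \<open>Differential operators\<close>

text \<open>Inverses are defined by a search in the carrier, so it has to be checked that shrinking
  the carrier does not change them.\<close>

lemma (in left_module) submodule_minus_eq:
  assumes N: "left_submodule R M N" and x: "x \<in> N" "y \<in> N"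
  shows "x \<ominus>\<^bsub>M\<lparr>carrier := N\<rparr>\<^esub> y = x \<ominus>\<^bsub>M\<^esub> y"
proof -
  interpret N: left_module R "M\<lparr>carrier := N\<rparr>" by (rule left_module_submodule[OF N])
  have "\<ominus>\<^bsub>M\<lparr>carrier := N\<rparr>\<^esub> y = \<ominus>\<^bsub>M\<^esub> y"
    by (rule N.M.minus_equality)
      (use x left_submodule_neg[OF N x(2)] N in \<open>auto simp: left_submodule_def M.l_neg\<close>)
  then show ?thesis by (simp add: a_minus_def)
qed

section \<open>The algebra of scalar-linear endomorphisms\<close>

context dga_module
begin

abbreviation "End \<equiv> scalar_linear_maps D M M"

lemma End_mem_iff: "f \<in> carrier End \<longleftrightarrow> f \<in> extensional (carrier M) \<and> f \<in> carrier M \<rightarrow> carrier M \<and>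
    (\<forall>x\<in>carrier M. \<forall>y\<in>carrier M. f (x \<oplus>\<^bsub>M\<^esub> y) = f x \<oplus>\<^bsub>M\<^esub> f y) \<and>
    (\<forall>k\<in>carrier Sc. \<forall>x\<in>carrier M. f ((k \<odot>\<^bsub>W\<^esub> \<one>\<^bsub>W\<^esub>) \<odot>\<^bsub>M\<^esub> x) = (k \<odot>\<^bsub>W\<^esub> \<one>\<^bsub>W\<^esub>) \<odot>\<^bsub>M\<^esub> f x)"
  by (simp add: scalar_linear_maps_def lin_map_def)

lemma End_simps:
  assumes "f \<in> carrier End" "x \<in> carrier M"
  shows "f x \<in> carrier M" "y \<in> carrier M \<Longrightarrow> f (x \<oplus>\<^bsub>M\<^esub> y) = f x \<oplus>\<^bsub>M\<^esub> f y"
    "k \<in> carrier Sc \<Longrightarrow> f ((k \<odot>\<^bsub>W\<^esub> \<one>\<^bsub>W\<^esub>) \<odot>\<^bsub>M\<^esub> x) = (k \<odot>\<^bsub>W\<^esub> \<one>\<^bsub>W\<^esub>) \<odot>\<^bsub>M\<^esub> f x"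
  using assms by (auto simp: End_mem_iff)

lemma End_memI:
  assumes "f \<in> extensional (carrier M)" "\<And>x. x \<in> carrier M \<Longrightarrow> f x \<in> carrier M"
    "\<And>x y. \<lbrakk>x \<in> carrier M; y \<in> carrier M\<rbrakk> \<Longrightarrow> f (x \<oplus>\<^bsub>M\<^esub> y) = f x \<oplus>\<^bsub>M\<^esub> f y"
    "\<And>k x. \<lbrakk>k \<in> carrier Sc; x \<in> carrier M\<rbrakk> \<Longrightarrow>
      f ((k \<odot>\<^bsub>W\<^esub> \<one>\<^bsub>W\<^esub>) \<odot>\<^bsub>M\<^esub> x) = (k \<odot>\<^bsub>W\<^esub> \<one>\<^bsub>W\<^esub>) \<odot>\<^bsub>M\<^esub> f x"
  shows "f \<in> carrier End"
  using assms by (simp add: End_mem_iff)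

lemma End_apply:
  "\<zero>\<^bsub>End\<^esub> = (\<lambda>e\<in>carrier M. \<zero>\<^bsub>M\<^esub>)" "f \<oplus>\<^bsub>End\<^esub> g = (\<lambda>e\<in>carrier M. f e \<oplus>\<^bsub>M\<^esub> g e)"
  "k \<odot>\<^bsub>End\<^esub> f = (\<lambda>e\<in>carrier M. (k \<odot>\<^bsub>W\<^esub> \<one>\<^bsub>W\<^esub>) \<odot>\<^bsub>M\<^esub> f e)"
  by (simp_all add: scalar_linear_maps_def)

lemma End_eqI:
  assumes "f \<in> carrier End" "g \<in> carrier End" "\<And>e. e \<in> carrier M \<Longrightarrow> f e = g e" shows "f = g"
  using assms by (intro extensionalityI[of f "carrier M" g]) (auto simp: End_mem_iff)

lemma scal_degree: "k \<in> carrier Sc \<Longrightarrow> k \<odot>\<^bsub>W\<^esub> \<one>\<^bsub>W\<^esub> \<in> degree_part D 0"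
  by (simp add: degree_simps)

lemma scal_smult_commute:
  assumes "k \<in> carrier Sc" "a \<in> degree_part D 0" "x \<in> carrier M"
  shows "(k \<odot>\<^bsub>W\<^esub> \<one>\<^bsub>W\<^esub>) \<odot>\<^bsub>M\<^esub> (a \<odot>\<^bsub>M\<^esub> x) = a \<odot>\<^bsub>M\<^esub> ((k \<odot>\<^bsub>W\<^esub> \<one>\<^bsub>W\<^esub>) \<odot>\<^bsub>M\<^esub> x)"
  using M.smult_assoc[of "k \<odot>\<^bsub>W\<^esub> \<one>\<^bsub>W\<^esub>" a x] M.smult_assoc[of a "k \<odot>\<^bsub>W\<^esub> \<one>\<^bsub>W\<^esub>" x] assms
    scalar_central[of k a]
  by (simp add: scal_degree degree_carrier)

lemma left_module_End: "left_module Sc End"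
proof -
  note sm = M.smult_closed[simplified] M.smult_r_distr[simplified] scal_degree
  have zero: "\<zero>\<^bsub>End\<^esub> \<in> carrier End"
    by (rule End_memI) (simp_all add: End_apply sm M.smult_zero_right)
  have add: "f \<oplus>\<^bsub>End\<^esub> g \<in> carrier End" if "f \<in> carrier End" "g \<in> carrier End" for f g
    by (rule End_memI) (use that in \<open>simp_all add: End_apply End_simps sm M.M.a_ac\<close>)
  have smult: "k \<odot>\<^bsub>End\<^esub> f \<in> carrier End" if f: "f \<in> carrier End" and k: "k \<in> carrier Sc" for f k
  proof (rule End_memI, goal_cases)
    case (4 l x)
    then show ?case
      using f k scal_smult_commute[OF k scal_degree[OF 4(1)], of "f x"]
      by (simp add: End_apply End_simps sm)
  qed (use f k in \<open>simp_all add: End_apply End_simps sm\<close>)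
  have neg: "(\<lambda>e\<in>carrier M. \<ominus>\<^bsub>M\<^esub> f e) \<in> carrier End" if "f \<in> carrier End" for f
    by (rule End_memI)
      (use that in \<open>simp_all add: End_simps sm M.M.minus_add M.smult_minus_right\<close>)
  note R = left_module.smult_l_distr[OF left_module_restrict_scalars]
    left_module.smult_r_distr[OF left_module_restrict_scalars]
    left_module.smult_assoc[OF left_module_restrict_scalars]
    left_module.smult_one[OF left_module_restrict_scalars]
  have "abelian_group End"
  proof (rule abelian_groupI)
    show "\<exists>g\<in>carrier End. g \<oplus>\<^bsub>End\<^esub> f = \<zero>\<^bsub>End\<^esub>" if "f \<in> carrier End" for f
      by (rule bexI[OF _ neg[OF that]])
        (use that in \<open>auto simp: End_apply End_simps M.M.l_neg restrict_def fun_eq_iff\<close>)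
    show "f \<oplus>\<^bsub>End\<^esub> g \<oplus>\<^bsub>End\<^esub> h = f \<oplus>\<^bsub>End\<^esub> (g \<oplus>\<^bsub>End\<^esub> h)"
      if "f \<in> carrier End" "g \<in> carrier End" "h \<in> carrier End" for f g h
      using that by (auto simp: End_apply End_simps M.M.a_assoc restrict_def fun_eq_iff)
    show "f \<oplus>\<^bsub>End\<^esub> g = g \<oplus>\<^bsub>End\<^esub> f" if "f \<in> carrier End" "g \<in> carrier End" for f g
      using that by (auto simp: End_apply End_simps M.M.a_comm restrict_def fun_eq_iff)
    show "\<zero>\<^bsub>End\<^esub> \<oplus>\<^bsub>End\<^esub> f = f" if "f \<in> carrier End" for f
      by (rule End_eqI[OF add[OF zero that] that]) (use that in \<open>simp add: End_apply End_simps\<close>)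
  qed (simp_all add: zero add)
  then show ?thesis
  proof (intro left_module.intro left_module_axioms.intro W.R.ring_axioms, goal_cases)
    case (2 a f) then show ?case by (simp add: smult)
  next
    case (3 a b f) then show ?case
      using R(1)[of a b] by (auto simp: End_apply End_simps restrict_def fun_eq_iff)
  next
    case (4 a f g) then show ?case
      using R(2)[of a] by (auto simp: End_apply End_simps restrict_def fun_eq_iff)
  next
    case (5 a b f) then show ?case
      using R(3)[of a b] by (auto simp: End_apply End_simps restrict_def fun_eq_iff)
  next
    case (6 f)
    then show ?case
      using R(4) by (intro End_eqI smult) (auto simp: End_apply End_simps)
  qed
qed

sublocale End: left_module "scalars D" "scalar_linear_maps D M M" by (rule left_module_End)

definition end_algebra :: "('k, 'm \<Rightarrow> 'm) module"
  where "end_algebra = End\<lparr>mult := compose (carrier M), one := (\<lambda>e\<in>carrier M. e)\<rparr>"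

lemma end_algebra_simps [simp]:
  "carrier end_algebra = carrier End" "zero end_algebra = zero End" "add end_algebra = add End"
  "smult end_algebra = smult End" "mult end_algebra = compose (carrier M)"
  "one end_algebra = (\<lambda>e\<in>carrier M. e)"
  by (simp_all add: end_algebra_def)

lemma end_algebra_minus [simp]: "a_minus end_algebra = a_minus End"
  by (simp add: a_minus_def a_inv_def fun_eq_iff)

lemma compose_End: "\<lbrakk>f \<in> carrier End; g \<in> carrier End\<rbrakk> \<Longrightarrow> compose (carrier M) f g \<in> carrier End"
  by (auto simp: End_mem_iff compose_def Pi_iff M.smult_closed scal_degree)

lemma id_End: "(\<lambda>e\<in>carrier M. e) \<in> carrier End"
  by (auto simp: End_mem_iff M.smult_closed scal_degree)

lemma end_algebra: "assoc_algebra Sc end_algebra"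
proof -
  have L: "left_module Sc end_algebra"
    by (rule End.left_module_surj[where p = "\<lambda>x. x"]) simp_all
  interpret L: left_module Sc end_algebra by (rule L)
  have "ring end_algebra"
  proof (rule ringI[OF L.M.abelian_group_axioms])
    show "monoid end_algebra"
      by (rule monoidI)
        (auto simp: compose_End id_End intro!: End_eqI, auto simp: compose_def End_simps)
  qed (auto simp: compose_End intro!: End_eqI, auto simp: compose_def End_apply End_simps)
  moreover have "compose (carrier M) (k \<odot>\<^bsub>End\<^esub> f) g = k \<odot>\<^bsub>End\<^esub> compose (carrier M) f g"
    "compose (carrier M) f (k \<odot>\<^bsub>End\<^esub> g) = k \<odot>\<^bsub>End\<^esub> compose (carrier M) f g"
    if "k \<in> carrier Sc" "f \<in> carrier End" "g \<in> carrier End" for k f g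
    using that by (auto simp: compose_def End_apply End_simps restrict_def fun_eq_iff)
  ultimately show ?thesis
    using module_of_left_module[OF W.R.is_cring L]
    by (simp add: assoc_algebra_def assoc_algebra_axioms_def)
qed

section \<open>Differential operators as a filtered subalgebra\<close>

abbreviation "Diff n \<equiv> carrier (diff_ops D M M n)"

lemma Diff_iff: "\<Delta> \<in> Diff n \<longleftrightarrow> \<Delta> \<in> carrier End \<and>
    (\<exists>\<Delta>'. lin_map A (jets D M n) M \<Delta>' \<and> (\<forall>e\<in>carrier M. \<Delta>' (prolong D M n e) = \<Delta> e))"
  by (simp add: diff_ops_def)

lemma diff_ops_eq: "diff_ops D M M n = End\<lparr>carrier := Diff n\<rparr>"
  by (simp add: diff_ops_def)

lemma Diff_submodule: "left_submodule Sc End (Diff n)"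
proof (rule left_submoduleI)
  have "lin_map A (jets D M n) M (\<lambda>_. \<zero>\<^bsub>M\<^esub>)"
    by (simp add: lin_map_def M.smult_zero_right)
  moreover have "\<forall>e\<in>carrier M. \<zero>\<^bsub>M\<^esub> = \<zero>\<^bsub>End\<^esub> e" by (simp add: End_apply)
  ultimately show "\<zero>\<^bsub>End\<^esub> \<in> Diff n" unfolding Diff_iff using End.M.zero_closed by blast
next
  fix \<Delta> \<Gamma> assume "\<Delta> \<in> Diff n" "\<Gamma> \<in> Diff n"
  then obtain \<Delta>' \<Gamma>' where l: "lin_map A (jets D M n) M \<Delta>'" "lin_map A (jets D M n) M \<Gamma>'"
    and e: "\<forall>e\<in>carrier M. \<Delta>' (prolong D M n e) = \<Delta> e" "\<forall>e\<in>carrier M. \<Gamma>' (prolong D M n e) = \<Gamma> e"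
    and c: "\<Delta> \<in> carrier End" "\<Gamma> \<in> carrier End" by (auto simp: Diff_iff)
  have "lin_map A (jets D M n) M (\<lambda>x. \<Delta>' x \<oplus>\<^bsub>M\<^esub> \<Gamma>' x)"
    using l by (auto simp: lin_map_def Pi_iff M.M.a_ac M.smult_r_distr)
  moreover have "\<forall>e\<in>carrier M. \<Delta>' (prolong D M n e) \<oplus>\<^bsub>M\<^esub> \<Gamma>' (prolong D M n e) = (\<Delta> \<oplus>\<^bsub>End\<^esub> \<Gamma>) e"
    using e by (simp add: End_apply)
  ultimately show "\<Delta> \<oplus>\<^bsub>End\<^esub> \<Gamma> \<in> Diff n" unfolding Diff_iff using End.M.a_closed[OF c] by blast
next
  fix k \<Delta> assume k: "k \<in> carrier Sc" and "\<Delta> \<in> Diff n"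
  then obtain \<Delta>' where l: "lin_map A (jets D M n) M \<Delta>'"
    and e: "\<forall>e\<in>carrier M. \<Delta>' (prolong D M n e) = \<Delta> e" and c: "\<Delta> \<in> carrier End" by (auto simp: Diff_iff)
  \<comment> \<open>Still linear over \<open>A\<close>, since scalars are central.\<close>
  have "lin_map A (jets D M n) M (\<lambda>x. (k \<odot>\<^bsub>W\<^esub> \<one>\<^bsub>W\<^esub>) \<odot>\<^bsub>M\<^esub> \<Delta>' x)"
    using l k by (auto simp: lin_map_def Pi_iff M.smult_closed scal_degree M.smult_r_distr scal_smult_commute)
  moreover have "\<forall>e\<in>carrier M. (k \<odot>\<^bsub>W\<^esub> \<one>\<^bsub>W\<^esub>) \<odot>\<^bsub>M\<^esub> \<Delta>' (prolong D M n e) = (k \<odot>\<^bsub>End\<^esub> \<Delta>) e"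
    using e by (simp add: End_apply)
  ultimately show "k \<odot>\<^bsub>End\<^esub> \<Delta> \<in> Diff n" unfolding Diff_iff using End.smult_closed[OF k c] by blast
qed (auto simp: Diff_iff)

lemma Diff_Suc: "Diff n \<subseteq> Diff (Suc n)"
proof
  fix \<Delta> assume "\<Delta> \<in> Diff n"
  then obtain \<Delta>' where l: "lin_map A (jets D M n) M \<Delta>'"
    and e: "\<forall>e\<in>carrier M. \<Delta>' (prolong D M n e) = \<Delta> e" and c: "\<Delta> \<in> carrier End" by (auto simp: Diff_iff)
  show "\<Delta> \<in> Diff (Suc n)"
    unfolding Diff_iff using c e lin_map_comp[OF jets_projection(1) l] jets_projection(2)
    by (auto simp del: prolong.simps jets.simps)
qed

lemma id_Diff: "(\<lambda>e\<in>carrier M. e) \<in> Diff 0"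
proof -
  have "inj_on (Base :: 'm \<Rightarrow> ('w, 'm) jet) (carrier M)" by (simp add: inj_on_def)
  note simps = M.transport_module_simps[OF this]
  \<comment> \<open>A 0-jet is always a \<open>Base\<close>; the value on \<open>Formal\<close> is
    arbitrary.\<close>
  have "lin_map A (jets D M 0) M (\<lambda>x. case x of Base e \<Rightarrow> e | Formal u \<Rightarrow> \<zero>\<^bsub>M\<^esub>)"
    using simps M.smult_closed by (auto simp: lin_map_def)
  then show ?thesis unfolding Diff_iff using id_End
    by (auto intro!: exI[of _ "\<lambda>x. case x of Base e \<Rightarrow> e | Formal u \<Rightarrow> \<zero>\<^bsub>M\<^esub>"])
qed

lemma Diff_compose:
  assumes "\<Gamma> \<in> Diff m" "\<Delta> \<in> Diff n" shows "compose (carrier M) \<Gamma> \<Delta> \<in> Diff (m + n)"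
proof -
  obtain \<Delta>' where \<Delta>: "lin_map A (jets D M n) M \<Delta>'" "\<forall>e\<in>carrier M. \<Delta>' (prolong D M n e) = \<Delta> e"
      "\<Delta> \<in> carrier End" using assms by (auto simp: Diff_iff)
  obtain \<Gamma>' where \<Gamma>: "lin_map A (jets D M m) M \<Gamma>'" "\<forall>e\<in>carrier M. \<Gamma>' (prolong D M m e) = \<Gamma> e"
      "\<Gamma> \<in> carrier End" using assms by (auto simp: Diff_iff)
  \<comment> \<open>Lifts start from maps into 0-jets, so the values of \<open>\<Delta>'\<close> are
    wrapped in \<open>Base\<close>.\<close>
  let ?g = "\<lambda>x. Base (\<Delta>' x)"
  have g: "lin_map A (jets D M n) (jets D M 0) ?g" by (rule lin_map_comp[OF \<Delta>(1) jets_zero(3)])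
  have "\<Gamma>' (jet_lift D M M n ?g m (prolong D M (m + n) e)) = compose (carrier M) \<Gamma> \<Delta> e"
    if e: "e \<in> carrier M" for e
    using jet_lift_prolong[where \<Delta> = \<Delta> and k = m, OF dga_module_axioms dga_module_axioms g e] \<Gamma> \<Delta> e
    by (simp add: End_simps compose_def)
  then show ?thesis
    unfolding Diff_iff using compose_End[OF \<Gamma>(3) \<Delta>(3)]
      lin_map_comp[OF jet_lift_linear[OF dga_module_axioms dga_module_axioms g] \<Gamma>(1)] by blast
qed

section \<open>Symbols and their product\<close>

abbreviation "lower n \<equiv> lower_diff_ops D M M n"

lemma lower_eq: "lower n = (case n of 0 \<Rightarrow> {\<zero>\<^bsub>End\<^esub>} | Suc m \<Rightarrow> Diff m)"
  by (simp add: lower_diff_ops_def)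

lemma lower_simps: "lower 0 = {\<zero>\<^bsub>End\<^esub>}" "lower (Suc m) = Diff m"
  by (simp_all add: lower_eq)

lemma left_module_Diff: "left_module Sc (diff_ops D M M n)"
  by (subst diff_ops_eq) (rule End.left_module_submodule[OF Diff_submodule])

sublocale Df: left_module "scalars D" "diff_ops D M M n" for n by (rule left_module_Diff)

lemma diff_ops_simps [simp]:
  "zero (diff_ops D M M n) = zero End" "add (diff_ops D M M n) = add End"
  "smult (diff_ops D M M n) = smult End"
  by (simp_all add: diff_ops_def)

lemma Diff_closed: "\<Delta> \<in> Diff n \<Longrightarrow> \<Delta> \<in> carrier End"
  by (simp add: Diff_iff)

lemma lower_submodule: "left_submodule Sc (diff_ops D M M n) (lower n)"
proof (cases n)
  case 0
  then show ?thesis using Df.M.zero_closed[of 0] End.smult_zero_right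
    by (auto simp: lower_eq left_submodule_def)
next
  case (Suc m)
  then show ?thesis using Diff_submodule[of m] Diff_Suc[of m]
    by (simp add: lower_eq left_submodule_def)
qed

lemma Diff_minus: "\<lbrakk>x \<in> Diff n; y \<in> Diff n\<rbrakk> \<Longrightarrow> x \<ominus>\<^bsub>diff_ops D M M n\<^esub> y = x \<ominus>\<^bsub>End\<^esub> y"
  by (rule End.submodule_minus_eq[OF Diff_submodule, folded diff_ops_eq])

abbreviation "\<sigma> n \<equiv> symbol_map D M M n"

lemma symbol_map_eq_iff:
  assumes "x \<in> Diff n" "y \<in> Diff n" shows "\<sigma> n x = \<sigma> n y \<longleftrightarrow> x \<ominus>\<^bsub>End\<^esub> y \<in> lower n"
  using Df.coset_eq_iff[OF lower_submodule assms] Diff_minus[OF assms] by (simp add: symbol_map_def)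

lemma symb_simps:
  shows "carrier (symb D M M n) = \<sigma> n ` Diff n"
    and "\<lbrakk>x \<in> Diff n; y \<in> Diff n\<rbrakk> \<Longrightarrow> \<sigma> n x \<oplus>\<^bsub>symb D M M n\<^esub> \<sigma> n y = \<sigma> n (x \<oplus>\<^bsub>End\<^esub> y)"
    and "\<lbrakk>k \<in> carrier Sc; x \<in> Diff n\<rbrakk> \<Longrightarrow> k \<odot>\<^bsub>symb D M M n\<^esub> \<sigma> n x = \<sigma> n (k \<odot>\<^bsub>End\<^esub> x)"
    and "\<zero>\<^bsub>symb D M M n\<^esub> = \<sigma> n \<zero>\<^bsub>End\<^esub>"
  using Df.quot_module_simps[OF lower_submodule[of n]]
  by (simp_all add: symb_def symbol_map_def[abs_def])

lemma left_module_symb: "left_module Sc (symb D M M n)"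
  unfolding symb_def by (rule Df.left_module_quot[OF lower_submodule])

lemma symbol_map_mem:
  assumes "a \<in> carrier (symb D M M n)" "x \<in> a" shows "x \<in> Diff n" "\<sigma> n x = a"
proof -
  interpret L: abelian_subgroup "lower n" "diff_ops D M M n"
    by (rule Df.additive_subgroup_left_submodule[OF lower_submodule])
  obtain y where y: "y \<in> Diff n" "a = \<sigma> n y" 
  proof -
    have "a \<in> \<sigma> n ` Diff n" using assms(1) by (simp only: symb_simps(1))
    then show thesis using that by (rule imageE)
  qed
  note y = y(1) y(2)[unfolded symbol_map_def]
  then show x: "x \<in> Diff n" using assms Df.M.a_r_coset_subset_G[OF L.a_subset y(1)] by blast
  show "\<sigma> n x = a" using L.a_repr_independence'[of x y] y assms by (simp add: symbol_map_def)
qed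

lemma symbol_map_self: "x \<in> Diff n \<Longrightarrow> x \<in> \<sigma> n x"
proof -
  interpret L: abelian_subgroup "lower n" "diff_ops D M M n"
    by (rule Df.additive_subgroup_left_submodule[OF lower_submodule])
  show "x \<in> Diff n \<Longrightarrow> x \<in> \<sigma> n x" unfolding symbol_map_def by (rule L.a_rcos_self)
qed

text \<open>In positive order this is \<open>Diff_compose\<close> with one index lowered; in order 0
  the lower part consists of the zero operator only, and composing with it on either side gives
  zero.\<close>

lemma lower_compose:
  assumes "x \<in> Diff n" "y \<in> Diff m" "x \<in> lower n \<or> y \<in> lower m"
  shows "compose (carrier M) x y \<in> lower (n + m)"
proof -
  have z: "compose (carrier M) \<zero>\<^bsub>End\<^esub> y = \<zero>\<^bsub>End\<^esub>" "compose (carrier M) x \<zero>\<^bsub>End\<^esub> = \<zero>\<^bsub>End\<^esub>"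
  proof -
    note c = Diff_closed[OF assms(1)] Diff_closed[OF assms(2)]
    have "x \<zero>\<^bsub>M\<^esub> = \<zero>\<^bsub>M\<^esub>"
      using additive_map_zero[OF M.M.abelian_group_axioms M.M.abelian_group_axioms, of x] End_simps[OF c(1)]
      by (simp add: additive_map_def)
    then show "compose (carrier M) \<zero>\<^bsub>End\<^esub> y = \<zero>\<^bsub>End\<^esub>" "compose (carrier M) x \<zero>\<^bsub>End\<^esub> = \<zero>\<^bsub>End\<^esub>"
      using c by (auto simp: compose_def End_apply End_simps restrict_def fun_eq_iff)
  qed
  have z': "\<zero>\<^bsub>End\<^esub> \<in> lower k" for k
    using lower_submodule[of k] by (simp add: left_submodule_def)
  show ?thesis
  proof (cases "x \<in> lower n")
    case True
    then show ?thesis using Diff_compose[OF _ assms(2)] z z'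
      by (cases n) (auto simp: lower_simps)
  next
    case False
    then have y: "y \<in> lower m" using assms by simp
    then show ?thesis using Diff_compose[OF assms(1)] z z'
      by (cases m) (auto simp: lower_simps)
  qed
qed

text \<open>\<open>symb_mult\<close> is a union over all pairs of representatives. The decomposition
  \<open>x' y' - x y = (x' - x) y' + x (y' - y)\<close> shows that they all have the same symbol of
  order \<open>n + m\<close>.\<close>

lemma symb_mult_eq:
  assumes a: "a \<in> carrier (symb D M M n)" "x \<in> a" and b: "b \<in> carrier (symb D M M m)" "y \<in> b"
  shows "symb_mult D M n m a b = \<sigma> (n + m) (compose (carrier M) x y)"
proof -
  interpret S: assoc_algebra Sc end_algebra by (rule end_algebra)
  note x = symbol_map_mem[OF a] and y = symbol_map_mem[OF b]
  have "\<sigma> (n + m) (compose (carrier M) x' y') = \<sigma> (n + m) (compose (carrier M) x y)"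
    if x': "x' \<in> a" and y': "y' \<in> b" for x' y'
  proof -
    note x' = symbol_map_mem[OF a(1) x'] and y' = symbol_map_mem[OF b(1) y']
    note c = Diff_closed[OF x(1)] Diff_closed[OF x'(1)] Diff_closed[OF y(1)] Diff_closed[OF y'(1)]
    have l: "x' \<ominus>\<^bsub>End\<^esub> x \<in> lower n" "y' \<ominus>\<^bsub>End\<^esub> y \<in> lower m"
      using symbol_map_eq_iff[OF x'(1) x(1)] symbol_map_eq_iff[OF y'(1) y(1)]
      unfolding x(2) x'(2) y(2) y'(2) by blast+
    have d: "x' \<ominus>\<^bsub>End\<^esub> x \<in> Diff n" "y' \<ominus>\<^bsub>End\<^esub> y \<in> Diff m"
      by (rule End.left_submodule_minus[OF Diff_submodule x'(1) x(1)]
          End.left_submodule_minus[OF Diff_submodule y'(1) y(1)])+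
    have "compose (carrier M) (x' \<ominus>\<^bsub>End\<^esub> x) y' \<oplus>\<^bsub>End\<^esub> compose (carrier M) x (y' \<ominus>\<^bsub>End\<^esub> y) \<in> lower (n + m)"
      using lower_submodule[of "n + m"] lower_compose[OF d(1) y'(1)] lower_compose[OF x(1) d(2)] l
      by (simp add: left_submodule_def)
    also have "compose (carrier M) (x' \<ominus>\<^bsub>End\<^esub> x) y' \<oplus>\<^bsub>End\<^esub> compose (carrier M) x (y' \<ominus>\<^bsub>End\<^esub> y) =
        compose (carrier M) x' y' \<ominus>\<^bsub>End\<^esub> compose (carrier M) x y"
    proof -
      \<comment> \<open>Computed in \<open>end_algebra\<close>, where the ring laws are
        available.\<close>
      have "((x' \<ominus>\<^bsub>end_algebra\<^esub> x) \<otimes>\<^bsub>end_algebra\<^esub> y') \<oplus>\<^bsub>end_algebra\<^esub> (x \<otimes>\<^bsub>end_algebra\<^esub> (y' \<ominus>\<^bsub>end_algebra\<^esub> y)) =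
          (x' \<otimes>\<^bsub>end_algebra\<^esub> y') \<ominus>\<^bsub>end_algebra\<^esub> (x \<otimes>\<^bsub>end_algebra\<^esub> y)"
      proof -
        have cs: "x \<in> carrier end_algebra" "x' \<in> carrier end_algebra" "y \<in> carrier end_algebra"
          "y' \<in> carrier end_algebra" using c by simp_all
        show ?thesis
          using cs by (simp del: end_algebra_simps end_algebra_minus
              add: a_minus_def S.l_distr S.r_distr S.l_minus S.r_minus S.a_assoc S.r_neg1)
      qed
      then show ?thesis by simp
    qed
    finally show ?thesis
      using symbol_map_eq_iff[OF Diff_compose[OF x'(1) y'(1)] Diff_compose[OF x(1) y(1)]] by simp
  qed
  then show ?thesis using a b unfolding symb_mult_def by blast
qed

end

section \<open>Quantizations\<close>

locale quantized_module = dga_module D M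
  for D :: "('k, 'w) dga" and M :: "('w, 'm) module" +
  fixes q :: "nat \<Rightarrow> ('m \<Rightarrow> 'm) set \<Rightarrow> 'm \<Rightarrow> 'm"
  assumes full: "full_quantization D M q"
begin

lemma q_mem: "a \<in> carrier (symb D M M n) \<Longrightarrow> q n a \<in> Diff n"
  and q_add: "\<lbrakk>a \<in> carrier (symb D M M n); b \<in> carrier (symb D M M n)\<rbrakk> \<Longrightarrow>
    q n (a \<oplus>\<^bsub>symb D M M n\<^esub> b) = q n a \<oplus>\<^bsub>End\<^esub> q n b"
  and q_hom: "\<lbrakk>lin_map A M M \<phi>; \<Delta> \<in> Diff n\<rbrakk> \<Longrightarrow>
    q n (\<sigma> n (compose (carrier M) \<phi> \<Delta>)) = compose (carrier M) \<phi> (q n (\<sigma> n \<Delta>))"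
  and q_section: "a \<in> carrier (symb D M M n) \<Longrightarrow> \<sigma> n (q n a) = a"
  using full by (auto simp: full_quantization_def quantization_def)

lemma symbol_map_closed: "\<Delta> \<in> Diff n \<Longrightarrow> \<sigma> n \<Delta> \<in> carrier (symb D M M n)"
  by (simp add: symb_simps)

text \<open>A quantization commutes with postcomposition by \<open>A\<close>-linear maps.
  Multiplication by a scalar is such a map, and postcomposing with it is the scalar action on
  operators.\<close>

lemma q_linear: "lin_map Sc (symb D M M n) end_algebra (q n)"
proof -
  have "q n (k \<odot>\<^bsub>symb D M M n\<^esub> a) = k \<odot>\<^bsub>End\<^esub> q n a"
    if k: "k \<in> carrier Sc" and a: "a \<in> carrier (symb D M M n)" for k a
  proof -
    let ?\<phi> = "\<lambda>x. (k \<odot>\<^bsub>W\<^esub> \<one>\<^bsub>W\<^esub>) \<odot>\<^bsub>M\<^esub> x"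
    have \<phi>: "lin_map A M M ?\<phi>"
      using k by (auto simp: lin_map_def M.smult_closed scal_degree M.smult_r_distr scal_smult_commute)
    have c: "compose (carrier M) ?\<phi> \<Delta> = k \<odot>\<^bsub>End\<^esub> \<Delta>" for \<Delta>
      by (simp add: compose_def End_apply)
    obtain \<Delta> where \<Delta>: "\<Delta> \<in> Diff n" "a = \<sigma> n \<Delta>" using a by (auto simp: symb_simps)
    then show ?thesis using q_hom[OF \<phi> \<Delta>(1)] k unfolding c by (simp add: symb_simps)
  qed
  then show ?thesis
    using q_add Diff_closed[OF q_mem] by (auto simp: lin_map_def)
qed

lemma q_symbol_lower:
  assumes "\<Delta> \<in> Diff n" shows "\<Delta> \<ominus>\<^bsub>End\<^esub> q n (\<sigma> n \<Delta>) \<in> lower n"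
  using symbol_map_eq_iff[OF assms q_mem[OF symbol_map_closed[OF assms]]]
    q_section[OF symbol_map_closed[OF assms]] by simp

text \<open>Injectivity modulo lower order is the section property of \<open>q\<close>, and the
  splitting is \<open>q_symbol_lower\<close>.\<close>

sublocale SF: split_filtration "scalars D" end_algebra "symb D M M" q Diff
proof (intro split_filtration.intro end_algebra split_filtration_axioms.intro left_module_symb
    q_linear q_mem Diff_Suc)
  show "left_submodule Sc end_algebra (Diff n)" for n
    using Diff_submodule[of n] by (simp add: left_submodule_def)
  show "\<one>\<^bsub>end_algebra\<^esub> \<in> Diff 0" using id_Diff by simp
  show "x \<otimes>\<^bsub>end_algebra\<^esub> y \<in> Diff (n + m)" if "x \<in> Diff n" "y \<in> Diff m" for x y n m
    using Diff_compose[OF that] by simp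
  have z: "x \<ominus>\<^bsub>End\<^esub> \<zero>\<^bsub>End\<^esub> = x" if "x \<in> carrier End" for x
    using that by (simp add: a_minus_def)
  show "a = \<zero>\<^bsub>symb D M M n\<^esub>"
    if "a \<in> carrier (symb D M M n)" "q n a \<in> (case n of 0 \<Rightarrow> {\<zero>\<^bsub>end_algebra\<^esub>} | Suc m \<Rightarrow> Diff m)" for a n
  proof -
    have "q n a \<in> lower n" using that by (cases n) (simp_all add: lower_simps)
    then have "\<sigma> n (q n a) = \<sigma> n \<zero>\<^bsub>End\<^esub>"
      using symbol_map_eq_iff[OF q_mem[OF that(1)], of "\<zero>\<^bsub>End\<^esub>"] Df.M.zero_closed[of n]
        z[OF Diff_closed[OF q_mem[OF that(1)]]] by simp
    then show ?thesis using q_section[OF that(1)] by (simp add: symb_simps)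
  qed
  show "\<exists>a\<in>carrier (symb D M M n). x \<ominus>\<^bsub>end_algebra\<^esub> q n a \<in>
      (case n of 0 \<Rightarrow> {\<zero>\<^bsub>end_algebra\<^esub>} | Suc m \<Rightarrow> Diff m)" if "x \<in> Diff n" for x n
    using q_symbol_lower[OF that] symbol_map_closed[OF that]
    by (cases n) (auto simp: lower_simps)
qed

text \<open>Truncation peels off the components of the decomposition from the top.\<close>

lemma truncate_mem:
  assumes "\<Delta> \<in> Diff n" "k \<le> n" shows "truncate D M q n \<Delta> k \<in> Diff k"
  using assms(2)
proof (induction k rule: inc_induct)
  case base then show ?case using assms by (simp add: truncate.simps)
next
  case (step k)
  then show ?case using q_symbol_lower[OF step.IH]
    by (subst truncate.simps) (simp add: Let_def lower_simps)
qed

text \<open>For \<open>k = n\<close> the truncation is \<open>\<Delta>\<close> itself, which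
  identifies its \<open>symbol_part\<close> family with the components that \<open>star_incl\<close>
  requires.\<close>

lemma truncate_sum:
  assumes \<Delta>: "\<Delta> \<in> Diff n"
  shows "k \<le> n \<Longrightarrow> truncate D M q n \<Delta> k = SF.qsum k (symbol_part D M q n \<Delta>)"
proof (induction k)
  case 0
  have T: "truncate D M q n \<Delta> 0 \<in> Diff 0" using truncate_mem[OF \<Delta>] by simp
  \<comment> \<open>The part below order 0 is zero, so the last truncation equals the quantization
    of its own symbol.\<close>
  have "truncate D M q n \<Delta> 0 \<ominus>\<^bsub>End\<^esub> q 0 (\<sigma> 0 (truncate D M q n \<Delta> 0)) = \<zero>\<^bsub>End\<^esub>"
    using q_symbol_lower[OF T] by (simp add: lower_simps)
  then show ?case
    using Diff_closed[OF T] Diff_closed[OF q_mem[OF symbol_map_closed[OF T]]]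
    by (simp add: End.M.minus_eq_zero_iff symbol_part_def)
next
  case (Suc k)
  let ?T = "truncate D M q n \<Delta> (Suc k)"
  have T: "?T \<in> Diff (Suc k)" using truncate_mem[OF \<Delta> Suc.prems] .
  have c: "?T \<in> carrier End" "q (Suc k) (\<sigma> (Suc k) ?T) \<in> carrier End"
    using Diff_closed[OF T] Diff_closed[OF q_mem[OF symbol_map_closed[OF T]]] by auto
  have p: "\<forall>j\<le>Suc k. symbol_part D M q n \<Delta> j \<in> carrier (symb D M M j)"
    using truncate_mem[OF \<Delta>] symbol_map_closed Suc.prems by (simp add: symbol_part_def)
  have "truncate D M q n \<Delta> k = ?T \<ominus>\<^bsub>End\<^esub> q (Suc k) (\<sigma> (Suc k) ?T)"
    using Suc.prems by (subst truncate.simps) (simp add: Let_def)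
  then have "SF.qsum k (symbol_part D M q n \<Delta>) = ?T \<ominus>\<^bsub>End\<^esub> q (Suc k) (\<sigma> (Suc k) ?T)"
    using Suc by simp
  then have "SF.qsum (Suc k) (symbol_part D M q n \<Delta>) =
      q (Suc k) (\<sigma> (Suc k) ?T) \<oplus>\<^bsub>End\<^esub> (?T \<ominus>\<^bsub>End\<^esub> q (Suc k) (\<sigma> (Suc k) ?T))"
    using SF.qsum_Suc[OF p] by (simp add: symbol_part_def)
  also have "\<dots> = ?T" using c by (simp add: a_minus_def End.M.a_lcomm End.M.r_neg)
  finally show ?case by simp
qed

section \<open>Transfer to formal polynomials of symbols\<close>

lemma symb_h_eq: "symb_h D M = SF.B"
  by (simp add: symb_h_def symb_total_def)

lemma symb_h_incl_eq: "symb_h_incl D M n a = SF.hom_incl n a"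
  by (simp add: symb_h_incl_def symb_h_cls_def symb_total_def)

lemma symb_h_below_eq: "symb_h_below D M n = SF.below n"
  by (simp add: symb_h_below_def SF.below_def symb_h_cls_def symb_total_def)

lemma star_formula:
  assumes a: "a \<in> carrier (symb D M M n)" and b: "b \<in> carrier (symb D M M m)"
  shows "SF.star (SF.hom_incl n a) (SF.hom_incl m b) = (\<Oplus>\<^bsub>SF.B\<^esub>k\<in>{0..n + m}.
    (hvar D [^]\<^bsub>UP Sc\<^esub> k) \<odot>\<^bsub>SF.B\<^esub> SF.hom_incl (n + m - k)
      (symbol_part D M q (n + m) (compose (carrier M) (q n a) (q m b)) (n + m - k)))"
proof -
  let ?\<Delta> = "compose (carrier M) (q n a) (q m b)"
  have \<Delta>: "?\<Delta> \<in> Diff (n + m)" using Diff_compose[OF q_mem[OF a] q_mem[OF b]] .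
  have "symbol_part D M q (n + m) ?\<Delta> k \<in> carrier (symb D M M k)" if "k \<le> n + m" for k
    using truncate_mem[OF \<Delta> that] symbol_map_closed by (simp add: symbol_part_def)
  moreover have "truncate D M q (n + m) ?\<Delta> (n + m) = ?\<Delta>" by (simp add: truncate.simps)
  ultimately show ?thesis
    unfolding hvar_def using truncate_sum[OF \<Delta>, of "n + m"] by (intro SF.star_incl[OF a b]) simp_all
qed

text \<open>The description in \<open>formal_star\<close> is resolved by existence and uniqueness.
  Two bilinear maps given by the same formula on homogeneous symbols agree in the second argument
  first, then in the first one; outside the carrier extensionality decides.\<close>

lemma formal_star_eq: "formal_star D M q = SF.star"
proof -
  have star: "is_formal_star D M q SF.star"
    unfolding is_formal_star_def symb_h_eq symb_h_incl_eq
  proof (intro conjI allI ballI)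
    show "SF.star \<in> carrier SF.B \<rightarrow>\<^sub>E (carrier SF.B \<rightarrow>\<^sub>E carrier SF.B)"
      using SF.star_simps(1) by (auto simp: SF.star_def PiE_iff extensional_def)
  qed (simp_all add: SF.star_linear star_formula)
  moreover have "f = SF.star" if f: "is_formal_star D M q f" for f
  proof -
    note f = f[unfolded is_formal_star_def symb_h_eq symb_h_incl_eq]
    have gen: "f (SF.hom_incl n a) (SF.hom_incl m b) = SF.star (SF.hom_incl n a) (SF.hom_incl m b)"
      if "a \<in> carrier (symb D M M n)" "b \<in> carrier (symb D M M m)" for n m a b
      using f that star_formula[OF that] by simp
    have 1: "f (SF.hom_incl n a) y = SF.star (SF.hom_incl n a) y"
      if a: "a \<in> carrier (symb D M M n)" and y: "y \<in> carrier SF.B" for n a y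
    proof (rule SF.linear_eqI[OF _ SF.star_linear(1) gen[OF a] y])
      show "lin_map (UP Sc) SF.B SF.B (f (SF.hom_incl n a))" using f SF.hom_incl_closed[OF a] by blast
    qed (rule SF.hom_incl_closed[OF a])
    have 2: "f x y = SF.star x y" if x: "x \<in> carrier SF.B" and y: "y \<in> carrier SF.B" for x y
    proof (rule SF.linear_eqI[where f = "\<lambda>x. f x y" and g = "\<lambda>x. SF.star x y", OF _ SF.star_linear(2)[OF y] 1[OF _ y] x])
      show "lin_map (UP Sc) SF.B SF.B (\<lambda>x. f x y)" using f y by blast
    qed
    have F: "f \<in> carrier SF.B \<rightarrow>\<^sub>E (carrier SF.B \<rightarrow>\<^sub>E carrier SF.B)" using f by blast
    have S: "SF.star \<in> carrier SF.B \<rightarrow>\<^sub>E (carrier SF.B \<rightarrow>\<^sub>E carrier SF.B)"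
      using star unfolding is_formal_star_def symb_h_eq by blast
    show ?thesis
    proof (rule PiE_ext[OF F S])
      fix x assume x: "x \<in> carrier SF.B"
      show "f x = SF.star x"
        by (rule PiE_ext[of _ "carrier SF.B" "\<lambda>_. carrier SF.B"]) (use F S x 2 in \<open>auto simp: PiE_iff\<close>)
    qed
  qed
  ultimately show ?thesis unfolding formal_star_def by (rule the_equality)
qed

text \<open>Truncating at the top order changes nothing, so the summand for \<open>k = 0\<close> is
  the symbol of the composition, that is, the symbol product. Each other summand contains a factor
  \<open>h\<close>.\<close>

lemma star_symbol_mult:
  assumes a: "a \<in> carrier (symb D M M n)" and b: "b \<in> carrier (symb D M M m)"
  shows "SF.hom_incl (n + m) (symb_mult D M n m a b) \<in> carrier SF.B"
    and "\<exists>x\<in>SF.below (m + n). SF.star (SF.hom_incl n a) (SF.hom_incl m b) =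
      SF.hom_incl (n + m) (symb_mult D M n m a b) \<oplus>\<^bsub>SF.B\<^esub> hvar D \<odot>\<^bsub>SF.B\<^esub> x"
proof -
  let ?N = "n + m" and ?\<Delta> = "compose (carrier M) (q n a) (q m b)"
  let ?h = "hvar D" and ?c = "symbol_part D M q (n + m) (compose (carrier M) (q n a) (q m b))"
  have \<Delta>: "?\<Delta> \<in> Diff ?N" using Diff_compose[OF q_mem[OF a] q_mem[OF b]] .
  have qa: "q n a \<in> a" and qb: "q m b \<in> b"
    using symbol_map_self[OF q_mem[OF a]] symbol_map_self[OF q_mem[OF b]] q_section a b by simp_all
  have top: "?c ?N = symb_mult D M n m a b"
    using symb_mult_eq[OF a qa b qb] by (simp add: symbol_part_def truncate.simps)
  have c: "?c k \<in> carrier (symb D M M k)" if "k \<le> ?N" for k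
    using truncate_mem[OF \<Delta> that] symbol_map_closed by (simp add: symbol_part_def)
  show t: "SF.hom_incl ?N (symb_mult D M n m a b) \<in> carrier SF.B"
    using c[of ?N] by (simp add: top SF.hom_incl_closed)
  have h: "?h \<in> carrier (UP Sc)" by (simp add: hvar_def)
  then have hk: "?h [^]\<^bsub>UP Sc\<^esub> k \<in> carrier (UP Sc)" for k :: nat
    by (rule W.UK.P.nat_pow_closed)
  let ?f = "\<lambda>k. (?h [^]\<^bsub>UP Sc\<^esub> k) \<odot>\<^bsub>SF.B\<^esub> SF.hom_incl (?N - k) (?c (?N - k))"
  \<comment> \<open>The summand with one factor \<open>h\<close> split off; this is meaningful as
    \<open>k\<close> starts at 1 in the sum \<open>?x\<close>.\<close>
  let ?g = "\<lambda>k. (?h [^]\<^bsub>UP Sc\<^esub> (k - 1)) \<odot>\<^bsub>SF.B\<^esub> SF.hom_incl (?N - k) (?c (?N - k))"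
  let ?x = "\<Oplus>\<^bsub>SF.B\<^esub>k\<in>{1..?N}. ?g k"
  have fc: "?f k \<in> carrier SF.B" "?g k \<in> carrier SF.B" for k
    using c[of "?N - k"] by (simp_all add: SF.LB.smult_closed hk SF.hom_incl_closed)
  \<comment> \<open>For \<open>k \<ge> 1\<close> the order \<open>n + m - k\<close> is strictly
    below \<open>m + n\<close>.\<close>
  have gb: "?g k \<in> SF.below (m + n)" if "k \<in> {1..?N}" for k
  proof -
    have ck: "?c (?N - k) \<in> carrier (symb D M M (?N - k))" by (rule c) simp
    have "?g k = SF.pure (direct_sum_incl (symb D M M) (?N - k) (?c (?N - k))) (?h [^]\<^bsub>UP Sc\<^esub> (k - 1))"
      using SF.pure_smult[OF SF.incl_simps[OF ck] W.UK.UP_one_closed hk] hk W.UK.P.r_one by simp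
    then show ?thesis
      using SF.incl_simps[OF ck] hk that
      by (simp del: One_nat_def) (rule SF.below_pure, auto simp: direct_sum_incl_def)
  qed
  then have x: "?x \<in> SF.below (m + n)" by (rule SF.below_finsum)
  have "?h \<odot>\<^bsub>SF.B\<^esub> ?x = (\<Oplus>\<^bsub>SF.B\<^esub>k\<in>{1..?N}. ?h \<odot>\<^bsub>SF.B\<^esub> ?g k)"
    by (rule additive_map_finsum[OF SF.LB.M.abelian_group_axioms SF.LB.M.abelian_group_axioms])
      (use h fc in \<open>auto simp: additive_map_def SF.LB.smult_closed SF.LB.smult_r_distr\<close>)
  also have "\<dots> = (\<Oplus>\<^bsub>SF.B\<^esub>k\<in>{1..?N}. ?f k)"
  proof (rule SF.LB.M.finsum_cong)
    have "?h \<odot>\<^bsub>SF.B\<^esub> ?g k = ?f k" if "k \<in> {1..?N}" for k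
    proof -
      have "?h \<otimes>\<^bsub>UP Sc\<^esub> (?h [^]\<^bsub>UP Sc\<^esub> (k - 1)) = ?h [^]\<^bsub>UP Sc\<^esub> k"
        using that h hk[of "k - 1"] W.UK.P.m_comm[of ?h "?h [^]\<^bsub>UP Sc\<^esub> (k - 1)"]
        by (cases k) simp_all
      then show ?thesis
        using SF.LB.smult_assoc[OF h hk[of "k - 1"] SF.hom_incl_closed[OF c[of "?N - k"]]] by simp
    qed
    then show "\<And>k. k \<in> {1..?N} =simp=> ?h \<odot>\<^bsub>SF.B\<^esub> ?g k = ?f k" by (simp add: simp_implies_def)
  qed (use fc h in \<open>simp_all add: Pi_iff SF.LB.smult_closed\<close>)
  finally have hx: "?h \<odot>\<^bsub>SF.B\<^esub> ?x = (\<Oplus>\<^bsub>SF.B\<^esub>k\<in>{1..?N}. ?f k)" .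
  have "(\<Oplus>\<^bsub>SF.B\<^esub>k\<in>insert 0 {1..?N}. ?f k) = ?f 0 \<oplus>\<^bsub>SF.B\<^esub> (\<Oplus>\<^bsub>SF.B\<^esub>k\<in>{1..?N}. ?f k)"
  proof (rule SF.LB.M.finsum_insert)
    show "?f \<in> {1..?N} \<rightarrow> carrier SF.B" by (rule Pi_I) (rule fc(1))
    show "?f 0 \<in> carrier SF.B" by (rule fc(1))
  qed simp_all
  moreover have "{0..?N} = insert 0 {1..?N}" by auto
  ultimately have "SF.star (SF.hom_incl n a) (SF.hom_incl m b) = ?f 0 \<oplus>\<^bsub>SF.B\<^esub> (\<Oplus>\<^bsub>SF.B\<^esub>k\<in>{1..?N}. ?f k)"
    unfolding star_formula[OF a b] by (simp only:)
  also have "?f 0 = SF.hom_incl ?N (symb_mult D M n m a b)"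
    using SF.LB.smult_one[OF t] by (simp add: top)
  finally have "SF.star (SF.hom_incl n a) (SF.hom_incl m b) =
      SF.hom_incl ?N (symb_mult D M n m a b) \<oplus>\<^bsub>SF.B\<^esub> ?h \<odot>\<^bsub>SF.B\<^esub> ?x"
    unfolding hx .
  then show "\<exists>x\<in>SF.below (m + n). SF.star (SF.hom_incl n a) (SF.hom_incl m b) =
      SF.hom_incl ?N (symb_mult D M n m a b) \<oplus>\<^bsub>SF.B\<^esub> ?h \<odot>\<^bsub>SF.B\<^esub> x"
    using x by (rule bexI)
qed

end

theorem proposition5p32:
  fixes D :: "('k, 'w) dga"
    and E :: "('w, 'e) module"
    and q :: "nat \<Rightarrow> ('e \<Rightarrow> 'e) set \<Rightarrow> 'e \<Rightarrow> 'e"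
  assumes "exterior_algebra D"
    and "left_module (alg D) E"
    and "full_quantization D E q"
  shows
    "(\<exists>u. filtered_algebra (UP (scalars D))
        ((symb_h D E)\<lparr>mult := formal_star D E q, one := u\<rparr>)
        (\<lambda>n. symb_h_below D E (Suc n))) \<and>
     (\<forall>n m. \<forall>a\<in>carrier (symb D E E n). \<forall>b\<in>carrier (symb D E E m).
        formal_star D E q (symb_h_incl D E n a) (symb_h_incl D E m b)
          \<ominus>\<^bsub>symb_h D E\<^esub> symb_h_incl D E (n + m) (symb_mult D E n m a b)
        \<in> (\<lambda>x. hvar D \<odot>\<^bsub>symb_h D E\<^esub> x) ` symb_h_below D E (m + n)) \<and>
     (\<forall>n m. \<forall>a\<in>carrier (symb D E E n). \<forall>b\<in>carrier (symb D E E m).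
        \<exists>x\<in>carrier (symb_h D E).
          formal_star D E q (symb_h_incl D E n a) (symb_h_incl D E m b)
            = symb_h_incl D E (n + m) (symb_mult D E n m a b)
              \<oplus>\<^bsub>symb_h D E\<^esub> hvar D \<odot>\<^bsub>symb_h D E\<^esub> x)"
proof -
  interpret quantized_module D E q
    using assms by (intro quantized_module.intro dga_module.intro quantized_module_axioms.intro)
  have sub: "SF.below n \<subseteq> carrier SF.B" for n by (rule SF.below_carrier)
  have hc: "hvar D \<in> carrier (UP (scalars D))" by (simp add: hvar_def)
  show ?thesis
    unfolding formal_star_eq symb_h_eq symb_h_incl_eq symb_h_below_eq
  proof (intro conjI allI ballI)
    show "\<exists>u. filtered_algebra (UP (scalars D)) (SF.B\<lparr>mult := SF.star, one := u\<rparr>) (\<lambda>n. SF.below (Suc n))"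
      using SF.star_filtered by blast
  next
    fix n m a b assume a: "a \<in> carrier (symb D E E n)" and b: "b \<in> carrier (symb D E E m)"
    note t = star_symbol_mult[OF a b]
    obtain x where x: "x \<in> SF.below (m + n)" "SF.star (SF.hom_incl n a) (SF.hom_incl m b) =
        SF.hom_incl (n + m) (symb_mult D E n m a b) \<oplus>\<^bsub>SF.B\<^esub> hvar D \<odot>\<^bsub>SF.B\<^esub> x"
      using t(2) by blast
    then have xc: "hvar D \<odot>\<^bsub>SF.B\<^esub> x \<in> carrier SF.B" using SF.LB.smult_closed[OF hc] sub by blast
    then have "SF.star (SF.hom_incl n a) (SF.hom_incl m b) \<ominus>\<^bsub>SF.B\<^esub>
        SF.hom_incl (n + m) (symb_mult D E n m a b) = hvar D \<odot>\<^bsub>SF.B\<^esub> x"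
      using t(1) unfolding x(2)
      by (simp add: a_minus_def SF.LB.M.a_comm[of _ "hvar D \<odot>\<^bsub>SF.B\<^esub> x"] SF.LB.M.a_assoc SF.LB.M.r_neg)
    then show "SF.star (SF.hom_incl n a) (SF.hom_incl m b) \<ominus>\<^bsub>SF.B\<^esub>
        SF.hom_incl (n + m) (symb_mult D E n m a b) \<in> (\<lambda>x. hvar D \<odot>\<^bsub>SF.B\<^esub> x) ` SF.below (m + n)"
      using x(1) by (rule image_eqI)
    show "\<exists>x\<in>carrier SF.B. SF.star (SF.hom_incl n a) (SF.hom_incl m b) =
        SF.hom_incl (n + m) (symb_mult D E n m a b) \<oplus>\<^bsub>SF.B\<^esub> hvar D \<odot>\<^bsub>SF.B\<^esub> x"
      using x sub by blast
  qed
qed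

end
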